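(* Let $1\le N<sp$, $p\ge 2$, and let $h:\Omega\times\mathbb{R}\to\mathbb{R}$ be a Carathéodory function such that for all $R>0$ the function $x\mapsto\sup_{|\xi|\le R}|h(x,\xi)|$ belongs to $L^1(\Omega)$. Put $H(x,\xi):=\int_0^{\xi}h(x,\tau)\,d\tau$ for $(x,\xi)\in\Omega\times\mathbb{R}$. Assume that: (1) there exist a positive constant $t<p$ and a function $\mu\in L^1(\Omega)$ such that $H(x,\xi)\le\mu(x)(1+|\xi|^t)$ for almost every $x\in\Omega$ and every $\xi\in\mathbb{R}$; (2) there exist two positive constants $\gamma$ and $\eta$, with $\eta>\gamma$, such that, setting $\Gamma:=\int_\Omega\sup_{|\xi|\le\gamma}H(x,\xi)\,dx$ (with $\Gamma\neq 0$, since it appears in a denominator below), one has $$\frac{\int_\Omega H(x,\eta)\,dx}{\eta^p}>\bigl(1+c^p\|a\|_{L^1(\Omega)}\bigr)\frac{\Gamma}{\gamma^p}.$$ Then, for each parameter $$\lambda\in\left(\frac{\eta^p\|a\|_{L^1(\Omega)}}{p\int_\Omega H(x,\eta)\,dx-p\Gamma},\ \frac{\gamma^p}{p\,c^p\,\Gamma}\right),$$ the problem $$(-\Delta)^s_pu+a(x)|u|^{p-2}u=\lambda h(x,u)\ \text{ in }\Omega,\qquad \mathcal{N}_{s,p}u=0\ \text{ in }\mathbb{R}^N\setminus\overline{\Omega}$$ possesses at least three weak solutions in $W^{s,p}_\Omega$.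
   Context: Standing assumptions: $\Omega\subset\mathbb{R}^N$ is a non-empty bounded open set with boundary of class $C^1$, $N\ge1$, $0<s<1$, $a\in L^\infty(\Omega)$ with $\operatorname{ess\,inf}_{x\in\Omega}a(x)>0$, and $\lambda$ is a positive real parameter. Operators (normalizing constant set equal to 1): $(-\Delta)^s_pu(x)=\mathrm{P.V.}\int_{\mathbb{R}^N}\frac{|u(x)-u(y)|^{p-2}(u(x)-u(y))}{|x-y|^{N+sp}}\,dy$, and $\mathcal{N}_{s,p}u(x)=\int_\Omega\frac{|u(x)-u(y)|^{p-2}(u(x)-u(y))}{|x-y|^{N+sp}}\,dy$ for $x\in\mathbb{R}^N\setminus\overline{\Omega}$. Function space: let $T(\Omega):=\mathbb{R}^{2N}\setminus(\mathbb{R}^N\setminus\Omega)^2$. For measurable $u:\mathbb{R}^N\to\mathbb{R}$ set $$\|u\|:=\left(\int_\Omega a(x)|u|^p\,dx+\frac12\int_{T(\Omega)}\frac{|u(x)-u(y)|^p}{|x-y|^{N+sp}}\,dx\,dy\right)^{1/p},$$ and $W^{s,p}_\Omega:=\{u:\mathbb{R}^N\to\mathbb{R}\text{ measurable}:\|u\|<\infty\}$, a reflexive Banach space (functions identified when equal a.e.). Weak solution: $u\in W^{s,p}_\Omega$ is a weak solution of the problem if for every $v\in W^{s,p}_\Omega$ $$\frac12\int_{T(\Omega)}\frac{|u(x)-u(y)|^{p-2}(u(x)-u(y))(v(x)-v(y))}{|x-y|^{N+ps}}\,dx\,dy+\int_\Omega a(x)|u|^{p-2}uv\,dx=\lambda\int_\Omega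 h(x,u)v\,dx.$$ Constant $c$: when $N<sp$ the space $W^{s,p}_\Omega$ embeds compactly in $C(\overline\Omega)$, and $c:=\sup_{u\in W^{s,p}_\Omega\setminus\{0\}}\frac{\|u\|_{L^\infty(\Omega)}}{\|u\|}<\infty$. *)

theory Defs
  imports "HOL-Analysis.Analysis" "HOL-Probability.Essential_Supremum"
begin

text \<open>
  The ambient space \<open>\<real>\<^sup>N\<close> is a type \<open>'a::euclidean_space\<close>, so that
  \<open>N = DIM('a) \<ge> 1\<close>. A function on \<open>\<Omega>\<close> is a function on the whole type that is only looked at
  through \<open>lebesgue_on \<Omega>\<close>.
\<close>

definition C1_function :: "('a::euclidean_space \<Rightarrow> real) \<Rightarrow> bool" where
  "C1_function g \<longleftrightarrow> (\<exists>G :: 'a \<Rightarrow> 'a.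
     continuous_on UNIV G \<and> (\<forall>x. (g has_derivative (\<lambda>v. G x \<bullet> v)) (at x)))"

text \<open>
  Near each boundary point, \<open>\<Omega>\<close> lies strictly above the graph of a \<open>C\<^sup>1\<close> function. The vector
  \<open>e\<close> is the direction of the last coordinate axis after a rotation, \<open>x \<bullet> e\<close> is the last coordinate
  of \<open>x\<close>, and \<open>x - (x \<bullet> e) *\<^sub>R e\<close> is the point of the hyperplane orthogonal to \<open>e\<close> that stands for the
  remaining \<open>N - 1\<close> coordinates. Only the values of \<open>g\<close> on that hyperplane matter.
\<close>

definition C1_boundary :: "'a::euclidean_space set \<Rightarrow> bool" where
  "C1_boundary \<Omega> \<longleftrightarrow> (\<forall>z \<in> frontier \<Omega>. \<exists>r e g. 0 < r \<and> norm e = 1 \<and> C1_function g \<and>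
     \<Omega> \<inter> ball z r = {x \<in> ball z r. g (x - (x \<bullet> e) *\<^sub>R e) < x \<bullet> e})"

definition Linfty_norm :: "'a::euclidean_space set \<Rightarrow> ('a \<Rightarrow> real) \<Rightarrow> ereal" where
  "Linfty_norm \<Omega> f = esssup (lebesgue_on \<Omega>) (\<lambda>x. ereal \<bar>f x\<bar>)"

definition in_Linfty :: "'a::euclidean_space set \<Rightarrow> ('a \<Rightarrow> real) \<Rightarrow> bool" where
  "in_Linfty \<Omega> f \<longleftrightarrow> f \<in> borel_measurable (lebesgue_on \<Omega>) \<and> Linfty_norm \<Omega> f < \<infinity>"

definition ess_inf :: "'a::euclidean_space set \<Rightarrow> ('a \<Rightarrow> real) \<Rightarrow> ereal" where
  "ess_inf \<Omega> f = - esssup (lebesgue_on \<Omega>) (\<lambda>x. - ereal (f x))"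

definition L1_norm :: "'a::euclidean_space set \<Rightarrow> ('a \<Rightarrow> real) \<Rightarrow> real" where
  "L1_norm \<Omega> f = (LINT x|lebesgue_on \<Omega>. \<bar>f x\<bar>)"

definition T_set :: "'a::euclidean_space set \<Rightarrow> ('a \<times> 'a) set" where
  "T_set \<Omega> = UNIV - (UNIV - \<Omega>) \<times> (UNIV - \<Omega>)"

text \<open>The \<open>p\<close>-th power of the norm, with values in \<open>[0, \<infinity>]\<close>.\<close>

definition W_energy ::
  "'a::euclidean_space set \<Rightarrow> ('a \<Rightarrow> real) \<Rightarrow> real \<Rightarrow> real \<Rightarrow> ('a \<Rightarrow> real) \<Rightarrow> ennreal" where
  "W_energy \<Omega> a s p u =
     (\<integral>\<^sup>+x. ennreal (a x * \<bar>u x\<bar> powr p) \<partial>lebesgue_on \<Omega>) +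
     ennreal (1 / 2) * (\<integral>\<^sup>+(x, y) \<in> T_set \<Omega>.
        ennreal (\<bar>u x - u y\<bar> powr p / norm (x - y) powr (real DIM('a) + s * p))
        \<partial>(lebesgue \<Otimes>\<^sub>M lebesgue))"

definition W_norm ::
  "'a::euclidean_space set \<Rightarrow> ('a \<Rightarrow> real) \<Rightarrow> real \<Rightarrow> real \<Rightarrow> ('a \<Rightarrow> real) \<Rightarrow> real" where
  "W_norm \<Omega> a s p u = enn2real (W_energy \<Omega> a s p u) powr (1 / p)"

text \<open>
  The members are functions, not classes modulo equality almost everywhere; this identification is
  made wherever distinctness or \<open>u \<noteq> 0\<close> is at stake.
\<close>

definition W_space ::
  "'a::euclidean_space set \<Rightarrow> ('a \<Rightarrow> real) \<Rightarrow> real \<Rightarrow> real \<Rightarrow> ('a \<Rightarrow> real) set" where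
  "W_space \<Omega> a s p = {u \<in> borel_measurable lebesgue. W_energy \<Omega> a s p u < \<infinity>}"

text \<open>
  The supremum is taken in the extended reals; for a bounded \<open>C\<^sup>1\<close> domain and \<open>N < s p\<close> it is a
  positive real, by the embedding of the space into \<open>C(closure \<Omega>)\<close>.
\<close>

definition embedding_const ::
  "'a::euclidean_space set \<Rightarrow> ('a \<Rightarrow> real) \<Rightarrow> real \<Rightarrow> real \<Rightarrow> real" where
  "embedding_const \<Omega> a s p = real_of_ereal
     (SUP u \<in> {u \<in> W_space \<Omega> a s p. \<not> (AE x in lebesgue. u x = 0)}.
        Linfty_norm \<Omega> u / ereal (W_norm \<Omega> a s p u))"

definition caratheodory :: "'a::euclidean_space set \<Rightarrow> ('a \<Rightarrow> real \<Rightarrow> real) \<Rightarrow> bool" where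
  "caratheodory \<Omega> h \<longleftrightarrow>
     (\<forall>\<xi>. (\<lambda>x. h x \<xi>) \<in> borel_measurable (lebesgue_on \<Omega>)) \<and>
     (AE x in lebesgue_on \<Omega>. continuous_on UNIV (h x))"

text \<open>The interval integral is oriented, hence this is also the intended value for \<open>\<xi> < 0\<close>.\<close>

definition primitive :: "('a \<Rightarrow> real \<Rightarrow> real) \<Rightarrow> 'a \<Rightarrow> real \<Rightarrow> real" where
  "primitive h x \<xi> = (LBINT \<tau>=0..\<xi>. h x \<tau>)"

text \<open>
  The map \<open>t \<mapsto> |t|\<^bsup>p - 2\<^esup> t\<close>. Isabelle has \<open>0 powr q = 0\<close> even for \<open>q = 0\<close>; the factor \<open>t\<close> makes
  this harmless.
\<close>

definition p_pow :: "real \<Rightarrow> real \<Rightarrow> real" where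
  "p_pow p t = \<bar>t\<bar> powr (p - 2) * t"

text \<open>
  Weak solutions of \<open>(-\<Delta>)\<^sup>s\<^sub>p u + a |u|\<^bsup>p - 2\<^esup> u = \<lambda> h(x, u)\<close> in \<open>\<Omega>\<close> with the nonlocal Neumann
  condition \<open>\<N>\<^sub>s\<^sub>,\<^sub>p u = 0\<close> outside \<open>closure \<Omega>\<close>. The two integrals on the left converge absolutely for
  all \<open>u, v\<close> in the space, and so does the one on the right when \<open>N < s p\<close> and
  \<open>sup\<^bsub>|\<xi>| \<le> R\<^esub> |h(x, \<xi>)|\<close> is integrable over \<open>\<Omega>\<close> for every \<open>R\<close>, because \<open>u\<close> and \<open>v\<close> are then
  essentially bounded on \<open>\<Omega>\<close>.
\<close>

definition weak_solution ::
  "'a::euclidean_space set \<Rightarrow> ('a \<Rightarrow> real) \<Rightarrow> real \<Rightarrow> real \<Rightarrow> real \<Rightarrow> ('a \<Rightarrow> real \<Rightarrow> real)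
     \<Rightarrow> ('a \<Rightarrow> real) \<Rightarrow> bool" where
  "weak_solution \<Omega> a s p lam h u \<longleftrightarrow> u \<in> W_space \<Omega> a s p \<and>
     (\<forall>v \<in> W_space \<Omega> a s p.
        1 / 2 * (LINT (x, y) : T_set \<Omega> | lebesgue \<Otimes>\<^sub>M lebesgue.
            p_pow p (u x - u y) * (v x - v y) / norm (x - y) powr (real DIM('a) + p * s)) +
        (LINT x|lebesgue_on \<Omega>. a x * p_pow p (u x) * v x)
        = lam * (LINT x|lebesgue_on \<Omega>. h x (u x) * v x))"

end

theory Submission
  imports Defs "HOL-Complex_Analysis.Great_Picard" "HOL-Library.Function_Algebras"
begin

text \<open>
  Write \<open>energy u\<close> for the \<open>p\<close>-th power of the norm and \<open>I u = energy u / p - \<lambda> * \<integral> H(x, u)\<close> for the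
  functional of the problem. On the ball \<open>energy u / p \<le> r\<close> with \<open>r = \<gamma> powr p / (p * c powr p)\<close> every
  \<open>u\<close> satisfies \<open>\<bar>u\<bar> \<le> \<gamma>\<close> almost everywhere on \<open>\<Omega>\<close>, by the definition of \<open>c\<close>, so that the potential is
  at most \<open>\<lambda> * \<Gamma>\<close> there. The upper bound on \<open>\<lambda>\<close> makes \<open>I\<close> at least \<open>r - \<lambda> * \<Gamma> > 0 = I 0\<close> on the sphere
  \<open>energy u / p = r\<close>, and the lower bound on \<open>\<lambda>\<close> puts the value of \<open>I\<close> at the constant \<open>\<eta>\<close> below
  \<open>- \<lambda> * \<Gamma>\<close>, hence below all values of \<open>I\<close> in the ball. Thus \<open>I\<close> has two wells separated by a
  barrier: one solution has nearly minimal value inside the ball, one has nearly minimal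
  value overall and lies outside, and a third one is a mountain pass between \<open>0\<close> and \<open>\<eta>\<close>, at a level
  above the other two (lemma \<open>three_equilibria\<close>).

  The critical points are found without the dual space. Freezing the nonlinearity at \<open>u\<close> leaves the
  strictly convex problem of minimising \<open>energy v / p - \<lambda> * \<integral> h(x, u) * v\<close> over \<open>v\<close>. Clarkson's
  inequality makes minimising sequences Cauchy, so there is a minimiser, called the response of \<open>u\<close>, and
  it depends continuously on \<open>u\<close>. A function equal to its own response is a weak solution, since the
  Euler equation of the convex problem is then the weak formulation
  (\<open>equilibrium_imp_weak_solution\<close>). Moreover \<open>I\<close> decreases along the segment from \<open>u\<close> to its
  response, because the energy lies below its chord and \<open>h\<close> is uniformly continuous for bounded data.
  The rate is uniform on a bounded set unless that set has an equilibrium in its closure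
  (\<open>descent_or_equilibrium\<close>). This yields almost minimal equilibria as well as the mountain pass:
  one push of an almost optimal curve towards the responses of its points would lower its maximum
  below the minimax level, and no flow needs to be integrated.

  The dichotomy rests on two properties of the function space. It is complete: a sequence with rapidly
  decreasing successive energies converges almost everywhere on \<open>\<Omega>\<close> by the local term, and then on
  the whole space because its increments converge over almost all pairs meeting \<open>\<Omega>\<close>
  (\<open>energy_complete\<close>). And a bounded sequence has a subsequence converging almost everywhere on
  \<open>\<Omega>\<close> (\<open>AE_convergent_subsequence\<close>): it is uniformly bounded there, its local means converge along
  a diagonal subsequence, and the nonlocal energy bounds the distance of a function from its means.
  Dominated convergence then turns convergence almost everywhere into convergence of the linear
  forms \<open>v \<mapsto> \<integral> h(x, u) * v\<close>.
\<close>

section \<open>Two inequalities for powers of real numbers\<close>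

lemma abs_powr_convex:
  fixes x y p t :: real
  assumes p: "1 \<le> p" and t: "0 \<le> t" "t \<le> 1"
  shows "\<bar>(1 - t) * x + t * y\<bar> powr p \<le> (1 - t) * \<bar>x\<bar> powr p + t * \<bar>y\<bar> powr p"
proof -
  have small: "s powr p \<le> s" if "0 \<le> s" "s \<le> 1" for s :: real
    using powr_mono'[of 1 p s] that p by (cases "s = 0") auto
  have nonneg: "((1 - t) * a + t * b) powr p \<le> (1 - t) * a powr p + t * b powr p"
    if a: "0 \<le> a" and b: "0 \<le> b" for a b :: real
  proof -
    consider "a = 0" | "b = 0" | "0 < a" "0 < b"
      using a b by linarith
    then show ?thesis
    proof cases
      case 1
      then show ?thesis
        using mult_right_mono[OF small[OF t], of "b powr p"] b t p by (simp add: powr_mult)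
    next
      case 2
      then show ?thesis
        using mult_right_mono[OF small[of "1 - t"], of "a powr p"] a t p by (simp add: powr_mult)
    next
      case 3
      then show ?thesis
        using convex_onD[OF powr_convex[OF p], of t a b] t by (simp add: algebra_simps)
    qed
  qed
  have "\<bar>(1 - t) * x + t * y\<bar> \<le> (1 - t) * \<bar>x\<bar> + t * \<bar>y\<bar>"
    using abs_triangle_ineq[of "(1 - t) * x" "t * y"] t by (simp add: abs_mult)
  then have "\<bar>(1 - t) * x + t * y\<bar> powr p \<le> ((1 - t) * \<bar>x\<bar> + t * \<bar>y\<bar>) powr p"
    using p by (intro powr_mono2) auto
  also have "\<dots> \<le> (1 - t) * \<bar>x\<bar> powr p + t * \<bar>y\<bar> powr p"
    by (rule nonneg) auto
  finally show ?thesis .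
qed

text \<open>
  Clarkson's inequality is the parallelogram law, raised to the power \<open>p / 2 \<ge> 1\<close>: such powers are
  superadditive on the left of the law and convex on its right.
\<close>

lemma clarkson_real:
  fixes x y p :: real
  assumes p: "2 \<le> p"
  shows "\<bar>(x + y) / 2\<bar> powr p + \<bar>(x - y) / 2\<bar> powr p \<le> (\<bar>x\<bar> powr p + \<bar>y\<bar> powr p) / 2"
proof -
  have square: "(z\<^sup>2) powr (p / 2) = \<bar>z\<bar> powr p" for z :: real
  proof (cases "z = 0")
    case False
    then have "(z\<^sup>2) powr (p / 2) = (\<bar>z\<bar> powr 2) powr (p / 2)"
      by (simp add: powr_numeral)
    then show ?thesis
      by (simp add: powr_powr del: powr_numeral)
  qed simp
  have superadd: "A powr q + B powr q \<le> (A + B) powr q"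
    if "0 \<le> A" "0 \<le> B" "1 \<le> q" for A B q :: real
  proof (cases "A + B = 0")
    case True
    then show ?thesis
      using that by (simp add: add_nonneg_eq_0_iff)
  next
    case False
    then have S: "0 < A + B"
      using that by linarith
    have "s powr q \<le> s" if "0 \<le> s" "s \<le> 1" for s :: real
      using powr_mono'[of 1 q s] that \<open>1 \<le> q\<close> by (cases "s = 0") auto
    from this[of "A / (A + B)"] this[of "B / (A + B)"]
    have "(A / (A + B)) powr q + (B / (A + B)) powr q \<le> A / (A + B) + B / (A + B)"
      using S that by (auto intro!: add_mono)
    also have "\<dots> = 1"
      using S by (simp add: add_divide_distrib[symmetric])
    finally show ?thesis
      using S that by (simp add: powr_divide field_simps)
  qed
  have "\<bar>(x + y) / 2\<bar> powr p + \<bar>(x - y) / 2\<bar> powr p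
      \<le> (((x + y) / 2)\<^sup>2 + ((x - y) / 2)\<^sup>2) powr (p / 2)"
    using superadd[of "((x + y) / 2)\<^sup>2" "((x - y) / 2)\<^sup>2" "p / 2"] p
    unfolding square by simp
  also have "((x + y) / 2)\<^sup>2 + ((x - y) / 2)\<^sup>2 = (1 - 1/2) * x\<^sup>2 + 1/2 * y\<^sup>2"
    by (simp add: power2_eq_square field_simps)
  also have "\<dots> powr (p / 2) \<le> (1 - 1/2) * (x\<^sup>2) powr (p / 2) + 1/2 * (y\<^sup>2) powr (p / 2)"
    using abs_powr_convex[of "p / 2" "1/2" "x\<^sup>2" "y\<^sup>2"] p by simp
  finally show ?thesis
    unfolding square by simp
qed

section \<open>Uniformly convex energies\<close>

text \<open>
  \<open>E\<close> plays the role of the \<open>p\<close>-th power of a seminorm. Vectors of energy \<open>0\<close> are not identified with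
  \<open>0\<close>, so limits and minimisers are unique only up to energy \<open>0\<close>.
\<close>

locale convex_energy =
  fixes V :: "'v::real_vector set" and E :: "'v \<Rightarrow> real" and p :: real
  assumes subspace_V: "subspace V"
    and p_ge_2: "2 \<le> p"
    and E_nonneg: "0 \<le> E u"
    and E_scale: "u \<in> V \<Longrightarrow> E (c *\<^sub>R u) = \<bar>c\<bar> powr p * E u"
    and E_convex: "u \<in> V \<Longrightarrow> v \<in> V \<Longrightarrow> 0 \<le> t \<Longrightarrow> t \<le> 1 \<Longrightarrow>
      E ((1 - t) *\<^sub>R u + t *\<^sub>R v) \<le> (1 - t) * E u + t * E v"
    and E_clarkson: "u \<in> V \<Longrightarrow> v \<in> V \<Longrightarrow>
      E ((1/2) *\<^sub>R (u + v)) + E ((1/2) *\<^sub>R (u - v)) \<le> (E u + E v) / 2"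
    and E_complete: "(\<And>n. s n \<in> V) \<Longrightarrow> (\<And>\<epsilon>. 0 < \<epsilon> \<Longrightarrow> \<exists>M. \<forall>m\<ge>M. \<forall>n\<ge>M. E (s m - s n) < \<epsilon>) \<Longrightarrow>
      \<exists>w\<in>V. (\<lambda>n. E (s n - w)) \<longlonglongrightarrow> 0"
begin

definition nrm :: "'v \<Rightarrow> real" where
  "nrm u = E u powr (1 / p)"

lemma p_pos: "0 < p"
  using p_ge_2 by simp

lemmas V_closed [simp, intro] =
  subspace_0[OF subspace_V] subspace_add[OF subspace_V] subspace_diff[OF subspace_V]
  subspace_scale[OF subspace_V] subspace_neg[OF subspace_V]

lemma nrm_nonneg [simp]: "0 \<le> nrm u"
  by (simp add: nrm_def)

lemma nrm_powr: "nrm u powr p = E u"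
  using p_pos E_nonneg by (simp add: nrm_def powr_powr)

lemma nrm_le_iff: "0 \<le> R \<Longrightarrow> nrm u \<le> R \<longleftrightarrow> E u \<le> R powr p"
  using p_pos powr_mono2[of p "nrm u" R] powr_less_mono2[of p R "nrm u"]
  by (fastforce simp: nrm_powr not_le[symmetric])

lemma E_minus_commute: "u \<in> V \<Longrightarrow> v \<in> V \<Longrightarrow> E (u - v) = E (v - u)"
  using E_scale[of "v - u" "-1"] by simp

lemma E_0 [simp]: "E 0 = 0"
  using E_scale[of 0 0] p_pos by simp

lemma nrm_scale: "u \<in> V \<Longrightarrow> nrm (c *\<^sub>R u) = \<bar>c\<bar> * nrm u"
  using p_pos E_nonneg by (simp add: nrm_def E_scale powr_mult powr_powr)

lemma nrm_minus_commute: "u \<in> V \<Longrightarrow> v \<in> V \<Longrightarrow> nrm (u - v) = nrm (v - u)"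
  by (simp add: nrm_def E_minus_commute)

text \<open>
  Minkowski's inequality follows from convexity and homogeneity, because \<open>u + v\<close> is a multiple of a
  convex combination of the normalised vectors. The slack \<open>e\<close> avoids dividing by a vanishing norm.
\<close>

lemma nrm_triangle:
  assumes u: "u \<in> V" and v: "v \<in> V"
  shows "nrm (u + v) \<le> nrm u + nrm v"
proof (rule field_le_epsilon)
  fix e :: real
  assume e: "0 < e"
  define a b where "a = nrm u + e / 2" and "b = nrm v + e / 2"
  have pos: "0 < a" "0 < b"
    unfolding a_def b_def by (rule add_nonneg_pos, use e in simp_all)+
  define t where "t = b / (a + b)"
  have t: "0 \<le> t" "t \<le> 1" "1 - t = a / (a + b)"
    using pos by (auto simp: t_def field_simps)
  have unit: "E ((1 / r) *\<^sub>R w) \<le> 1" if "w \<in> V" "nrm w \<le> r" "0 < r" for w r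
  proof -
    have "nrm ((1 / r) *\<^sub>R w) \<le> 1"
      using that by (simp add: nrm_scale)
    then show ?thesis
      by (simp add: nrm_le_iff)
  qed
  have "E ((1 / (a + b)) *\<^sub>R (u + v)) = E ((1 - t) *\<^sub>R ((1 / a) *\<^sub>R u) + t *\<^sub>R ((1 / b) *\<^sub>R v))"
    unfolding t(3) using pos by (simp add: t_def scaleR_add_right)
  also have "\<dots> \<le> (1 - t) * E ((1 / a) *\<^sub>R u) + t * E ((1 / b) *\<^sub>R v)"
    using u v t by (intro E_convex) auto
  also have "\<dots> \<le> (1 - t) * 1 + t * 1"
    using u v t pos e by (intro add_mono mult_left_mono unit) (auto simp: a_def b_def)
  finally have "nrm ((1 / (a + b)) *\<^sub>R (u + v)) \<le> 1"
    by (simp add: nrm_le_iff)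
  then have "nrm (u + v) \<le> a + b"
    using u v pos by (simp add: nrm_scale)
  then show "nrm (u + v) \<le> nrm u + nrm v + e"
    by (simp add: a_def b_def)
qed

lemma nrm_diff_bound: "u \<in> V \<Longrightarrow> v \<in> V \<Longrightarrow> \<bar>nrm u - nrm v\<bar> \<le> nrm (u - v)"
  using nrm_triangle[of "u - v" v] nrm_triangle[of "v - u" u] nrm_minus_commute[of u v] by auto

lemma nrm_triangle_diff: "u \<in> V \<Longrightarrow> v \<in> V \<Longrightarrow> w \<in> V \<Longrightarrow> nrm (u - w) \<le> nrm (u - v) + nrm (v - w)"
  using nrm_triangle[of "u - v" "v - w"] by simp

lemma E_tendsto_0_iff: "(\<lambda>n. E (s n)) \<longlonglongrightarrow> 0 \<longleftrightarrow> (\<lambda>n. nrm (s n)) \<longlonglongrightarrow> 0"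
proof
  assume "(\<lambda>n. E (s n)) \<longlonglongrightarrow> 0"
  then have "(\<lambda>n. E (s n) powr (1 / p)) \<longlonglongrightarrow> 0 powr (1 / p)"
    using p_pos E_nonneg by (intro tendsto_powr') auto
  then show "(\<lambda>n. nrm (s n)) \<longlonglongrightarrow> 0"
    by (simp add: nrm_def)
next
  assume "(\<lambda>n. nrm (s n)) \<longlonglongrightarrow> 0"
  then have "(\<lambda>n. nrm (s n) powr p) \<longlonglongrightarrow> 0 powr p"
    using p_pos by (intro tendsto_powr') auto
  then show "(\<lambda>n. E (s n)) \<longlonglongrightarrow> 0"
    by (simp add: nrm_powr)
qed

lemma nrm_tendsto:
  assumes s: "\<And>n. s n \<in> V" and w: "w \<in> V" and lim: "(\<lambda>n. E (s n - w)) \<longlonglongrightarrow> 0"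
  shows "(\<lambda>n. nrm (s n)) \<longlonglongrightarrow> nrm w"
proof -
  have "(\<lambda>n. nrm (s n) - nrm w) \<longlonglongrightarrow> 0"
    using lim unfolding E_tendsto_0_iff
    by (rule Lim_null_comparison[rotated]) (use s w nrm_diff_bound in auto)
  then show ?thesis
    by (simp add: LIM_zero_iff)
qed

lemma E_tendsto:
  assumes "\<And>n. s n \<in> V" "w \<in> V" "(\<lambda>n. E (s n - w)) \<longlonglongrightarrow> 0"
  shows "(\<lambda>n. E (s n)) \<longlonglongrightarrow> E w"
proof -
  have "(\<lambda>n. nrm (s n) powr p) \<longlonglongrightarrow> nrm w powr p"
    using nrm_tendsto[OF assms] p_pos by (intro tendsto_powr') auto
  then show ?thesis
    by (simp add: nrm_powr)
qed

lemma E_halving: "u \<in> V \<Longrightarrow> E ((1/2) *\<^sub>R u) = E u / 2 powr p"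
  using E_scale[of u "1/2"] by (simp add: powr_divide)

lemma nrm_complete:
  assumes s: "\<And>n. s n \<in> V"
    and cauchy: "\<And>\<epsilon>. 0 < \<epsilon> \<Longrightarrow> \<exists>M. \<forall>m\<ge>M. \<forall>n\<ge>M. nrm (s m - s n) < \<epsilon>"
  shows "\<exists>w\<in>V. (\<lambda>n. E (s n - w)) \<longlonglongrightarrow> 0"
proof (rule E_complete[OF s])
  fix \<epsilon> :: real
  assume \<epsilon>: "0 < \<epsilon>"
  obtain M where M: "\<forall>m\<ge>M. \<forall>n\<ge>M. nrm (s m - s n) < \<epsilon> powr (1 / p)"
    using cauchy[of "\<epsilon> powr (1 / p)"] \<epsilon> by auto
  have "E (s m - s n) < \<epsilon>" if "M \<le> m" "M \<le> n" for m n
  proof -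
    have "nrm (s m - s n) powr p < (\<epsilon> powr (1 / p)) powr p"
      using M that p_pos by (intro powr_less_mono2) auto
    then show ?thesis
      using p_pos \<epsilon> by (simp add: nrm_powr powr_powr)
  qed
  then show "\<exists>M. \<forall>m\<ge>M. \<forall>n\<ge>M. E (s m - s n) < \<epsilon>"
    by blast
qed

text \<open>
  The constant by which Clarkson's inequality makes \<open>\<lambda>v. E v / p\<close> strongly convex.
\<close>

definition modulus :: real where
  "modulus = 2 / (p * 2 powr p)"

lemma modulus_pos: "0 < modulus"
  using p_pos by (simp add: modulus_def)

text \<open>
  Uniform convexity makes every minimising sequence of \<open>E v / p - f v\<close> a Cauchy sequence, so the
  minimum is attained; and the value grows at least like the energy of the distance to the minimiser.
\<close>

lemma minimiser_exists:
  assumes add: "\<And>u v. u \<in> V \<Longrightarrow> v \<in> V \<Longrightarrow> f (u + v) = f u + f v"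
    and scale: "\<And>c u. u \<in> V \<Longrightarrow> f (c *\<^sub>R u) = c * f u"
    and bounded: "\<And>u. u \<in> V \<Longrightarrow> \<bar>f u\<bar> \<le> C * nrm u" and C: "0 \<le> C"
  shows "\<exists>m\<in>V. \<forall>v\<in>V. E m / p - f m + modulus * E (v - m) \<le> E v / p - f v"
proof -
  define F where "F v = E v / p - f v" for v
  have diff: "f (u - v) = f u - f v" if "u \<in> V" "v \<in> V" for u v
    using add[of u "-1 *\<^sub>R v"] scale[of v "-1"] that by simp
  have midpoint: "F ((1/2) *\<^sub>R (u + v)) + modulus / 2 * E (u - v) \<le> (F u + F v) / 2"
    if "u \<in> V" "v \<in> V" for u v
  proof -
    have "(E ((1/2) *\<^sub>R (u + v)) + E ((1/2) *\<^sub>R (u - v))) / p \<le> ((E u + E v) / 2) / p"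
      using E_clarkson[OF that] p_pos by (intro divide_right_mono) auto
    then have "E ((1/2) *\<^sub>R (u + v)) / p + modulus / 2 * E (u - v) \<le> (E u / p + E v / p) / 2"
      using that p_pos by (simp add: E_halving modulus_def add_divide_distrib mult.commute)
    then show ?thesis
      using that by (simp add: F_def add scale algebra_simps)
  qed
  \<comment> \<open>Since \<open>p \<ge> 2\<close>, the energy outgrows the linear form; the crude constant only bounds below.\<close>
  have young: "C * x \<le> x powr p / p + (C + C * C * p)" if "0 \<le> x" for x
  proof (cases "x \<le> 1 + C * p")
    case True
    then have "C * x \<le> C * (1 + C * p)"
      using C by (intro mult_left_mono)
    moreover have "0 \<le> x powr p / p"
      using p_pos by simp
    ultimately show ?thesis
      by (simp add: algebra_simps)
  next
    case False
    then have x: "1 \<le> x" "C * p \<le> x"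
      using C p_pos mult_nonneg_nonneg[of C p] by linarith+
    have "C * p * x \<le> x * x"
      using x by (intro mult_right_mono) auto
    also have "x * x = x powr 2"
      using x by (simp add: powr_numeral power2_eq_square)
    also have "\<dots> \<le> x powr p"
      using x p_ge_2 by (intro powr_mono) auto
    finally have "C * x \<le> x powr p / p"
      using p_pos by (simp add: field_simps)
    moreover have "0 \<le> C + C * C * p"
      using C p_pos by simp
    ultimately show ?thesis
      by linarith
  qed
  have below: "- (C + C * C * p) \<le> F v" if "v \<in> V" for v
    using young[of "nrm v"] bounded[OF that] by (simp add: F_def nrm_powr)
  define b where "b = Inf (F ` V)"
  have bdd: "bdd_below (F ` V)"
    using below by (intro bdd_belowI[of _ "- (C + C * C * p)"]) auto
  have lower: "b \<le> F v" if "v \<in> V" for v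
    unfolding b_def using that bdd by (intro cINF_lower) auto
  have "\<exists>v\<in>V. F v < b + 1 / real (Suc n)" for n
    using cInf_lessD[of "F ` V" "b + 1 / real (Suc n)"] by (force simp: b_def)
  then obtain s where s: "\<And>n. s n \<in> V" "\<And>n. F (s n) < b + 1 / real (Suc n)"
    by metis
  have close: "modulus / 2 * E (s m - s n) \<le> 1 / real (Suc M)" if "M \<le> m" "M \<le> n" for m n M
  proof -
    have "1 / real (Suc m) \<le> 1 / real (Suc M)" "1 / real (Suc n) \<le> 1 / real (Suc M)"
      using that by (auto intro!: divide_left_mono)
    then show ?thesis
      using midpoint[OF s(1)[of m] s(1)[of n]] lower[of "(1/2) *\<^sub>R (s m + s n)"] s(1)[of m] s(1)[of n]
        s(2)[of m] s(2)[of n]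
      by simp
  qed
  have "\<exists>w\<in>V. (\<lambda>n. E (s n - w)) \<longlonglongrightarrow> 0"
  proof (rule E_complete[OF s(1)])
    fix \<epsilon> :: real
    assume "0 < \<epsilon>"
    then have "0 < modulus / 2 * \<epsilon>"
      using modulus_pos by simp
    then obtain M where "1 / real (Suc M) < modulus / 2 * \<epsilon>"
      using nat_approx_posE by blast
    then have "E (s m - s n) < \<epsilon>" if "M \<le> m" "M \<le> n" for m n
      using close[OF that] modulus_pos by (smt (verit) mult_le_cancel_left_pos half_gt_zero)
    then show "\<exists>M. \<forall>m\<ge>M. \<forall>n\<ge>M. E (s m - s n) < \<epsilon>"
      by blast
  qed
  then obtain w where w: "w \<in> V" "(\<lambda>n. E (s n - w)) \<longlonglongrightarrow> 0"
    by blast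
  have "(\<lambda>n. f (s n) - f w) \<longlonglongrightarrow> 0"
  proof (rule Lim_null_comparison)
    show "(\<lambda>n. C * nrm (s n - w)) \<longlonglongrightarrow> 0"
      using w(2) unfolding E_tendsto_0_iff by (intro tendsto_mult_right_zero)
    show "\<forall>\<^sub>F n in sequentially. norm (f (s n) - f w) \<le> C * nrm (s n - w)"
      using bounded[of "s n - w" for n] s(1) w(1) by (simp add: diff)
  qed
  then have "(\<lambda>n. f (s n)) \<longlonglongrightarrow> f w"
    by (simp add: LIM_zero_iff)
  then have "(\<lambda>n. F (s n)) \<longlonglongrightarrow> F w"
    unfolding F_def using p_pos by (intro tendsto_intros E_tendsto s w) auto
  moreover have "(\<lambda>n. b + 1 / real (Suc n)) \<longlonglongrightarrow> b + 0"
    by (intro tendsto_intros LIMSEQ_Suc lim_1_over_n)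
  ultimately have "F w \<le> b + 0"
    by (rule LIMSEQ_le) (use s(2) less_imp_le in blast)
  have "F w + modulus * E (v - w) \<le> F v" if "v \<in> V" for v
    using midpoint[OF that w(1)] lower[of "(1/2) *\<^sub>R (v + w)"] \<open>F w \<le> b + 0\<close> lower[OF w(1)] that w(1)
    by simp
  then show ?thesis
    using w(1) unfolding F_def by blast
qed

end

section \<open>Equilibria of a uniformly convex energy with a compact potential\<close>

text \<open>
  \<open>L u\<close> is the derivative of the potential \<open>P\<close> at \<open>u\<close>. The clause \<open>P_derivative\<close> asks for it
  uniformly over bounded base points and directions, and \<open>L_compact\<close> says that \<open>L\<close> maps bounded sets to
  relatively compact sets of linear forms.
\<close>

locale compact_potential = convex_energy V E p
  for V :: "'v::real_vector set" and E :: "'v \<Rightarrow> real" and p :: real +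
  fixes P :: "'v \<Rightarrow> real" and L :: "'v \<Rightarrow> 'v \<Rightarrow> real"
  assumes L_add: "u \<in> V \<Longrightarrow> v \<in> V \<Longrightarrow> w \<in> V \<Longrightarrow> L u (v + w) = L u v + L u w"
    and L_scale: "u \<in> V \<Longrightarrow> v \<in> V \<Longrightarrow> L u (c *\<^sub>R v) = c * L u v"
    and L_bounded: "\<exists>C\<ge>0. \<forall>u\<in>V. E u \<le> R \<longrightarrow> (\<forall>v\<in>V. \<bar>L u v\<bar> \<le> C * nrm v)"
    and L_compact: "(\<And>n. s n \<in> V) \<Longrightarrow> (\<And>n. E (s n) \<le> R) \<Longrightarrow>
      \<exists>r::nat \<Rightarrow> nat. strict_mono r \<and> (\<forall>\<epsilon>>0. \<exists>M. \<forall>m\<ge>M. \<forall>n\<ge>M. \<forall>v\<in>V.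
        \<bar>L (s (r m)) v - L (s (r n)) v\<bar> \<le> \<epsilon> * nrm v)"
    and L_continuous: "(\<And>n. s n \<in> V) \<Longrightarrow> w \<in> V \<Longrightarrow> (\<lambda>n. E (s n - w)) \<longlonglongrightarrow> 0 \<Longrightarrow> 0 < \<epsilon> \<Longrightarrow>
      \<forall>\<^sub>F n in sequentially. \<forall>v\<in>V. \<bar>L (s n) v - L w v\<bar> \<le> \<epsilon> * nrm v"
    and P_continuous: "(\<And>n. s n \<in> V) \<Longrightarrow> w \<in> V \<Longrightarrow> (\<lambda>n. E (s n - w)) \<longlonglongrightarrow> 0 \<Longrightarrow>
      (\<lambda>n. P (s n)) \<longlonglongrightarrow> P w"
    and P_derivative: "(\<And>n. s n \<in> V) \<Longrightarrow> (\<And>n. d n \<in> V) \<Longrightarrow> (\<And>n. E (s n) \<le> R) \<Longrightarrow> (\<And>n. E (d n) \<le> R) \<Longrightarrow>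
      (\<And>n. 0 < \<tau> n) \<Longrightarrow> \<tau> \<longlonglongrightarrow> 0 \<Longrightarrow>
      (\<lambda>n. (P (s n + \<tau> n *\<^sub>R d n) - P (s n)) / \<tau> n - L (s n) (d n)) \<longlonglongrightarrow> 0"
begin

definition I :: "'v \<Rightarrow> real" where
  "I u = E u / p - P u"

text \<open>
  Since \<open>E\<close> is convex, critical points of \<open>I\<close> are the points that minimise \<open>I\<close> with \<open>P\<close> replaced by
  its linear part there. This formulation avoids the derivative of \<open>E\<close>.
\<close>

definition equilibrium :: "'v \<Rightarrow> bool" where
  "equilibrium u \<longleftrightarrow> u \<in> V \<and> (\<forall>v\<in>V. E u / p - L u u \<le> E v / p - L u v)"

text \<open>
  The solution of the convex problem with the load frozen at \<open>u\<close>. A point at energy distance \<open>0\<close> from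
  its response is an equilibrium, and otherwise \<open>response u - u\<close> is a direction of descent for \<open>I\<close>.
\<close>

definition response :: "'v \<Rightarrow> 'v" where
  "response u = (SOME m. m \<in> V \<and>
     (\<forall>v\<in>V. E m / p - L u m + modulus * E (v - m) \<le> E v / p - L u v))"

lemma L_diff: "u \<in> V \<Longrightarrow> v \<in> V \<Longrightarrow> w \<in> V \<Longrightarrow> L u (v - w) = L u v - L u w"
  using L_add[of u v "-1 *\<^sub>R w"] L_scale[of u w "-1"] by simp

lemma response:
  assumes u: "u \<in> V"
  shows "response u \<in> V"
    and "v \<in> V \<Longrightarrow>
      E (response u) / p - L u (response u) + modulus * E (v - response u) \<le> E v / p - L u v"
proof -
  obtain C where C: "0 \<le> C" "\<And>v. v \<in> V \<Longrightarrow> \<bar>L u v\<bar> \<le> C * nrm v"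
    using L_bounded[of "E u"] u by auto
  have "\<exists>m. m \<in> V \<and> (\<forall>v\<in>V. E m / p - L u m + modulus * E (v - m) \<le> E v / p - L u v)"
    using minimiser_exists[of "L u" C] C u by (auto simp: L_add L_scale)
  then have *: "response u \<in> V \<and> (\<forall>v\<in>V. E (response u) / p - L u (response u) +
      modulus * E (v - response u) \<le> E v / p - L u v)"
    unfolding response_def by (rule someI_ex)
  then show "response u \<in> V"
    by blast
  show "v \<in> V \<Longrightarrow>
      E (response u) / p - L u (response u) + modulus * E (v - response u) \<le> E v / p - L u v"
    using * by blast
qed

text \<open>
  Strong convexity of both minimisation problems, each tested with the minimiser of the other,
  bounds the distance of the minimisers by the distance of the linear forms.
\<close>

lemma response_close:
  assumes u: "u \<in> V" and v: "v \<in> V" and \<delta>: "0 < \<delta>"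
    and near: "\<And>w. w \<in> V \<Longrightarrow> \<bar>L u w - L v w\<bar> \<le> modulus * \<delta> powr (p - 1) * nrm w"
  shows "nrm (response u - response v) < \<delta>"
proof (rule ccontr)
  define d where "d = response u - response v"
  assume "\<not> ?thesis"
  then have d: "\<delta> \<le> nrm d"
    by (simp add: d_def)
  have dV: "d \<in> V"
    using response(1)[OF u] response(1)[OF v] by (simp add: d_def)
  have "L u d - L v d \<ge> 2 * modulus * E d"
    using response(2)[OF u response(1)[OF v]] response(2)[OF v response(1)[OF u]]
      response(1)[OF u] response(1)[OF v] u v E_minus_commute[of "response u" "response v"]
    by (simp add: d_def L_diff)
  then have "2 * modulus * E d \<le> modulus * \<delta> powr (p - 1) * nrm d"
    using near[OF dV] by linarith
  moreover have Ed: "E d = nrm d powr (p - 1) * nrm d"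
    using d \<delta> by (simp add: nrm_powr[symmetric] powr_diff)
  moreover have "\<delta> powr (p - 1) \<le> nrm d powr (p - 1)"
    using d \<delta> p_ge_2 by (intro powr_mono2) auto
  then have "modulus * \<delta> powr (p - 1) * nrm d \<le> modulus * nrm d powr (p - 1) * nrm d"
    using modulus_pos by (intro mult_right_mono mult_left_mono) auto
  ultimately have "2 * (modulus * (nrm d powr (p - 1) * nrm d)) \<le> modulus * (nrm d powr (p - 1) * nrm d)"
    unfolding mult.assoc Ed by linarith
  moreover have "0 < modulus * (nrm d powr (p - 1) * nrm d)"
    using modulus_pos d \<delta> by simp
  ultimately show False
    by linarith
qed

lemma response_continuous:
  assumes s: "\<And>n. s n \<in> V" and w: "w \<in> V" and lim: "(\<lambda>n. E (s n - w)) \<longlonglongrightarrow> 0"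
  shows "(\<lambda>n. E (response (s n) - response w)) \<longlonglongrightarrow> 0"
  unfolding E_tendsto_0_iff
proof (rule LIMSEQ_I)
  fix \<delta> :: real
  assume \<delta>: "0 < \<delta>"
  then have "0 < modulus * \<delta> powr (p - 1)"
    using modulus_pos by simp
  from L_continuous[OF s w lim this] obtain M
    where M: "\<And>n v. M \<le> n \<Longrightarrow> v \<in> V \<Longrightarrow> \<bar>L (s n) v - L w v\<bar> \<le> modulus * \<delta> powr (p - 1) * nrm v"
    unfolding eventually_sequentially by blast
  have "norm (nrm (response (s n) - response w) - 0) < \<delta>" if "M \<le> n" for n
    using response_close[OF s w \<delta> M[OF that]] by simp
  then show "\<exists>M. \<forall>n\<ge>M. norm (nrm (response (s n) - response w) - 0) < \<delta>"
    by blast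
qed

lemma response_compact:
  assumes s: "\<And>n. s n \<in> V" and R: "\<And>n. E (s n) \<le> R"
  shows "\<exists>r::nat \<Rightarrow> nat. strict_mono r \<and>
    (\<forall>\<delta>>0. \<exists>M. \<forall>m\<ge>M. \<forall>n\<ge>M. nrm (response (s (r m)) - response (s (r n))) < \<delta>)"
proof -
  obtain r :: "nat \<Rightarrow> nat" where r: "strict_mono r"
    and close: "\<forall>\<epsilon>>0. \<exists>M. \<forall>m\<ge>M. \<forall>n\<ge>M. \<forall>v\<in>V. \<bar>L (s (r m)) v - L (s (r n)) v\<bar> \<le> \<epsilon> * nrm v"
    using L_compact[of s R] s R by blast
  have "\<exists>M. \<forall>m\<ge>M. \<forall>n\<ge>M. nrm (response (s (r m)) - response (s (r n))) < \<delta>" if \<delta>: "0 < \<delta>" for \<delta>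
  proof -
    have "0 < modulus * \<delta> powr (p - 1)"
      using modulus_pos \<delta> by simp
    with close obtain M where M: "\<And>m n v. M \<le> m \<Longrightarrow> M \<le> n \<Longrightarrow> v \<in> V \<Longrightarrow>
        \<bar>L (s (r m)) v - L (s (r n)) v\<bar> \<le> modulus * \<delta> powr (p - 1) * nrm v"
      by blast
    then show ?thesis
      using response_close[OF s s \<delta>] by blast
  qed
  then show ?thesis
    using r by (intro exI[of _ r]) simp
qed

text \<open>
  Comparison with \<open>0\<close> gives \<open>E m / p \<le> C * nrm m\<close> for the response \<open>m\<close>, which bounds \<open>m\<close> because the
  energy grows at least quadratically beyond norm \<open>1\<close>.
\<close>

lemma response_bounded: "\<exists>R'. \<forall>u\<in>V. E u \<le> R \<longrightarrow> E (response u - u) \<le> R'"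
proof -
  obtain C where C: "0 \<le> C" "\<And>u v. u \<in> V \<Longrightarrow> E u \<le> R \<Longrightarrow> v \<in> V \<Longrightarrow> \<bar>L u v\<bar> \<le> C * nrm v"
    using L_bounded[of R] by auto
  define K where "K = 1 + p * C + \<bar>R\<bar> powr (1 / p)"
  have "E (response u - u) \<le> K powr p" if u: "u \<in> V" "E u \<le> R" for u
  proof -
    define m where "m = response u"
    have m: "m \<in> V"
      using response(1)[OF u(1)] by (simp add: m_def)
    have "E m / p - L u m + modulus * E (0 - m) \<le> E 0 / p - L u 0"
      using response(2)[OF u(1), of 0] by (simp add: m_def)
    moreover have "L u 0 = 0"
      using L_scale[of u 0 0] u by simp
    moreover have "0 \<le> modulus * E (0 - m)"
      using modulus_pos E_nonneg by simp
    ultimately have "E m / p \<le> C * nrm m"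
      using C(2)[OF u m] by simp
    then have Em: "E m \<le> p * C * nrm m"
      using p_pos by (simp add: field_simps)
    have "nrm m \<le> 1 + p * C"
    proof (cases "nrm m \<le> 1")
      case True
      then show ?thesis
        using p_pos C(1) mult_nonneg_nonneg[of p C] by linarith
    next
      case False
      have "nrm m * nrm m = nrm m powr 2"
        using False by (simp add: powr_numeral power2_eq_square)
      also have "\<dots> \<le> nrm m powr p"
        using False p_ge_2 by (intro powr_mono) auto
      finally have "nrm m * nrm m \<le> p * C * nrm m"
        using Em by (simp add: nrm_powr)
      then show ?thesis
        using False by simp
    qed
    moreover have "nrm u \<le> \<bar>R\<bar> powr (1 / p)"
      using u E_nonneg[of u] p_pos unfolding nrm_def by (intro powr_mono2) auto
    ultimately have "nrm (m - u) \<le> K"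
      using nrm_triangle_diff[of m 0 u] nrm_minus_commute[of 0 u] m u(1) by (simp add: K_def)
    moreover have "0 \<le> K"
      using p_pos C(1) by (simp add: K_def)
    ultimately show ?thesis
      by (simp add: nrm_le_iff m_def)
  qed
  then show ?thesis
    by blast
qed

lemma equilibrium_if_response_fixed:
  assumes u: "u \<in> V" and fixed: "E (response u - u) = 0"
  shows "equilibrium u"
proof -
  let ?m = "response u"
  have m: "?m \<in> V"
    by (rule response(1)[OF u])
  have nrm0: "nrm (?m - u) = 0"
    using fixed by (simp add: nrm_def)
  have "nrm u = nrm ?m"
    using nrm_diff_bound[OF m u] nrm0 by simp
  then have "E u = E ?m"
    by (metis nrm_powr)
  moreover have "L u (?m - u) = 0"
  proof -
    obtain C where "\<forall>v\<in>V. \<bar>L u v\<bar> \<le> C * nrm v"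
      using L_bounded[of "E u"] u by auto
    then have "\<bar>L u (?m - u)\<bar> \<le> C * nrm (?m - u)"
      using u m by blast
    then show ?thesis
      by (simp add: nrm0)
  qed
  then have "L u ?m = L u u"
    using u m by (simp add: L_diff)
  moreover have "E ?m / p - L u ?m \<le> E v / p - L u v" if "v \<in> V" for v
    using response(2)[OF u that] mult_nonneg_nonneg[OF less_imp_le[OF modulus_pos] E_nonneg[of "v - ?m"]]
    by linarith
  ultimately show ?thesis
    using u by (simp add: equilibrium_def)
qed

text \<open>
  Along the segment from \<open>u\<close> to its response the energy lies below its chord, and the chord falls
  because the response minimises \<open>E v / p - L u v\<close>.
\<close>

lemma energy_towards_response:
  assumes u: "u \<in> V" and t: "0 \<le> t" "t \<le> 1"
  shows "E (u + t *\<^sub>R (response u - u)) / p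
    \<le> E u / p + t * L u (response u - u) - t * (modulus * E (response u - u))"
proof -
  let ?m = "response u"
  have m: "?m \<in> V"
    by (rule response(1)[OF u])
  have "u + t *\<^sub>R (?m - u) = (1 - t) *\<^sub>R u + t *\<^sub>R ?m"
    by (simp add: algebra_simps)
  then have "E (u + t *\<^sub>R (?m - u)) / p \<le> ((1 - t) * E u + t * E ?m) / p"
    using E_convex[OF u m t] p_pos by (simp add: divide_right_mono)
  also have "\<dots> = E u / p + t * (E ?m / p - E u / p)"
    using p_pos by (simp add: field_simps)
  also have "\<dots> \<le> E u / p + t * (L u ?m - L u u - modulus * E (?m - u))"
    using response(2)[OF u u] E_minus_commute[OF u m] t by (intro add_left_mono mult_left_mono) auto
  finally show ?thesis
    using u m by (simp add: L_diff algebra_simps)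
qed

lemma I_tendsto:
  assumes "\<And>n. s n \<in> V" "w \<in> V" "(\<lambda>n. E (s n - w)) \<longlonglongrightarrow> 0"
  shows "(\<lambda>n. I (s n)) \<longlonglongrightarrow> I w"
  unfolding I_def using p_pos by (intro tendsto_intros E_tendsto P_continuous assms) auto

text \<open>
  This dichotomy replaces the Palais--Smale condition together with a deformation lemma. If no uniform
  rate of descent towards the response exists on \<open>S\<close>, then there are points of \<open>S\<close> whose distance
  to their response tends to zero. Their responses cluster by compactness, hence so do the points
  themselves, and the limit equals its response.
\<close>

lemma descent_or_equilibrium:
  assumes S: "S \<subseteq> V" and R: "\<forall>u\<in>S. E u \<le> R"
  obtains (descent) \<tau> \<kappa> where "0 < \<tau>" "\<tau> \<le> 1" "0 < \<kappa>"
      "\<And>u t. u \<in> S \<Longrightarrow> 0 \<le> t \<Longrightarrow> t \<le> \<tau> \<Longrightarrow> I (u + t *\<^sub>R (response u - u)) \<le> I u - \<kappa> * t"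
  | (equilibrium) u s where "equilibrium u" "\<And>n. s n \<in> S" "(\<lambda>n::nat. E (s n - u)) \<longlonglongrightarrow> 0"
proof (cases "\<exists>\<tau> \<kappa>. 0 < \<tau> \<and> \<tau> \<le> 1 \<and> 0 < \<kappa> \<and>
    (\<forall>u\<in>S. \<forall>t. 0 \<le> t \<longrightarrow> t \<le> \<tau> \<longrightarrow> I (u + t *\<^sub>R (response u - u)) \<le> I u - \<kappa> * t)")
  case True
  then show ?thesis
    using descent by blast
next
  case False
  have "\<exists>u t. u \<in> S \<and> 0 \<le> t \<and> t \<le> 1 / real (Suc n) \<and>
      I u - (1 / real (Suc n)) * t < I (u + t *\<^sub>R (response u - u))" for n
  proof (rule ccontr)
    assume "\<not> ?thesis"
    then have "\<forall>u\<in>S. \<forall>t. 0 \<le> t \<longrightarrow> t \<le> 1 / real (Suc n) \<longrightarrow>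
        I (u + t *\<^sub>R (response u - u)) \<le> I u - (1 / real (Suc n)) * t"
      by (meson not_le)
    moreover have "0 < 1 / real (Suc n)" "1 / real (Suc n) \<le> 1"
      by auto
    ultimately show False
      using False by blast
  qed
  then obtain s t where s: "\<And>n. s n \<in> S" and t0: "\<And>n. 0 \<le> t n" and t1: "\<And>n. t n \<le> 1 / real (Suc n)"
    and slow: "\<And>n. I (s n) - (1 / real (Suc n)) * t n < I (s n + t n *\<^sub>R (response (s n) - s n))"
    by metis
  have sV: "s n \<in> V" and sR: "E (s n) \<le> R" for n
    using s S R by auto
  define d where "d n = response (s n) - s n" for n
  have dV: "d n \<in> V" for n
    using response(1)[OF sV] sV by (simp add: d_def)
  obtain R' where R': "\<And>n. E (d n) \<le> R'"
    using response_bounded[of R] sV sR unfolding d_def by blast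
  have t_pos: "0 < t n" for n
    using slow[of n] t0[of n] by (cases "t n = 0") auto
  have t_lim: "t \<longlonglongrightarrow> 0"
    by (rule Lim_null_comparison[OF _ LIMSEQ_Suc[OF lim_1_over_n]])
      (use t0 t1 in \<open>auto intro!: always_eventually\<close>)
  \<comment> \<open>The error of the first order expansion of \<open>P\<close>, the only term that can offset the decrease.\<close>
  define q where "q n = (P (s n + t n *\<^sub>R d n) - P (s n)) / t n - L (s n) (d n)" for n
  have q_lim: "q \<longlonglongrightarrow> 0"
    unfolding q_def
    by (rule P_derivative[where R = "max R R'"])
      (use sV dV sR R' t_pos t_lim in \<open>auto simp: le_max_iff_disj\<close>)
  have small: "E (d n) \<le> (1 / real (Suc n) - q n) / modulus" for n
  proof -
    have "t n \<le> 1"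
      using t1[of n] by (rule order_trans) auto
    have "P (s n + t n *\<^sub>R d n) - P (s n) = t n * (q n + L (s n) (d n))"
      using t_pos[of n] by (simp add: q_def)
    then have "t n * (modulus * E (d n)) \<le> t n * (1 / real (Suc n) - q n)"
      using energy_towards_response[OF sV[of n] t0[of n] \<open>t n \<le> 1\<close>] slow[of n]
      unfolding I_def d_def by (simp add: algebra_simps)
    then have "modulus * E (d n) \<le> 1 / real (Suc n) - q n"
      using t_pos[of n] by (rule mult_left_le_imp_le)
    then show ?thesis
      using modulus_pos by (simp add: pos_le_divide_eq mult.commute)
  qed
  have d_lim: "(\<lambda>n. E (d n)) \<longlonglongrightarrow> 0"
  proof (rule Lim_null_comparison)
    show "\<forall>\<^sub>F n in sequentially. norm (E (d n)) \<le> (1 / real (Suc n) - q n) / modulus"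
      using small E_nonneg by (intro always_eventually) auto
    have "(\<lambda>n. (1 / real (Suc n) - q n) / modulus) \<longlonglongrightarrow> (0 - 0) / modulus"
      using modulus_pos by (intro tendsto_intros LIMSEQ_Suc lim_1_over_n q_lim) auto
    then show "(\<lambda>n. (1 / real (Suc n) - q n) / modulus) \<longlonglongrightarrow> 0"
      by simp
  qed
  obtain r :: "nat \<Rightarrow> nat" where "strict_mono r \<and>
      (\<forall>\<delta>>0. \<exists>M. \<forall>m\<ge>M. \<forall>n\<ge>M. nrm (response (s (r m)) - response (s (r n))) < \<delta>)"
    using response_compact[OF sV sR] ..
  then have r: "strict_mono r" and cluster:
    "\<forall>\<delta>>0. \<exists>M. \<forall>m\<ge>M. \<forall>n\<ge>M. nrm (response (s (r m)) - response (s (r n))) < \<delta>"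
    by simp_all
  define s' where "s' = s \<circ> r"
  have s'V: "s' n \<in> V" for n
    using sV by (simp add: s'_def)
  have m'V: "response (s' n) \<in> V" for n
    by (rule response(1)[OF s'V])
  have gap: "(\<lambda>n. nrm (response (s' n) - s' n)) \<longlonglongrightarrow> 0"
    using LIMSEQ_subseq_LIMSEQ[OF iffD1[OF E_tendsto_0_iff d_lim] r]
    by (simp add: d_def s'_def comp_def)
  have "\<exists>w\<in>V. (\<lambda>n. E (s' n - w)) \<longlonglongrightarrow> 0"
  proof (rule nrm_complete[OF s'V])
    fix \<epsilon> :: real
    assume "0 < \<epsilon>"
    then have \<epsilon>: "0 < \<epsilon> / 3"
      by simp
    obtain M1 where M1: "\<forall>m\<ge>M1. \<forall>n\<ge>M1. nrm (response (s' m) - response (s' n)) < \<epsilon> / 3"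
      using cluster[rule_format, OF \<epsilon>] unfolding s'_def comp_def ..
    obtain M2 where M2: "\<forall>n\<ge>M2. norm (nrm (response (s' n) - s' n) - 0) < \<epsilon> / 3"
      using LIMSEQ_D[OF gap \<epsilon>] ..
    have "nrm (s' m - s' n) < \<epsilon>" if "max M1 M2 \<le> m" "max M1 M2 \<le> n" for m n
    proof -
      have "nrm (s' m - s' n) \<le> nrm (s' m - response (s' m)) + nrm (response (s' m) - s' n)"
        by (intro nrm_triangle_diff s'V m'V)
      also have "nrm (response (s' m) - s' n)
          \<le> nrm (response (s' m) - response (s' n)) + nrm (response (s' n) - s' n)"
        by (intro nrm_triangle_diff s'V m'V)
      finally show ?thesis
        using M1[rule_format, of m n] M2[rule_format, of m] that nrm_minus_commute[OF s'V m'V, of m m]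
          M2[rule_format, of n] by simp
    qed
    then show "\<exists>M. \<forall>m\<ge>M. \<forall>n\<ge>M. nrm (s' m - s' n) < \<epsilon>"
      by blast
  qed
  then obtain w where w: "w \<in> V" and lim: "(\<lambda>n. E (s' n - w)) \<longlonglongrightarrow> 0"
    by blast
  have sum_lim:
    "(\<lambda>n. nrm (response (s' n) - response w) + nrm (response (s' n) - s' n) + nrm (s' n - w)) \<longlonglongrightarrow> 0 + 0 + 0"
    using response_continuous[OF s'V w lim] lim gap unfolding E_tendsto_0_iff
    by (intro tendsto_add)
  have "nrm (response w - w)
      \<le> nrm (response (s' n) - response w) + nrm (response (s' n) - s' n) + nrm (s' n - w)" for n
    using nrm_triangle_diff[OF response(1)[OF w] m'V w, of n] nrm_triangle_diff[OF m'V s'V w, of n n]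
      nrm_minus_commute[OF response(1)[OF w] m'V, of n]
    by linarith
  then have "nrm (response w - w) \<le> 0 + 0 + 0"
    by (intro LIMSEQ_le_const[OF sum_lim]) simp
  then have "nrm (response w - w) = 0"
    using nrm_nonneg[of "response w - w"] by linarith
  then have "E (response w - w) = 0"
    using nrm_powr[of "response w - w"] p_pos by simp
  then have w_eq: "equilibrium w"
    by (rule equilibrium_if_response_fixed[OF w])
  show ?thesis
  proof (rule equilibrium[of w s'])
    show "equilibrium w"
      by (rule w_eq)
    show "s' n \<in> S" for n
      unfolding s'_def comp_def by (rule s)
    show "(\<lambda>n. E (s' n - w)) \<longlonglongrightarrow> 0"
      by (rule lim)
  qed
qed

end

context compact_potential
begin

section \<open>Three equilibria\<close>

text \<open>
  Continuity of a curve in \<open>V\<close> refers to the energy. It is phrased with sequences of parameters, in the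
  form in which the continuity of \<open>P\<close> and \<open>L\<close> is given.
\<close>

definition curve :: "(real \<Rightarrow> 'v) \<Rightarrow> bool" where
  "curve g \<longleftrightarrow> (\<forall>x\<in>{0..1}. g x \<in> V) \<and>
     (\<forall>x. \<forall>\<xi>\<in>{0..1}. (\<forall>n::nat. x n \<in> {0..1}) \<longrightarrow> x \<longlonglongrightarrow> \<xi> \<longrightarrow> (\<lambda>n. E (g (x n) - g \<xi>)) \<longlonglongrightarrow> 0)"

lemma curve_in_V: "curve g \<Longrightarrow> 0 \<le> x \<Longrightarrow> x \<le> 1 \<Longrightarrow> g x \<in> V"
  by (simp add: curve_def)

lemma curve_tendsto:
  "curve g \<Longrightarrow> (\<And>n::nat. x n \<in> {0..1}) \<Longrightarrow> \<xi> \<in> {0..1} \<Longrightarrow> x \<longlonglongrightarrow> \<xi> \<Longrightarrow>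
    (\<lambda>n. E (g (x n) - g \<xi>)) \<longlonglongrightarrow> 0"
  unfolding curve_def by blast

lemma curve_continuous_E:
  assumes g: "curve g"
  shows "continuous_on {0..1} (\<lambda>x. E (g x))"
  unfolding continuous_on_sequentially comp_def
  using g by (auto intro!: E_tendsto curve_tendsto curve_in_V[OF g])

lemma curve_continuous_I:
  assumes g: "curve g"
  shows "continuous_on {0..1} (\<lambda>x. I (g x))"
  unfolding continuous_on_sequentially comp_def
  using g by (auto intro!: I_tendsto curve_tendsto curve_in_V[OF g])

lemma curve_segment:
  assumes u: "u \<in> V" and w: "w \<in> V"
  shows "curve (\<lambda>x. u + x *\<^sub>R w)"
  unfolding curve_def
proof (intro conjI ballI allI impI)
  show "u + x *\<^sub>R w \<in> V" for x
    using u w by auto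
  fix x :: "nat \<Rightarrow> real" and \<xi> :: real
  assume "x \<longlonglongrightarrow> \<xi>"
  then have "(\<lambda>n. \<bar>x n - \<xi>\<bar> * nrm w) \<longlonglongrightarrow> \<bar>\<xi> - \<xi>\<bar> * nrm w"
    by (intro tendsto_intros)
  then show "(\<lambda>n. E (u + x n *\<^sub>R w - (u + \<xi> *\<^sub>R w))) \<longlonglongrightarrow> 0"
    unfolding E_tendsto_0_iff using w by (simp add: nrm_scale flip: scaleR_diff_left)
qed

text \<open>
  The response depends continuously on the point, so a curve remains continuous when its points are
  moved towards their responses by an amount that varies continuously.
\<close>

lemma curve_pushed:
  assumes g: "curve g" and \<theta>: "continuous_on {0..1} \<theta>"
  shows "curve (\<lambda>x. g x + \<theta> x *\<^sub>R (response (g x) - g x))"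
  unfolding curve_def
proof (intro conjI ballI allI impI)
  show "g x + \<theta> x *\<^sub>R (response (g x) - g x) \<in> V" if "x \<in> {0..1}" for x
    using curve_in_V[OF g, of x] response(1)[of "g x"] that by auto
  fix x :: "nat \<Rightarrow> real" and \<xi> :: real
  assume \<xi>: "\<xi> \<in> {0..1}" and x: "\<forall>n. x n \<in> {0..1}" and lim: "x \<longlonglongrightarrow> \<xi>"
  have gV: "g (x n) \<in> V" "g \<xi> \<in> V" "response (g (x n)) \<in> V" "response (g \<xi>) \<in> V" for n
    using curve_in_V[OF g] response(1) \<xi> x by auto
  have g_lim: "(\<lambda>n. E (g (x n) - g \<xi>)) \<longlonglongrightarrow> 0"
    using curve_tendsto[OF g] x \<xi> lim by blast
  have r_lim: "(\<lambda>n. E (response (g (x n)) - response (g \<xi>))) \<longlonglongrightarrow> 0"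
    by (rule response_continuous[OF gV(1) gV(2) g_lim])
  have \<theta>_lim: "(\<lambda>n. \<theta> (x n)) \<longlonglongrightarrow> \<theta> \<xi>"
    using \<theta> x \<xi> lim unfolding continuous_on_sequentially comp_def by blast
  let ?d = "response (g \<xi>) - g \<xi>"
  let ?e = "\<lambda>n. g (x n) - g \<xi>" and ?f = "\<lambda>n. response (g (x n)) - response (g \<xi>)"
  have "(\<lambda>n. nrm (?e n) + (\<bar>\<theta> (x n) - \<theta> \<xi>\<bar> * nrm ?d + \<bar>\<theta> (x n)\<bar> * (nrm (?f n) + nrm (?e n)))) \<longlonglongrightarrow>
      0 + (\<bar>\<theta> \<xi> - \<theta> \<xi>\<bar> * nrm ?d + \<bar>\<theta> \<xi>\<bar> * (0 + 0))"
    using g_lim r_lim unfolding E_tendsto_0_iff by (intro tendsto_intros \<theta>_lim)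
  then have bound_lim: "(\<lambda>n. nrm (?e n) + (\<bar>\<theta> (x n) - \<theta> \<xi>\<bar> * nrm ?d +
      \<bar>\<theta> (x n)\<bar> * (nrm (?f n) + nrm (?e n)))) \<longlonglongrightarrow> 0"
    by simp
  have bound: "nrm (g (x n) + \<theta> (x n) *\<^sub>R (response (g (x n)) - g (x n)) - (g \<xi> + \<theta> \<xi> *\<^sub>R ?d))
      \<le> nrm (?e n) + (\<bar>\<theta> (x n) - \<theta> \<xi>\<bar> * nrm ?d + \<bar>\<theta> (x n)\<bar> * (nrm (?f n) + nrm (?e n)))" for n
  proof -
    have "g (x n) + \<theta> (x n) *\<^sub>R (response (g (x n)) - g (x n)) - (g \<xi> + \<theta> \<xi> *\<^sub>R ?d) =
        ?e n + ((\<theta> (x n) - \<theta> \<xi>) *\<^sub>R ?d + \<theta> (x n) *\<^sub>R (?f n + -1 *\<^sub>R ?e n))"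
      by (simp add: algebra_simps)
    also have "nrm \<dots> \<le> nrm (?e n) + nrm ((\<theta> (x n) - \<theta> \<xi>) *\<^sub>R ?d + \<theta> (x n) *\<^sub>R (?f n + -1 *\<^sub>R ?e n))"
      using gV by (intro nrm_triangle V_closed)
    also have "nrm ((\<theta> (x n) - \<theta> \<xi>) *\<^sub>R ?d + \<theta> (x n) *\<^sub>R (?f n + -1 *\<^sub>R ?e n))
        \<le> nrm ((\<theta> (x n) - \<theta> \<xi>) *\<^sub>R ?d) + nrm (\<theta> (x n) *\<^sub>R (?f n + -1 *\<^sub>R ?e n))"
      using gV by (intro nrm_triangle V_closed)
    also have "nrm ((\<theta> (x n) - \<theta> \<xi>) *\<^sub>R ?d) = \<bar>\<theta> (x n) - \<theta> \<xi>\<bar> * nrm ?d"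
      using gV by (intro nrm_scale V_closed)
    also have "nrm (\<theta> (x n) *\<^sub>R (?f n + -1 *\<^sub>R ?e n)) = \<bar>\<theta> (x n)\<bar> * nrm (?f n + -1 *\<^sub>R ?e n)"
      using gV by (intro nrm_scale V_closed)
    also have "nrm (?f n + -1 *\<^sub>R ?e n) \<le> nrm (?f n) + nrm (-1 *\<^sub>R ?e n)"
      using gV by (intro nrm_triangle V_closed)
    also have "nrm (-1 *\<^sub>R ?e n) = \<bar>-1\<bar> * nrm (?e n)"
      using gV by (intro nrm_scale V_closed)
    finally show ?thesis
      by (simp add: mult_left_mono)
  qed
  show "(\<lambda>n. E (g (x n) + \<theta> (x n) *\<^sub>R (response (g (x n)) - g (x n)) - (g \<xi> + \<theta> \<xi> *\<^sub>R ?d))) \<longlonglongrightarrow> 0"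
    unfolding E_tendsto_0_iff
    by (rule Lim_null_comparison[OF _ bound_lim]) (use bound in simp)
qed

text \<open>
  To leave the sublevel set of \<open>E\<close>, a curve would have to cross the level \<open>E u = p * r\<close>, where \<open>I\<close> is too
  large.
\<close>

lemma curve_stays_inside:
  assumes g: "curve g" and start: "E (g 0) / p \<le> r"
    and barrier: "\<And>u. u \<in> V \<Longrightarrow> E u / p = r \<Longrightarrow> \<beta> \<le> I u"
    and below: "\<And>x. 0 \<le> x \<Longrightarrow> x \<le> 1 \<Longrightarrow> I (g x) < \<beta>"
  shows "E (g 1) / p \<le> r"
proof (rule ccontr)
  assume "\<not> ?thesis"
  then have "\<exists>x. 0 \<le> x \<and> x \<le> 1 \<and> E (g x) / p = r"
    using start p_pos by (intro IVT') (auto intro!: continuous_intros curve_continuous_E g)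
  then show False
    using barrier below curve_in_V[OF g] by (metis not_le)
qed

text \<open>
  Uniform descent from an almost minimal point would remain in the region and pass below the infimum.
  Hence there are equilibria in the closure of the region whose value is as close to the infimum as
  desired, here below \<open>\<beta>\<close>.
\<close>

lemma equilibrium_near_infimum:
  assumes S: "S \<subseteq> V" "S \<noteq> {}" and R: "\<And>u. u \<in> S \<Longrightarrow> E u \<le> R"
    and below: "\<And>u. u \<in> S \<Longrightarrow> b \<le> I u"
    and less: "\<exists>u\<in>S. I u < \<beta>"
    and invariant: "\<And>u w. u \<in> S \<Longrightarrow> w \<in> V \<Longrightarrow> (\<And>x. 0 \<le> x \<Longrightarrow> x \<le> 1 \<Longrightarrow> I (u + x *\<^sub>R w) \<le> I u) \<Longrightarrow>
      I u < \<beta> \<Longrightarrow> u + w \<in> S"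
  obtains u s where "equilibrium u" "I u < \<beta>" "\<And>n. s n \<in> S" "(\<lambda>n::nat. E (s n - u)) \<longlonglongrightarrow> 0"
proof -
  define m where "m = Inf (I ` S)"
  have bdd: "bdd_below (I ` S)"
    using below by (intro bdd_belowI[of _ b]) auto
  have lower: "m \<le> I u" if "u \<in> S" for u
    unfolding m_def using that bdd by (intro cINF_lower)
  have near: "\<exists>u\<in>S. I u < m + \<epsilon>" if "0 < \<epsilon>" for \<epsilon>
    using cInf_lessD[of "I ` S" "m + \<epsilon>"] that S(2) by (auto simp: m_def)
  have m: "m < \<beta>"
    using less lower by fastforce
  define S' where "S' = {u \<in> S. I u \<le> m + (\<beta> - m) / 2}"
  have S': "S' \<subseteq> V" "\<forall>u\<in>S'. E u \<le> R"
    using S R by (auto simp: S'_def)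
  show ?thesis
  proof (cases rule: descent_or_equilibrium[OF S', case_names descent equilibrium])
    case (descent \<tau> \<kappa>)
    obtain u where u: "u \<in> S" "I u < m + min ((\<beta> - m) / 2) (\<kappa> * \<tau>)"
      using near[of "min ((\<beta> - m) / 2) (\<kappa> * \<tau>)"] descent m by auto
    define w where "w = \<tau> *\<^sub>R (response u - u)"
    have w: "w \<in> V"
      using u S response(1)[of u] by (auto simp: w_def)
    have along: "I (u + x *\<^sub>R w) \<le> I u - \<kappa> * (x * \<tau>)" if "0 \<le> x" "x \<le> 1" for x
    proof -
      have "x * \<tau> \<le> \<tau>"
        using that descent by (simp add: mult_left_le_one_le)
      then show ?thesis
        using descent(4)[of u "x * \<tau>"] u that descent(1) by (simp add: w_def S'_def)
    qed
    have "I (u + x *\<^sub>R w) \<le> I u" if "0 \<le> x" "x \<le> 1" for x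
      using along[OF that] descent that by (smt (verit) mult_nonneg_nonneg)
    moreover have "I u < \<beta>"
      using u(2) m min.cobounded1[of "(\<beta> - m) / 2" "\<kappa> * \<tau>"] by (simp add: field_simps)
    ultimately have "u + w \<in> S"
      using invariant[OF u(1) w] by blast
    then have "m \<le> I u - \<kappa> * \<tau>"
      using lower along[of 1] by fastforce
    then show ?thesis
      using u by simp
  next
    case (equilibrium u s)
    have s: "s n \<in> S" "I (s n) \<le> m + (\<beta> - m) / 2" for n
      using equilibrium(2)[of n] by (auto simp: S'_def)
    have "(\<lambda>n. I (s n)) \<longlonglongrightarrow> I u"
      using equilibrium s(1) S(1) by (intro I_tendsto) (auto simp: equilibrium_def)
    then have "I u \<le> m + (\<beta> - m) / 2"
      by (rule LIMSEQ_le_const2) (use s in auto)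
    then have "I u < \<beta>"
      using m by (simp add: field_simps)
    then show ?thesis
      using that equilibrium s by blast
  qed
qed

text \<open>
  The mountain pass. A curve whose maximum nearly equals the minimax level is pushed once, with full
  strength near that level and not at all far below it. Without equilibria near the level this
  lowers the maximum below the minimax level.
\<close>

lemma mountain_pass:
  assumes e0: "e0 \<in> V" "E e0 / p \<le> r" and e1: "e1 \<in> V" "r < E e1 / p"
    and barrier: "\<And>u. u \<in> V \<Longrightarrow> E u / p = r \<Longrightarrow> \<beta> \<le> I u"
    and low: "\<alpha> < \<beta>" "I e0 \<le> \<alpha>" "I e1 \<le> \<alpha>"
    and coercive: "\<And>b. \<exists>R. \<forall>u\<in>V. I u \<le> b \<longrightarrow> E u \<le> R"
  obtains u where "equilibrium u" "\<alpha> < I u"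
proof -
  define levels where
    "levels = {b. \<exists>g. curve g \<and> g 0 = e0 \<and> g 1 = e1 \<and> (\<forall>x\<in>{0..1}. I (g x) \<le> b)}"
  have crossing: "\<beta> \<le> b" if b: "b \<in> levels" for b
  proof -
    obtain g where g: "curve g" "g 0 = e0" "g 1 = e1" "\<And>x. x \<in> {0..1} \<Longrightarrow> I (g x) \<le> b"
      using b unfolding levels_def by blast
    have "\<exists>x. 0 \<le> x \<and> x \<le> 1 \<and> E (g x) / p = r"
      using e0 e1 p_pos g by (intro IVT') (auto intro!: continuous_intros curve_continuous_E)
    then show ?thesis
      using barrier curve_in_V[OF g(1)] g(4) by (metis atLeastAtMost_iff order_trans)
  qed
  have "levels \<noteq> {}"
  proof -
    let ?g = "\<lambda>x. e0 + x *\<^sub>R (e1 - e0)"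
    have g: "curve ?g"
      using e0 e1 by (intro curve_segment) auto
    obtain x where "\<forall>y\<in>{0..1}. I (?g y) \<le> I (?g x)"
      using continuous_attains_sup[OF _ _ curve_continuous_I[OF g]] by auto
    then have "I (?g x) \<in> levels"
      using g unfolding levels_def by (intro CollectI exI[of _ ?g]) auto
    then show ?thesis
      by blast
  qed
  define m where "m = Inf levels"
  have bdd: "bdd_below levels"
    using crossing by (rule bdd_belowI)
  have m: "\<beta> \<le> m"
    unfolding m_def using \<open>levels \<noteq> {}\<close> crossing by (intro cInf_greatest)
  define \<epsilon> where "\<epsilon> = (m - \<alpha>) / 2"
  have \<epsilon>: "0 < \<epsilon>" "\<alpha> < m - \<epsilon>"
    using m low(1) by (auto simp: \<epsilon>_def field_simps)
  define S where "S = {u \<in> V. \<bar>I u - m\<bar> \<le> \<epsilon>}"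
  obtain R where "\<forall>u\<in>V. I u \<le> m + \<epsilon> \<longrightarrow> E u \<le> R"
    using coercive by blast
  then have S: "S \<subseteq> V" "\<forall>u\<in>S. E u \<le> R"
    by (auto simp: S_def)
  show ?thesis
  proof (cases rule: descent_or_equilibrium[OF S, case_names descent equilibrium])
    case (equilibrium u s)
    have s: "s n \<in> V" "m - \<epsilon> \<le> I (s n)" for n
      using equilibrium(2)[of n] by (auto simp: S_def)
    have "(\<lambda>n. I (s n)) \<longlonglongrightarrow> I u"
      using equilibrium s(1) by (intro I_tendsto) (auto simp: equilibrium_def)
    then have "m - \<epsilon> \<le> I u"
      by (rule LIMSEQ_le_const) (use s in auto)
    then show ?thesis
      using that equilibrium \<epsilon> by force
  next
    case (descent \<tau> \<kappa>)
    \<comment> \<open>A full push gains \<open>\<kappa> * \<tau>\<close>, which is more than the excess \<open>\<delta>\<close> of the curve over the minimax level.\<close>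
    define \<delta> where "\<delta> = min \<epsilon> (\<kappa> * \<tau> / 2)"
    have \<delta>: "0 < \<delta>" "\<delta> \<le> \<epsilon>" "\<delta> \<le> \<kappa> * \<tau> / 2"
      using \<epsilon> descent by (auto simp: \<delta>_def)
    obtain b where b: "b \<in> levels" "b < m + \<delta>"
      using cInf_lessD[of levels "m + \<delta>"] \<open>levels \<noteq> {}\<close> \<delta> by (auto simp: m_def)
    then obtain g where g: "curve g" "g 0 = e0" "g 1 = e1" "\<And>x. x \<in> {0..1} \<Longrightarrow> I (g x) \<le> b"
      by (auto simp: levels_def)
    \<comment> \<open>The strength of the push: \<open>0\<close> below the level \<open>m - \<epsilon>\<close>, full above \<open>m - \<epsilon> / 2\<close>. The end points stay fixed.\<close>
    define \<theta> where "\<theta> x = \<tau> * max 0 (min 1 ((I (g x) - (m - \<epsilon>)) / (\<epsilon> / 2)))" for x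
    have \<theta>_cont: "continuous_on {0..1} \<theta>"
      unfolding \<theta>_def using \<epsilon> by (intro continuous_intros curve_continuous_I g) auto
    have \<theta>: "0 \<le> \<theta> x" "\<theta> x \<le> \<tau>" for x
      using descent by (auto simp: \<theta>_def mult_left_le)
    define g' where "g' x = g x + \<theta> x *\<^sub>R (response (g x) - g x)" for x
    have g'_curve: "curve g'"
      unfolding g'_def by (rule curve_pushed[OF g(1) \<theta>_cont])
    have low_fixed: "g' x = g x" if "I (g x) \<le> m - \<epsilon>" for x
    proof -
      have "(I (g x) - (m - \<epsilon>)) / (\<epsilon> / 2) \<le> 0"
        using that \<epsilon> by (intro divide_nonpos_pos) auto
      then have "\<theta> x = 0"
        by (simp add: \<theta>_def)
      then show ?thesis
        by (simp add: g'_def)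
    qed
    have lowered: "I (g' x) \<le> m - min \<delta> (\<epsilon> / 2)" if x: "x \<in> {0..1}" for x
    proof (cases "I (g x) \<le> m - \<epsilon>")
      case True
      then show ?thesis
        using low_fixed[OF True] \<epsilon> by simp
    next
      case False
      then have "g x \<in> S"
        using g(1,4) x b(2) \<delta>(2) curve_in_V[OF g(1), of x] by (fastforce simp: S_def)
      then have drop: "I (g' x) \<le> I (g x) - \<kappa> * \<theta> x"
        unfolding g'_def using \<theta> by (intro descent(4)) auto
      show ?thesis
      proof (cases "I (g x) \<le> m - \<epsilon> / 2")
        case True
        have "0 \<le> \<kappa> * \<theta> x"
          using descent \<theta> by (intro mult_nonneg_nonneg) auto
        then show ?thesis
          using drop True by (simp add: min_def)
      next
        case False
        then have "1 \<le> (I (g x) - (m - \<epsilon>)) / (\<epsilon> / 2)"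
          using \<epsilon> by (simp add: pos_le_divide_eq)
        then have "\<theta> x = \<tau>"
          by (simp add: \<theta>_def)
        then show ?thesis
          using drop g(4)[OF x] b(2) \<delta> by (simp add: min_def)
      qed
    qed
    have "g' 0 = e0" "g' 1 = e1"
      using low_fixed[of 0] low_fixed[of 1] g(2,3) low \<epsilon> by auto
    then have "m - min \<delta> (\<epsilon> / 2) \<in> levels"
      using g'_curve lowered unfolding levels_def by blast
    then have "m \<le> m - min \<delta> (\<epsilon> / 2)"
      unfolding m_def using bdd by (intro cInf_lower)
    then show ?thesis
      using \<delta> \<epsilon> by auto
  qed
qed

text \<open>
  The barrier separates two wells. Descent inside the barrier and descent anywhere lead to one
  equilibrium in either well, and the pass between the wells carries a third one at a higher level.
\<close>

theorem three_equilibria: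
  assumes coercive: "\<And>b. \<exists>R. \<forall>u\<in>V. I u \<le> b \<longrightarrow> E u \<le> R"
    and below: "\<And>u. u \<in> V \<Longrightarrow> b \<le> I u"
    and barrier: "\<And>u. u \<in> V \<Longrightarrow> E u / p = r \<Longrightarrow> \<beta> \<le> I u"
    and r: "0 \<le> r" and I0: "I 0 < \<beta>"
    and inner: "\<And>u. u \<in> V \<Longrightarrow> E u / p \<le> r \<Longrightarrow> \<zeta> \<le> I u"
    and e: "e \<in> V" "I e < \<zeta>"
  obtains u1 u2 u3 where "equilibrium u1" "equilibrium u2" "equilibrium u3"
    "E u1 < E u2" "I u1 < I u3" "I u2 < I u3"
proof -
  have \<zeta>: "\<zeta> \<le> I 0"
    using inner[of 0] r by simp
  \<comment> \<open>The inner well, which descent from below \<open>\<beta>\<close> cannot leave.\<close>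
  define W where "W = {u \<in> V. E u / p \<le> r}"
  have W0: "0 \<in> W"
    using r by (simp add: W_def)
  have W_inv: "u + w \<in> W"
    if u: "u \<in> W" and w: "w \<in> V" and I: "\<And>x. 0 \<le> x \<Longrightarrow> x \<le> 1 \<Longrightarrow> I (u + x *\<^sub>R w) \<le> I u" "I u < \<beta>"
    for u w
  proof -
    have "E (u + 1 *\<^sub>R w) / p \<le> r"
    proof (rule curve_stays_inside[of "\<lambda>x. u + x *\<^sub>R w" r \<beta>])
      show "curve (\<lambda>x. u + x *\<^sub>R w)"
        using u w by (intro curve_segment) (auto simp: W_def)
      show "E (u + 0 *\<^sub>R w) / p \<le> r"
        using u by (simp add: W_def)
      show "I (u + x *\<^sub>R w) < \<beta>" if "0 \<le> x" "x \<le> 1" for x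
        using I(1)[OF that] I(2) by linarith
    qed (rule barrier)
    then show ?thesis
      using u w by (simp add: W_def)
  qed
  obtain u1 s1 where u1: "equilibrium u1" "I u1 < \<beta>" and s1: "\<And>n. s1 n \<in> W"
    and lim1: "(\<lambda>n::nat. E (s1 n - u1)) \<longlonglongrightarrow> 0"
  proof (rule equilibrium_near_infimum[of W "p * r" b \<beta>])
    show "E u \<le> p * r" if "u \<in> W" for u
      using that p_pos by (simp add: W_def field_simps)
  qed (use W0 W_inv I0 below in \<open>auto simp: W_def\<close>)
  have u1V: "u1 \<in> V"
    using u1 by (simp add: equilibrium_def)
  have "(\<lambda>n. E (s1 n)) \<longlonglongrightarrow> E u1"
    using s1 by (intro E_tendsto u1V lim1) (auto simp: W_def)
  then have "E u1 \<le> p * r"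
    by (rule LIMSEQ_le_const2) (use s1 p_pos in \<open>auto simp: W_def field_simps\<close>)
  then have Eu1: "E u1 / p \<le> r"
    using p_pos by (simp add: field_simps)
  obtain R where R: "\<forall>u\<in>V. I u \<le> \<zeta> \<longrightarrow> E u \<le> R"
    using coercive by blast
  obtain u2 where u2: "equilibrium u2" "I u2 < \<zeta>"
  proof (rule equilibrium_near_infimum[of "{u \<in> V. I u \<le> \<zeta>}" R b \<zeta>])
    show "u + w \<in> {u \<in> V. I u \<le> \<zeta>}"
      if "u \<in> {u \<in> V. I u \<le> \<zeta>}" "w \<in> V" "\<And>x. 0 \<le> x \<Longrightarrow> x \<le> 1 \<Longrightarrow> I (u + x *\<^sub>R w) \<le> I u" for u w
      using that(1,2) that(3)[of 1] by auto
  qed (use R below e that in \<open>auto intro: less_imp_le\<close>)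
  have u2V: "u2 \<in> V"
    using u2 by (simp add: equilibrium_def)
  have Eu2: "r < E u2 / p"
    using inner[OF u2V] u2(2) by force
  have Ee: "r < E e / p"
    using inner[OF e(1)] e(2) by force
  define \<alpha> where "\<alpha> = max (I 0) (I u1)"
  have "\<alpha> < \<beta>"
    using I0 u1 by (simp add: \<alpha>_def)
  have "I 0 \<le> \<alpha>" "I e \<le> \<alpha>"
    using \<zeta> e(2) by (auto simp: \<alpha>_def)
  obtain u3 where u3: "equilibrium u3" "\<alpha> < I u3"
  proof (rule mountain_pass[of 0 r e \<beta> \<alpha>])
    show "\<alpha> < \<beta>" "I 0 \<le> \<alpha>" "I e \<le> \<alpha>"
      by fact+
  qed (use r e(1) Ee barrier coercive in simp_all)
  have "E u1 < E u2"
    using Eu1 Eu2 p_pos by (metis divide_right_mono le_less_trans less_imp_le not_less)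
  moreover have "I u1 < I u3" "I u2 < I u3"
    using u3(2) u2(2) \<zeta> by (auto simp: \<alpha>_def)
  ultimately show ?thesis
    using that u1 u2 u3 by blast
qed

end

section \<open>Functions as vectors, and measure theory on pairs\<close>

instantiation "fun" :: (type, scaleR) scaleR
begin

definition scaleR_fun :: "real \<Rightarrow> ('a \<Rightarrow> 'b) \<Rightarrow> 'a \<Rightarrow> 'b" where
  "scaleR_fun c u = (\<lambda>x. c *\<^sub>R u x)"

instance ..

end

instance "fun" :: (type, real_vector) real_vector
  by standard (auto simp: scaleR_fun_def plus_fun_def algebra_simps)

lemma scaleR_fun_apply [simp]: "(c *\<^sub>R u) x = c *\<^sub>R u x"
  by (simp add: scaleR_fun_def)

lemma measurable_ident_lebesgue: "(\<lambda>x. x) \<in> borel_measurable lebesgue"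
  by (intro measurable_completion) simp

lemma sigma_finite_lebesgue: "sigma_finite_measure (lebesgue :: 'a::euclidean_space measure)"
proof
  let ?A = "range (\<lambda>n::nat. ball (0::'a) (real n))"
  have "\<Union> ?A = space lebesgue"
    by (auto intro: reals_Archimedean2)
  moreover have "emeasure lebesgue S \<noteq> \<infinity>" if "S \<in> ?A" for S
    using that emeasure_lborel_ball_finite[where 'a = 'a] by (auto simp: less_top[symmetric])
  ultimately show "\<exists>A. countable A \<and> A \<subseteq> sets lebesgue \<and> \<Union> A = space lebesgue \<and>
      (\<forall>S\<in>A. emeasure (lebesgue :: 'a measure) S \<noteq> \<infinity>)"
    by (intro exI[of _ ?A]) auto
qed

interpretation lebesgue: sigma_finite_measure "lebesgue :: 'a::euclidean_space measure"
  by (rule sigma_finite_lebesgue)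

interpretation lebesgue_pair: pair_sigma_finite
  "lebesgue :: 'a::euclidean_space measure" "lebesgue :: 'a::euclidean_space measure" ..

lemma AE_both_components:
  assumes "AE x in (lebesgue :: 'a::euclidean_space measure). P x"
  shows "AE z in (lebesgue :: 'a measure) \<Otimes>\<^sub>M (lebesgue :: 'a measure). P (fst z) \<and> P (snd z)"
proof -
  let ?L = "lebesgue :: 'a measure"
  obtain N where "{x \<in> space lebesgue. \<not> P x} \<subseteq> N" and N: "N \<in> null_sets lebesgue"
    using assms unfolding eventually_ae_filter by blast
  have N': "x \<in> N" if "\<not> P x" for x
    using \<open>{x \<in> space lebesgue. \<not> P x} \<subseteq> N\<close> that by auto
  from N have sets: "N \<in> sets lebesgue" and zero: "emeasure lebesgue N = 0"
    by auto
  have times: "emeasure (?L \<Otimes>\<^sub>M ?L) (X \<times> Y) = emeasure lebesgue X * emeasure lebesgue Y"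
    if "X \<in> sets lebesgue" "Y \<in> sets lebesgue" for X Y :: "'a set"
    using that by (rule lebesgue.emeasure_pair_measure_Times)
  have UNIV: "(UNIV :: 'a set) \<in> sets lebesgue"
    by simp
  have "N \<times> UNIV \<in> null_sets (?L \<Otimes>\<^sub>M ?L)"
  proof (rule null_setsI)
    show "emeasure (?L \<Otimes>\<^sub>M ?L) (N \<times> UNIV) = 0"
      by (simp only: times[OF sets UNIV] zero mult_zero_left)
  qed (rule pair_measureI[OF sets UNIV])
  moreover have "UNIV \<times> N \<in> null_sets (?L \<Otimes>\<^sub>M ?L)"
  proof (rule null_setsI)
    show "emeasure (?L \<Otimes>\<^sub>M ?L) (UNIV \<times> N) = 0"
      by (simp only: times[OF UNIV sets] zero mult_zero_right)
  qed (rule pair_measureI[OF UNIV sets])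
  ultimately have "N \<times> UNIV \<union> UNIV \<times> N \<in> null_sets (?L \<Otimes>\<^sub>M ?L)"
    by (rule null_sets.Un)
  then show ?thesis
  proof (rule AE_I', intro subsetI)
    fix z
    assume "z \<in> {z \<in> space (?L \<Otimes>\<^sub>M ?L). \<not> (P (fst z) \<and> P (snd z))}"
    then have "\<not> P (fst z) \<or> \<not> P (snd z)"
      by simp
    then show "z \<in> N \<times> UNIV \<union> UNIV \<times> N"
      using N'[of "fst z"] N'[of "snd z"] by (cases z) auto
  qed
qed

text \<open>Fatou's lemma, in the form used for lower semicontinuity.\<close>

lemma nn_integral_le_if_AE_tendsto:
  assumes f: "\<And>k::nat. f k \<in> borel_measurable M" and lim: "AE z in M. (\<lambda>k. f k z) \<longlonglongrightarrow> g z"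
    and bound: "\<forall>\<^sub>F k in sequentially. (\<integral>\<^sup>+z. f k z \<partial>M) \<le> C"
  shows "(\<integral>\<^sup>+z. g z \<partial>M) \<le> (C :: ennreal)"
proof -
  have "(\<integral>\<^sup>+z. g z \<partial>M) = (\<integral>\<^sup>+z. liminf (\<lambda>k. f k z) \<partial>M)"
    using lim by (intro nn_integral_cong_AE) (auto elim!: eventually_mono simp: lim_imp_Liminf)
  also have "\<dots> \<le> liminf (\<lambda>k. \<integral>\<^sup>+z. f k z \<partial>M)"
    by (rule nn_integral_liminf[OF f])
  also have "\<dots> \<le> C"
    using bound by (intro Liminf_le) auto
  finally show ?thesis .
qed

text \<open>
  Geometrically decaying \<open>p\<close>-energies: since the integral of \<open>\<Sum>k. 2 ^ k * w * \<bar>D k\<bar> powr p\<close> is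
  finite, \<open>\<bar>D k\<bar>\<close> decays geometrically at almost every point of positive weight.
\<close>

lemma AE_summable_if_energies_decay:
  fixes D :: "nat \<Rightarrow> 'b \<Rightarrow> real"
  assumes p: "0 < p" and D [measurable]: "\<And>k. D k \<in> borel_measurable M"
    and w [measurable]: "w \<in> borel_measurable M"
    and decay: "\<And>k. (\<integral>\<^sup>+z. ennreal (w z * \<bar>D k z\<bar> powr p) \<partial>M) \<le> ennreal ((1/4) ^ k)"
  shows "AE z in M. 0 < w z \<longrightarrow> summable (\<lambda>k. D k z)"
proof -
  have "(\<integral>\<^sup>+z. (\<Sum>k. ennreal (2 ^ k) * ennreal (w z * \<bar>D k z\<bar> powr p)) \<partial>M)
      = (\<Sum>k. ennreal (2 ^ k) * (\<integral>\<^sup>+z. ennreal (w z * \<bar>D k z\<bar> powr p) \<partial>M))"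
    by (subst nn_integral_suminf) (auto simp: nn_integral_cmult)
  also have "\<dots> \<le> (\<Sum>k. ennreal ((1/2) ^ k))"
  proof (rule suminf_le)
    fix k
    have "ennreal (2 ^ k) * (\<integral>\<^sup>+z. ennreal (w z * \<bar>D k z\<bar> powr p) \<partial>M)
        \<le> ennreal (2 ^ k) * ennreal ((1/4) ^ k)"
      by (intro mult_left_mono decay) auto
    also have "\<dots> = ennreal (2 ^ k * (1/4) ^ k)"
      by (rule ennreal_mult[symmetric]) simp_all
    also have "(2::real) ^ k * (1/4) ^ k = (1/2) ^ k"
      unfolding power_mult_distrib[symmetric] by simp
    finally show "ennreal (2 ^ k) * (\<integral>\<^sup>+z. ennreal (w z * \<bar>D k z\<bar> powr p) \<partial>M) \<le> ennreal ((1/2) ^ k)" .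
  qed auto
  also have "\<dots> = ennreal (\<Sum>k. (1/2) ^ k)"
    by (rule suminf_ennreal2) (simp_all add: summable_geometric)
  also have "\<dots> < \<infinity>"
    by (simp only: ennreal_less_top infinity_ennreal_def)
  finally have fin: "(\<integral>\<^sup>+z. (\<Sum>k. ennreal (2 ^ k) * ennreal (w z * \<bar>D k z\<bar> powr p)) \<partial>M) \<noteq> \<infinity>"
    by simp
  have "AE z in M. (\<Sum>k. ennreal (2 ^ k) * ennreal (w z * \<bar>D k z\<bar> powr p)) \<noteq> \<infinity>"
    by (rule nn_integral_PInf_AE[OF _ fin]) measurable
  then show ?thesis
  proof (rule eventually_mono, intro impI)
    fix z
    assume "(\<Sum>k. ennreal (2 ^ k) * ennreal (w z * \<bar>D k z\<bar> powr p)) \<noteq> \<infinity>" and w: "0 < w z"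
    then obtain S where S: "0 \<le> S" "(\<Sum>k. ennreal (2 ^ k) * ennreal (w z * \<bar>D k z\<bar> powr p)) = ennreal S"
      by (cases "\<Sum>k. ennreal (2 ^ k) * ennreal (w z * \<bar>D k z\<bar> powr p)") auto
    have term_le: "2 ^ k * (w z * \<bar>D k z\<bar> powr p) \<le> S" for k
    proof -
      have "ennreal (2 ^ k) * ennreal (w z * \<bar>D k z\<bar> powr p)
          \<le> (\<Sum>k. ennreal (2 ^ k) * ennreal (w z * \<bar>D k z\<bar> powr p))"
        using sum_le_suminf[of "\<lambda>k. ennreal (2 ^ k) * ennreal (w z * \<bar>D k z\<bar> powr p)" "{k}"] by simp
      then have "ennreal (2 ^ k * (w z * \<bar>D k z\<bar> powr p)) \<le> ennreal S"
        unfolding S(2) using w by (subst ennreal_mult) auto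
      then show ?thesis
        using S(1) by (simp only: ennreal_le_iff)
    qed
    define q where "q = (1/2) powr (1 / p)"
    have q: "0 < q" "q < 1"
      using p powr_less_mono2[of "1 / p" "1 / 2" 1] by (auto simp: q_def)
    have bound: "norm (D k z) \<le> (S / w z) powr (1 / p) * q ^ k" for k
    proof -
      have "\<bar>D k z\<bar> powr p \<le> S / w z * (1/2) ^ k"
        using term_le[of k] w by (simp add: field_simps power_divide)
      then have "(\<bar>D k z\<bar> powr p) powr (1 / p) \<le> (S / w z * (1/2) ^ k) powr (1 / p)"
        using p by (intro powr_mono2) auto
      also have "\<dots> = (S / w z) powr (1 / p) * ((1/2) ^ k) powr (1 / p)"
        by (rule powr_mult)
      also have "((1/2) ^ k) powr (1 / p) = q ^ k"
      proof -
        have "((1/2) ^ k) powr (1 / p) = ((1/2) powr real k) powr (1 / p)"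
          by (subst powr_realpow) simp_all
        also have "\<dots> = q powr real k"
          unfolding q_def powr_powr by (simp only: mult.commute)
        also have "\<dots> = q ^ k"
          by (rule powr_realpow[OF q(1)])
        finally show ?thesis .
      qed
      finally show ?thesis
        using p by (simp add: powr_powr)
    qed
    have "summable (\<lambda>k. (S / w z) powr (1 / p) * q ^ k)"
      using q by (intro summable_mult summable_geometric) auto
    then show "summable (\<lambda>k. D k z)"
      by (rule summable_comparison_test') (rule bound)
  qed
qed

lemma weighted_power_integral_mono:
  fixes f1 f2 f3 f4 w :: "'b \<Rightarrow> real"
  assumes [measurable]: "w \<in> borel_measurable M" "f1 \<in> borel_measurable M" "f2 \<in> borel_measurable M"
      "f3 \<in> borel_measurable M" "f4 \<in> borel_measurable M"
    and coeff: "0 \<le> k" "0 \<le> A" "0 \<le> B"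
    and le: "\<And>z. \<bar>f1 z\<bar> powr p + k * \<bar>f2 z\<bar> powr p \<le> A * \<bar>f3 z\<bar> powr p + B * \<bar>f4 z\<bar> powr p"
  shows "(\<integral>\<^sup>+z. ennreal (w z * \<bar>f1 z\<bar> powr p) \<partial>M) + ennreal k * (\<integral>\<^sup>+z. ennreal (w z * \<bar>f2 z\<bar> powr p) \<partial>M)
    \<le> ennreal A * (\<integral>\<^sup>+z. ennreal (w z * \<bar>f3 z\<bar> powr p) \<partial>M) +
      ennreal B * (\<integral>\<^sup>+z. ennreal (w z * \<bar>f4 z\<bar> powr p) \<partial>M)"
proof -
  have pointwise: "ennreal (w z * \<bar>f1 z\<bar> powr p) + ennreal k * ennreal (w z * \<bar>f2 z\<bar> powr p)
      \<le> ennreal A * ennreal (w z * \<bar>f3 z\<bar> powr p) + ennreal B * ennreal (w z * \<bar>f4 z\<bar> powr p)" for z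
  \<comment> \<open>At points of negative weight all terms are truncated to \<open>0\<close>.\<close>
  proof (cases "0 \<le> w z")
    case True
    have "w z * (\<bar>f1 z\<bar> powr p + k * \<bar>f2 z\<bar> powr p) \<le> w z * (A * \<bar>f3 z\<bar> powr p + B * \<bar>f4 z\<bar> powr p)"
      using le True by (intro mult_left_mono)
    then have "ennreal (w z * \<bar>f1 z\<bar> powr p + k * (w z * \<bar>f2 z\<bar> powr p))
        \<le> ennreal (A * (w z * \<bar>f3 z\<bar> powr p) + B * (w z * \<bar>f4 z\<bar> powr p))"
      by (intro ennreal_leI) (simp add: algebra_simps)
    then show ?thesis
      using True coeff by (simp add: ennreal_mult)
  next
    case False
    then have "ennreal (w z * \<bar>f z\<bar> powr p) = 0" for f :: "'b \<Rightarrow> real"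
      by (simp add: ennreal_neg mult_nonpos_nonneg)
    then show ?thesis
      by simp
  qed
  have "(\<integral>\<^sup>+z. ennreal (w z * \<bar>f1 z\<bar> powr p) + ennreal k * ennreal (w z * \<bar>f2 z\<bar> powr p) \<partial>M)
      \<le> (\<integral>\<^sup>+z. ennreal A * ennreal (w z * \<bar>f3 z\<bar> powr p) + ennreal B * ennreal (w z * \<bar>f4 z\<bar> powr p) \<partial>M)"
    by (intro nn_integral_mono pointwise)
  then show ?thesis
    by (simp add: nn_integral_add nn_integral_cmult)
qed

lemma ennreal_combination:
  assumes "0 \<le> A" "0 \<le> B" "0 \<le> x" "0 \<le> y"
  shows "ennreal (A * x + B * y) = ennreal A * ennreal x + ennreal B * ennreal y"
proof -
  have "ennreal (A * x + B * y) = ennreal (A * x) + ennreal (B * y)"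
    using assms by (intro ennreal_plus) auto
  then show ?thesis
    using assms by (simp only: ennreal_mult)
qed

section \<open>The energy of the fractional space\<close>

locale fractional_energy =
  fixes \<Omega> :: "'a::euclidean_space set" and a :: "'a \<Rightarrow> real" and s p :: real
  assumes open_\<Omega>: "open \<Omega>" and \<Omega>_nonempty: "\<Omega> \<noteq> {}" and bounded_\<Omega>: "bounded \<Omega>"
    and p_ge_2': "2 \<le> p"
    and a_Linfty: "in_Linfty \<Omega> a" and a_ess_inf: "0 < ess_inf \<Omega> a"
begin

abbreviation W :: "('a \<Rightarrow> real) set" where
  "W \<equiv> W_space \<Omega> a s p"

abbreviation pairs :: "('a \<times> 'a) measure" where
  "pairs \<equiv> lebesgue \<Otimes>\<^sub>M lebesgue"

text \<open>
  With the set \<open>T_set \<Omega>\<close> and the factor \<open>1 / 2\<close> included, the nonlocal part of the energy is a weighted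
  integral of a \<open>p\<close>-th power, as is the local part, so that the same lemmas apply to both.
\<close>

definition kernel :: "'a \<times> 'a \<Rightarrow> real" where
  "kernel z = indicator (T_set \<Omega>) z * (1 / 2) / norm (fst z - snd z) powr (real DIM('a) + s * p)"

definition increment :: "('a \<Rightarrow> real) \<Rightarrow> 'a \<times> 'a \<Rightarrow> real" where
  "increment u z = u (fst z) - u (snd z)"

definition energy :: "('a \<Rightarrow> real) \<Rightarrow> real" where
  "energy u = enn2real (W_energy \<Omega> a s p u)"

lemma \<Omega>_sets [measurable, simp]: "\<Omega> \<in> sets lebesgue"
  using open_\<Omega> by simp

lemma T_set_sets [measurable]: "T_set \<Omega> \<in> sets pairs"
proof -
  have "space pairs - (UNIV - \<Omega>) \<times> (UNIV - \<Omega>) \<in> sets pairs"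
    using sets.compl_sets[OF \<Omega>_sets] by (intro sets.compl_sets pair_measureI) auto
  then show ?thesis
    by (simp add: T_set_def space_pair_measure)
qed

lemma distance_measurable [measurable]: "(\<lambda>z. norm (fst z - snd z)) \<in> borel_measurable pairs"
proof -
  have [measurable]: "(\<lambda>z. fst z) \<in> borel_measurable pairs" "(\<lambda>z. snd z) \<in> borel_measurable pairs"
    using measurable_compose[OF measurable_fst measurable_ident_lebesgue]
      measurable_compose[OF measurable_snd measurable_ident_lebesgue] by auto
  show ?thesis
    by measurable
qed

lemma kernel_measurable [measurable]: "kernel \<in> borel_measurable pairs"
  unfolding kernel_def by measurable

lemma kernel_nonneg: "0 \<le> kernel z"
  by (simp add: kernel_def)

lemma kernel_pos: "z \<in> T_set \<Omega> \<Longrightarrow> fst z \<noteq> snd z \<Longrightarrow> 0 < kernel z"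
  by (simp add: kernel_def)

lemma restrict_measurable: "u \<in> borel_measurable lebesgue \<Longrightarrow> u \<in> borel_measurable (lebesgue_on \<Omega>)"
  by (rule measurable_restrict_space1)

lemma a_measurable [measurable]: "a \<in> borel_measurable (lebesgue_on \<Omega>)"
  using a_Linfty by (simp add: in_Linfty_def)

lemma increment_measurable [measurable]:
  "u \<in> borel_measurable lebesgue \<Longrightarrow> increment u \<in> borel_measurable pairs"
  unfolding increment_def
  by (intro borel_measurable_diff measurable_compose[OF measurable_fst] measurable_compose[OF measurable_snd])

lemma W_energy_eq:
  assumes [measurable]: "u \<in> borel_measurable lebesgue"
  shows "W_energy \<Omega> a s p u = (\<integral>\<^sup>+x. ennreal (a x * \<bar>u x\<bar> powr p) \<partial>lebesgue_on \<Omega>) +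
    (\<integral>\<^sup>+z. ennreal (kernel z * \<bar>increment u z\<bar> powr p) \<partial>pairs)"
proof -
  let ?q = "\<lambda>z. ennreal (\<bar>u (fst z) - u (snd z)\<bar> powr p / norm (fst z - snd z) powr (real DIM('a) + s * p)) *
      indicator (T_set \<Omega>) z"
  have [measurable]: "(\<lambda>z. u (fst z)) \<in> borel_measurable pairs" "(\<lambda>z. u (snd z)) \<in> borel_measurable pairs"
    by (auto intro: measurable_compose[OF measurable_fst] measurable_compose[OF measurable_snd])
  have meas: "?q \<in> borel_measurable pairs"
    by measurable
  have half: "ennreal (1 / 2) * ennreal X = ennreal (1 / 2 * X)" if "0 \<le> X" for X
    using that by (intro ennreal_mult[symmetric]) simp_all
  have pointwise: "ennreal (1 / 2) * ?q z = ennreal (kernel z * \<bar>increment u z\<bar> powr p)" for z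
  proof (cases "z \<in> T_set \<Omega>")
    case True
    then have "ennreal (1 / 2) * ?q z = ennreal (1 / 2) *
        ennreal (\<bar>u (fst z) - u (snd z)\<bar> powr p / norm (fst z - snd z) powr (real DIM('a) + s * p))"
      by (simp only: indicator_simps mult_1_right)
    also have "\<dots> = ennreal (1 / 2 *
        (\<bar>u (fst z) - u (snd z)\<bar> powr p / norm (fst z - snd z) powr (real DIM('a) + s * p)))"
      by (rule half) simp
    finally show ?thesis
      using True by (simp add: kernel_def increment_def)
  next
    case False
    then show ?thesis
      by (simp add: kernel_def)
  qed
  have "ennreal (1 / 2) * (\<integral>\<^sup>+z. ?q z \<partial>pairs) = (\<integral>\<^sup>+z. ennreal (1 / 2) * ?q z \<partial>pairs)"
    by (rule nn_integral_cmult[symmetric, OF meas])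
  also have "\<dots> = (\<integral>\<^sup>+z. ennreal (kernel z * \<bar>increment u z\<bar> powr p) \<partial>pairs)"
    by (simp only: pointwise)
  finally show ?thesis
    unfolding W_energy_def case_prod_beta by simp
qed

lemma W_D: "u \<in> W \<Longrightarrow> u \<in> borel_measurable lebesgue" "u \<in> W \<Longrightarrow> W_energy \<Omega> a s p u < \<infinity>"
  by (auto simp: W_space_def)

lemma W_energy_ennreal: "u \<in> W \<Longrightarrow> W_energy \<Omega> a s p u = ennreal (energy u)"
  using W_D(2) by (simp add: energy_def)

lemma energy_nonneg: "0 \<le> energy u"
  by (simp add: energy_def)

text \<open>
  Every inequality between \<open>p\<close>-th powers of real numbers that is linear in the powers passes to the
  energies, since it may be used for values and for increments alike.
\<close>

lemma W_energy_mono: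
  assumes [measurable]: "u1 \<in> borel_measurable lebesgue" "u2 \<in> borel_measurable lebesgue"
      "u3 \<in> borel_measurable lebesgue" "u4 \<in> borel_measurable lebesgue"
    and coeff: "0 \<le> k" "0 \<le> A" "0 \<le> B"
    and val: "\<And>x. \<bar>u1 x\<bar> powr p + k * \<bar>u2 x\<bar> powr p \<le> A * \<bar>u3 x\<bar> powr p + B * \<bar>u4 x\<bar> powr p"
    and inc: "\<And>z. \<bar>increment u1 z\<bar> powr p + k * \<bar>increment u2 z\<bar> powr p
      \<le> A * \<bar>increment u3 z\<bar> powr p + B * \<bar>increment u4 z\<bar> powr p"
  shows "W_energy \<Omega> a s p u1 + ennreal k * W_energy \<Omega> a s p u2
    \<le> ennreal A * W_energy \<Omega> a s p u3 + ennreal B * W_energy \<Omega> a s p u4"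
proof -
  have [measurable]: "u1 \<in> borel_measurable (lebesgue_on \<Omega>)" "u2 \<in> borel_measurable (lebesgue_on \<Omega>)"
      "u3 \<in> borel_measurable (lebesgue_on \<Omega>)" "u4 \<in> borel_measurable (lebesgue_on \<Omega>)"
    by (auto intro!: restrict_measurable)
  have local: "(\<integral>\<^sup>+x. ennreal (a x * \<bar>u1 x\<bar> powr p) \<partial>lebesgue_on \<Omega>) +
        ennreal k * (\<integral>\<^sup>+x. ennreal (a x * \<bar>u2 x\<bar> powr p) \<partial>lebesgue_on \<Omega>)
      \<le> ennreal A * (\<integral>\<^sup>+x. ennreal (a x * \<bar>u3 x\<bar> powr p) \<partial>lebesgue_on \<Omega>) +
        ennreal B * (\<integral>\<^sup>+x. ennreal (a x * \<bar>u4 x\<bar> powr p) \<partial>lebesgue_on \<Omega>)"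
    by (rule weighted_power_integral_mono[OF _ _ _ _ _ coeff val]) measurable
  have nonlocal: "(\<integral>\<^sup>+z. ennreal (kernel z * \<bar>increment u1 z\<bar> powr p) \<partial>pairs) +
        ennreal k * (\<integral>\<^sup>+z. ennreal (kernel z * \<bar>increment u2 z\<bar> powr p) \<partial>pairs)
      \<le> ennreal A * (\<integral>\<^sup>+z. ennreal (kernel z * \<bar>increment u3 z\<bar> powr p) \<partial>pairs) +
        ennreal B * (\<integral>\<^sup>+z. ennreal (kernel z * \<bar>increment u4 z\<bar> powr p) \<partial>pairs)"
    by (rule weighted_power_integral_mono[OF _ _ _ _ _ coeff inc]) measurable
  have "W_energy \<Omega> a s p u1 + ennreal k * W_energy \<Omega> a s p u2 =
      ((\<integral>\<^sup>+x. ennreal (a x * \<bar>u1 x\<bar> powr p) \<partial>lebesgue_on \<Omega>) +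
        ennreal k * (\<integral>\<^sup>+x. ennreal (a x * \<bar>u2 x\<bar> powr p) \<partial>lebesgue_on \<Omega>)) +
      ((\<integral>\<^sup>+z. ennreal (kernel z * \<bar>increment u1 z\<bar> powr p) \<partial>pairs) +
        ennreal k * (\<integral>\<^sup>+z. ennreal (kernel z * \<bar>increment u2 z\<bar> powr p) \<partial>pairs))"
    unfolding W_energy_eq[OF assms(1)] W_energy_eq[OF assms(2)] by (simp add: distrib_left ac_simps)
  also have "\<dots> \<le> (ennreal A * (\<integral>\<^sup>+x. ennreal (a x * \<bar>u3 x\<bar> powr p) \<partial>lebesgue_on \<Omega>) +
        ennreal B * (\<integral>\<^sup>+x. ennreal (a x * \<bar>u4 x\<bar> powr p) \<partial>lebesgue_on \<Omega>)) +
      (ennreal A * (\<integral>\<^sup>+z. ennreal (kernel z * \<bar>increment u3 z\<bar> powr p) \<partial>pairs) +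
        ennreal B * (\<integral>\<^sup>+z. ennreal (kernel z * \<bar>increment u4 z\<bar> powr p) \<partial>pairs))"
    by (intro add_mono local nonlocal)
  also have "\<dots> = ennreal A * W_energy \<Omega> a s p u3 + ennreal B * W_energy \<Omega> a s p u4"
    unfolding W_energy_eq[OF assms(3)] W_energy_eq[OF assms(4)] by (simp add: distrib_left ac_simps)
  finally show ?thesis .
qed

lemma increment_simps [simp]:
  "increment (u + v) z = increment u z + increment v z"
  "increment (u - v) z = increment u z - increment v z"
  "increment (c *\<^sub>R u) z = c * increment u z"
  "increment 0 z = 0"
  by (auto simp: increment_def algebra_simps)

lemma fun_measurable [measurable (raw)]:
  fixes u v :: "'a \<Rightarrow> real"
  shows "u \<in> borel_measurable M \<Longrightarrow> v \<in> borel_measurable M \<Longrightarrow> u + v \<in> borel_measurable M"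
    and "u \<in> borel_measurable M \<Longrightarrow> v \<in> borel_measurable M \<Longrightarrow> u - v \<in> borel_measurable M"
    and "u \<in> borel_measurable M \<Longrightarrow> c *\<^sub>R u \<in> borel_measurable M"
    and "(0 :: 'a \<Rightarrow> real) \<in> borel_measurable M"
  by (auto simp: plus_fun_def fun_diff_def scaleR_fun_def zero_fun_def)

lemma W_energy_scale:
  assumes [measurable]: "u \<in> borel_measurable lebesgue"
  shows "W_energy \<Omega> a s p (c *\<^sub>R u) = ennreal (\<bar>c\<bar> powr p) * W_energy \<Omega> a s p u"
proof -
  have le: "W_energy \<Omega> a s p (c *\<^sub>R u) \<le> ennreal (\<bar>c\<bar> powr p) * W_energy \<Omega> a s p u"
    if [measurable]: "u \<in> borel_measurable lebesgue" for c u
    using W_energy_mono[of "c *\<^sub>R u" 0 u 0 0 "\<bar>c\<bar> powr p" 0] by (simp add: abs_mult powr_mult)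
  show ?thesis
  proof (cases "c = 0")
    case True
    then show ?thesis
      using le[of u 0] by simp
  next
    case False
    have "ennreal (\<bar>c\<bar> powr p) * W_energy \<Omega> a s p u
        \<le> ennreal (\<bar>c\<bar> powr p) * (ennreal (\<bar>1 / c\<bar> powr p) * W_energy \<Omega> a s p (c *\<^sub>R u))"
      using le[of "c *\<^sub>R u" "1 / c"] False by (intro mult_left_mono) auto
    also have "\<dots> = W_energy \<Omega> a s p (c *\<^sub>R u)"
      using False by (simp add: mult.assoc[symmetric] ennreal_mult[symmetric] powr_mult[symmetric])
    finally show ?thesis
      using le[of u c] by (intro antisym) auto
  qed
qed

lemma W_energy_convex:
  assumes [measurable]: "u \<in> borel_measurable lebesgue" "v \<in> borel_measurable lebesgue"
    and t: "0 \<le> t" "t \<le> 1"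
  shows "W_energy \<Omega> a s p ((1 - t) *\<^sub>R u + t *\<^sub>R v)
    \<le> ennreal (1 - t) * W_energy \<Omega> a s p u + ennreal t * W_energy \<Omega> a s p v"
  using W_energy_mono[of "(1 - t) *\<^sub>R u + t *\<^sub>R v" 0 u v 0 "1 - t" t] abs_powr_convex[of p t] p_ge_2' t
  by simp

lemma W_scale: "u \<in> W \<Longrightarrow> c *\<^sub>R u \<in> W"
  by (auto simp: W_space_def W_energy_scale ennreal_mult_less_top)

lemma W_add:
  assumes "u \<in> W" "v \<in> W"
  shows "u + v \<in> W"
proof -
  have "W_energy \<Omega> a s p ((1 - 1/2) *\<^sub>R u + (1/2) *\<^sub>R v)
      \<le> ennreal (1 - 1/2) * W_energy \<Omega> a s p u + ennreal (1/2) * W_energy \<Omega> a s p v"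
    using assms by (intro W_energy_convex) (auto simp: W_D)
  also have "\<dots> < \<infinity>"
    unfolding W_energy_ennreal[OF assms(1)] W_energy_ennreal[OF assms(2)]
    by (subst ennreal_combination[symmetric], simp, simp, rule energy_nonneg, rule energy_nonneg,
        simp only: ennreal_less_top infinity_ennreal_def)
  finally have "(1 - 1/2) *\<^sub>R u + (1/2) *\<^sub>R v \<in> W"
    using assms[THEN W_D(1)] by (simp add: W_space_def)
  from W_scale[OF this, of 2] show ?thesis
    by (simp add: scaleR_add_right)
qed

lemma W_0: "0 \<in> W"
proof -
  have "W_energy \<Omega> a s p (0 *\<^sub>R 0) = 0"
    by (subst W_energy_scale) auto
  then show ?thesis
    by (simp add: W_space_def)
qed

lemma subspace_W: "subspace W"
  unfolding subspace_def using W_0 W_add W_scale by blast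

lemma W_diff: "u \<in> W \<Longrightarrow> v \<in> W \<Longrightarrow> u - v \<in> W"
  by (rule subspace_diff[OF subspace_W])

lemma energy_convex:
  assumes uv: "u \<in> W" "v \<in> W" and t: "0 \<le> t" "t \<le> 1"
  shows "energy ((1 - t) *\<^sub>R u + t *\<^sub>R v) \<le> (1 - t) * energy u + t * energy v"
proof -
  have W: "(1 - t) *\<^sub>R u + t *\<^sub>R v \<in> W"
    using uv by (intro W_add W_scale)
  have "ennreal (energy ((1 - t) *\<^sub>R u + t *\<^sub>R v))
      \<le> ennreal (1 - t) * ennreal (energy u) + ennreal t * ennreal (energy v)"
    using W_energy_convex[OF W_D(1)[OF uv(1)] W_D(1)[OF uv(2)] t]
    unfolding W_energy_ennreal[OF W] W_energy_ennreal[OF uv(1)] W_energy_ennreal[OF uv(2)] .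
  also have "\<dots> = ennreal ((1 - t) * energy u + t * energy v)"
    using t energy_nonneg by (intro ennreal_combination[symmetric]) auto
  finally have "ennreal (energy ((1 - t) *\<^sub>R u + t *\<^sub>R v)) \<le> ennreal ((1 - t) * energy u + t * energy v)" .
  moreover have "0 \<le> (1 - t) * energy u + t * energy v"
    using t energy_nonneg by (intro add_nonneg_nonneg mult_nonneg_nonneg) auto
  ultimately show ?thesis
    by (rule iffD1[OF ennreal_le_iff, rotated])
qed

lemma energy_clarkson:
  assumes uv: "u \<in> W" "v \<in> W"
  shows "energy ((1/2) *\<^sub>R (u + v)) + energy ((1/2) *\<^sub>R (u - v)) \<le> (energy u + energy v) / 2"
proof -
  have W: "(1/2) *\<^sub>R (u + v) \<in> W" "(1/2) *\<^sub>R (u - v) \<in> W"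
    using uv by (auto intro!: W_add W_scale W_diff)
  have "W_energy \<Omega> a s p ((1/2) *\<^sub>R (u + v)) + ennreal 1 * W_energy \<Omega> a s p ((1/2) *\<^sub>R (u - v))
      \<le> ennreal (1/2) * W_energy \<Omega> a s p u + ennreal (1/2) * W_energy \<Omega> a s p v"
    unfolding W_energy_def[symmetric]
  proof (rule W_energy_mono)
    have real: "\<bar>(1/2) * (\<alpha> + \<beta>)\<bar> powr p + 1 * \<bar>(1/2) * (\<alpha> - \<beta>)\<bar> powr p
        \<le> (1/2) * \<bar>\<alpha>\<bar> powr p + (1/2) * \<bar>\<beta>\<bar> powr p" for \<alpha> \<beta>
      using clarkson_real[OF p_ge_2', of \<alpha> \<beta>]
      by (simp only: times_divide_eq_left mult_1_left add_divide_distrib diff_divide_distrib)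
    show "\<bar>((1/2) *\<^sub>R (u + v)) x\<bar> powr p + 1 * \<bar>((1/2) *\<^sub>R (u - v)) x\<bar> powr p
        \<le> (1/2) * \<bar>u x\<bar> powr p + (1/2) * \<bar>v x\<bar> powr p" for x
      unfolding scaleR_fun_apply plus_fun_apply minus_apply real_scaleR_def by (rule real)
    show "\<bar>increment ((1/2) *\<^sub>R (u + v)) z\<bar> powr p + 1 * \<bar>increment ((1/2) *\<^sub>R (u - v)) z\<bar> powr p
        \<le> (1/2) * \<bar>increment u z\<bar> powr p + (1/2) * \<bar>increment v z\<bar> powr p" for z
      unfolding increment_simps by (rule real)
  qed (use W uv W_D in simp_all)
  then have le: "ennreal (energy ((1/2) *\<^sub>R (u + v))) + ennreal 1 * ennreal (energy ((1/2) *\<^sub>R (u - v)))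
      \<le> ennreal (1/2) * ennreal (energy u) + ennreal (1/2) * ennreal (energy v)"
    unfolding W_energy_ennreal[OF W(1)] W_energy_ennreal[OF W(2)]
      W_energy_ennreal[OF uv(1)] W_energy_ennreal[OF uv(2)] .
  have "ennreal (energy ((1/2) *\<^sub>R (u + v)) + energy ((1/2) *\<^sub>R (u - v))) =
      ennreal (energy ((1/2) *\<^sub>R (u + v))) + ennreal 1 * ennreal (energy ((1/2) *\<^sub>R (u - v)))"
    using energy_nonneg by (subst ennreal_plus) auto
  also note le
  also have "ennreal (1/2) * ennreal (energy u) + ennreal (1/2) * ennreal (energy v) =
      ennreal (1/2 * energy u + 1/2 * energy v)"
    using energy_nonneg by (intro ennreal_combination[symmetric]) auto
  finally have "energy ((1/2) *\<^sub>R (u + v)) + energy ((1/2) *\<^sub>R (u - v)) \<le> 1/2 * energy u + 1/2 * energy v"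
    by (rule iffD1[OF ennreal_le_iff, rotated]) (use energy_nonneg[of u] energy_nonneg[of v] in simp)
  then show ?thesis
    by simp
qed

lemma energy_scale: "u \<in> W \<Longrightarrow> energy (c *\<^sub>R u) = \<bar>c\<bar> powr p * energy u"
  by (simp add: energy_def W_energy_scale W_D enn2real_mult)

end

section \<open>Completeness of the fractional space\<close>

context fractional_energy
begin

lemma AE_a_pos: "AE x in lebesgue_on \<Omega>. 0 < a x"
proof -
  have neg: "esssup (lebesgue_on \<Omega>) (\<lambda>x. - ereal (a x)) < 0"
    using a_ess_inf by (simp add: ess_inf_def ereal_less_uminus_reorder)
  have "AE x in lebesgue_on \<Omega>. - ereal (a x) \<le> esssup (lebesgue_on \<Omega>) (\<lambda>x. - ereal (a x))"
    by (rule esssup_AE)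
  then show ?thesis
  proof (rule eventually_mono)
    fix x
    assume "- ereal (a x) \<le> esssup (lebesgue_on \<Omega>) (\<lambda>x. - ereal (a x))"
    then have "- ereal (a x) < 0"
      using neg by (rule le_less_trans)
    then show "0 < a x"
      by simp
  qed
qed

lemma space_\<Omega> [simp]: "space (lebesgue_on \<Omega>) = \<Omega>"
  by (simp add: space_restrict_space)

lemma AE_on_\<Omega>: "(AE x in lebesgue_on \<Omega>. Q x) \<longleftrightarrow> (AE x in lebesgue. x \<in> \<Omega> \<longrightarrow> Q x)"
  by (subst AE_restrict_space_iff) simp_all

lemma \<Omega>_not_negligible: "\<not> (AE x in lebesgue. x \<notin> \<Omega>)"
  using open_not_negligible[OF open_\<Omega> \<Omega>_nonempty] negligible_iff_null_sets AE_iff_null[of lebesgue "\<lambda>x. x \<notin> \<Omega>"]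
  by (auto simp: negligible_iff_null_sets)

lemma local_energy_le: "u \<in> borel_measurable lebesgue \<Longrightarrow>
    (\<integral>\<^sup>+x. ennreal (a x * \<bar>u x\<bar> powr p) \<partial>lebesgue_on \<Omega>) \<le> W_energy \<Omega> a s p u"
  by (simp add: W_energy_eq)

lemma nonlocal_energy_le: "u \<in> borel_measurable lebesgue \<Longrightarrow>
    (\<integral>\<^sup>+z. ennreal (kernel z * \<bar>increment u z\<bar> powr p) \<partial>pairs) \<le> W_energy \<Omega> a s p u"
  by (simp add: W_energy_eq)

text \<open>
  The local term gives convergence almost everywhere on \<open>\<Omega>\<close>. The nonlocal term makes the increments
  converge over almost every pair that meets \<open>\<Omega>\<close>; fixing one good point of \<open>\<Omega>\<close> in such pairs gives
  convergence at almost every other point.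
\<close>

lemma AE_convergent_if_energies_decay:
  assumes v: "\<And>k. v k \<in> W" and decay: "\<And>k. energy (v (Suc k) - v k) \<le> (1/4) ^ k"
  shows "AE x in lebesgue. convergent (\<lambda>k. v k x)"
proof -
  define d where "d k = v (Suc k) - v k" for k
  have dW: "d k \<in> W" for k
    using v by (simp add: d_def W_diff)
  have d_meas: "d k \<in> borel_measurable lebesgue" for k
    using W_D(1)[OF dW] .
  have d_energy: "W_energy \<Omega> a s p (d k) \<le> ennreal ((1/4) ^ k)" for k
    unfolding W_energy_ennreal[OF dW] using decay[of k] by (intro ennreal_leI) (simp add: d_def)
  have p: "0 < p"
    using p_ge_2' by simp
  have local: "AE x in lebesgue_on \<Omega>. 0 < a x \<longrightarrow> summable (\<lambda>k. d k x)"
    by (rule AE_summable_if_energies_decay[OF p restrict_measurable[OF d_meas] a_measurable])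
      (rule order_trans[OF local_energy_le[OF d_meas] d_energy])
  have nonlocal: "AE z in pairs. 0 < kernel z \<longrightarrow> summable (\<lambda>k. increment (d k) z)"
    by (rule AE_summable_if_energies_decay[OF p increment_measurable[OF d_meas] kernel_measurable])
      (rule order_trans[OF nonlocal_energy_le[OF d_meas] d_energy])
  have telescope: "(\<Sum>k<n. d k x) = v n x - v 0 x" for n x
    by (induction n) (simp_all add: d_def)
  have convergent_telescope: "convergent (\<lambda>n. w n)"
    if "summable e" "\<And>n. (\<Sum>k<n. e k) = w n - w 0" for e w :: "nat \<Rightarrow> real"
  proof -
    have "convergent (\<lambda>n. w n - w 0)"
      using that by (simp add: summable_iff_convergent)
    then show ?thesis
      by (simp add: convergent_diff_const_right_iff)
  qed
  have "AE x in lebesgue_on \<Omega>. convergent (\<lambda>k. v k x)"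
    using local AE_a_pos by eventually_elim (rule convergent_telescope[OF _ telescope], blast)
  then have inside: "AE x in lebesgue. x \<in> \<Omega> \<longrightarrow> convergent (\<lambda>k. v k x)"
    by (simp only: AE_on_\<Omega>)
  have "AE z in pairs. z \<in> T_set \<Omega> \<longrightarrow> convergent (\<lambda>k. increment (v k) z)"
    using nonlocal
  proof (rule eventually_mono, intro impI)
    fix z
    assume sum: "0 < kernel z \<longrightarrow> summable (\<lambda>k. increment (d k) z)" and z: "z \<in> T_set \<Omega>"
    show "convergent (\<lambda>k. increment (v k) z)"
    proof (cases "fst z = snd z")
      case True
      then show ?thesis
        by (simp add: increment_def convergent_const)
    next
      case False
      have "(\<Sum>k<n. increment (d k) z) = increment (v n) z - increment (v 0) z" for n
        using telescope[of "fst z" n] telescope[of "snd z" n] by (simp add: increment_def sum_subtractf)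
      with sum kernel_pos[OF z False] show ?thesis
        by (intro convergent_telescope) auto
    qed
  qed
  then have "AE x in lebesgue. AE y in lebesgue. (x, y) \<in> T_set \<Omega> \<longrightarrow> convergent (\<lambda>k. increment (v k) (x, y))"
    by (rule lebesgue_pair.AE_pair)
  with inside have "AE x in lebesgue. x \<in> \<Omega> \<longrightarrow> convergent (\<lambda>k. v k x) \<and>
      (AE y in lebesgue. (x, y) \<in> T_set \<Omega> \<longrightarrow> convergent (\<lambda>k. increment (v k) (x, y)))"
    by eventually_elim blast
  then obtain x where x: "x \<in> \<Omega>" "convergent (\<lambda>k. v k x)"
    "AE y in lebesgue. (x, y) \<in> T_set \<Omega> \<longrightarrow> convergent (\<lambda>k. increment (v k) (x, y))"
    using \<Omega>_not_negligible by (metis (mono_tags, lifting) eventually_mono)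
  from x(3) show ?thesis
  proof (rule eventually_mono)
    fix y
    assume "(x, y) \<in> T_set \<Omega> \<longrightarrow> convergent (\<lambda>k. increment (v k) (x, y))"
    then have "convergent (\<lambda>k. v k x - v k y)"
      using x(1) by (simp add: T_set_def increment_def)
    from convergent_diff[OF x(2) this] show "convergent (\<lambda>k. v k y)"
      by simp
  qed
qed

text \<open>
  Lower semicontinuity up to the factor \<open>2\<close>, which comes from bounding the local and the nonlocal part
  separately by the whole energy; it is immaterial where the bound tends to \<open>0\<close>.
\<close>

lemma W_energy_le_if_AE_tendsto:
  assumes v: "\<And>k::nat. v k \<in> W" and u: "u \<in> borel_measurable lebesgue"
    and lim: "AE x in lebesgue. (\<lambda>k. v k x) \<longlonglongrightarrow> u x"
    and bound: "\<forall>\<^sub>F k in sequentially. energy (v k) \<le> C"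
  shows "W_energy \<Omega> a s p u \<le> ennreal C + ennreal C"
proof -
  have p: "0 < p"
    using p_ge_2' by simp
  have v_meas: "v k \<in> borel_measurable lebesgue" for k
    using v by (rule W_D(1))
  have bound': "\<forall>\<^sub>F k in sequentially. W_energy \<Omega> a s p (v k) \<le> ennreal C"
    using bound by eventually_elim (simp only: W_energy_ennreal[OF v] ennreal_leI)
  have powr_lim: "(\<lambda>k. ennreal (w * \<bar>x k\<bar> powr p)) \<longlonglongrightarrow> ennreal (w * \<bar>y\<bar> powr p)"
    if "x \<longlonglongrightarrow> y" for w y and x :: "nat \<Rightarrow> real"
    using that p by (intro tendsto_ennrealI tendsto_intros tendsto_powr') auto
  have "(\<integral>\<^sup>+x. ennreal (a x * \<bar>u x\<bar> powr p) \<partial>lebesgue_on \<Omega>) \<le> ennreal C"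
  proof (rule nn_integral_le_if_AE_tendsto)
    show "(\<lambda>x. ennreal (a x * \<bar>v k x\<bar> powr p)) \<in> borel_measurable (lebesgue_on \<Omega>)" for k
      using restrict_measurable[OF v_meas[of k]] by measurable
    have "AE x in lebesgue_on \<Omega>. (\<lambda>k. v k x) \<longlonglongrightarrow> u x"
      unfolding AE_on_\<Omega> using lim by eventually_elim simp
    then show "AE x in lebesgue_on \<Omega>. (\<lambda>k. ennreal (a x * \<bar>v k x\<bar> powr p)) \<longlonglongrightarrow> ennreal (a x * \<bar>u x\<bar> powr p)"
      by eventually_elim (rule powr_lim)
    show "\<forall>\<^sub>F k in sequentially. (\<integral>\<^sup>+x. ennreal (a x * \<bar>v k x\<bar> powr p) \<partial>lebesgue_on \<Omega>) \<le> ennreal C"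
      using bound' by eventually_elim (rule order_trans[OF local_energy_le[OF v_meas]])
  qed
  moreover have "(\<integral>\<^sup>+z. ennreal (kernel z * \<bar>increment u z\<bar> powr p) \<partial>pairs) \<le> ennreal C"
  proof (rule nn_integral_le_if_AE_tendsto)
    show "(\<lambda>z. ennreal (kernel z * \<bar>increment (v k) z\<bar> powr p)) \<in> borel_measurable pairs" for k
      using increment_measurable[OF v_meas[of k]] by measurable
    from AE_both_components[OF lim]
    show "AE z in pairs. (\<lambda>k. ennreal (kernel z * \<bar>increment (v k) z\<bar> powr p))
        \<longlonglongrightarrow> ennreal (kernel z * \<bar>increment u z\<bar> powr p)"
      unfolding increment_def by eventually_elim (intro powr_lim tendsto_diff, simp_all)
    show "\<forall>\<^sub>F k in sequentially. (\<integral>\<^sup>+z. ennreal (kernel z * \<bar>increment (v k) z\<bar> powr p) \<partial>pairs) \<le> ennreal C"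
      using bound' by eventually_elim (rule order_trans[OF nonlocal_energy_le[OF v_meas]])
  qed
  ultimately show ?thesis
    unfolding W_energy_eq[OF u] by (rule add_mono)
qed

text \<open>
  As for \<open>L\<^sup>p\<close> spaces, a fast subsequence converges almost everywhere, and lower semicontinuity along
  it shows that the pointwise limit is also the limit in energy.
\<close>

lemma energy_complete:
  assumes u: "\<And>n. u n \<in> W"
    and cauchy: "\<And>\<epsilon>. 0 < \<epsilon> \<Longrightarrow> \<exists>M. \<forall>m\<ge>M. \<forall>n\<ge>M. energy (u m - u n) < \<epsilon>"
  shows "\<exists>w\<in>W. (\<lambda>n. energy (u n - w)) \<longlonglongrightarrow> 0"
proof -
  have "\<exists>M. \<forall>m\<ge>M. \<forall>n\<ge>M. energy (u m - u n) < (1/4) ^ k" for k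
    by (rule cauchy) simp
  then obtain M where M: "\<And>k m n. M k \<le> m \<Longrightarrow> M k \<le> n \<Longrightarrow> energy (u m - u n) < (1/4) ^ k"
    by metis
  define r where "r k = k + (\<Sum>j\<le>k. M j)" for k
  have r: "M k \<le> r k" "k \<le> r k" "r k \<le> r (Suc k)" for k
    using member_le_sum[of k "{..k}" M] by (auto simp: r_def)
  define v where "v k = u (r k)" for k
  have vW: "v k \<in> W" for k
    using u by (simp add: v_def)
  have "energy (v (Suc k) - v k) \<le> (1/4) ^ k" for k
    unfolding v_def using M[of k "r (Suc k)" "r k"] r[of k] by simp
  from AE_convergent_if_energies_decay[OF vW this]
  have conv: "AE x in lebesgue. convergent (\<lambda>k. v k x)" .
  define w where "w x = lim (\<lambda>k. v k x)" for x
  have w_meas: "w \<in> borel_measurable lebesgue"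
    unfolding w_def using W_D(1)[OF vW] by (intro borel_measurable_lim_metric)
  have lim: "AE x in lebesgue. (\<lambda>k. v k x) \<longlonglongrightarrow> w x"
    using conv by eventually_elim (simp add: w_def convergent_LIMSEQ_iff)
  have close: "\<exists>K. \<forall>n\<ge>K. W_energy \<Omega> a s p (u n - w) \<le> ennreal \<epsilon> + ennreal \<epsilon>" if \<epsilon>: "0 < \<epsilon>" for \<epsilon>
  proof -
    obtain K where K: "\<forall>m\<ge>K. \<forall>n\<ge>K. energy (u m - u n) < \<epsilon>"
      using cauchy[OF \<epsilon>] by blast
    have "W_energy \<Omega> a s p (u n - w) \<le> ennreal \<epsilon> + ennreal \<epsilon>" if "K \<le> n" for n
    proof (rule W_energy_le_if_AE_tendsto)
      show "u n - v k \<in> W" for k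
        using u vW by (rule W_diff)
      show "u n - w \<in> borel_measurable lebesgue"
        using W_D(1)[OF u] w_meas by (rule fun_measurable(2))
      show "AE x in lebesgue. (\<lambda>k. (u n - v k) x) \<longlonglongrightarrow> (u n - w) x"
        using lim by eventually_elim (auto intro!: tendsto_intros)
      show "\<forall>\<^sub>F k in sequentially. energy (u n - v k) \<le> \<epsilon>"
        using eventually_ge_at_top[of K]
      proof eventually_elim
        case (elim k)
        then have "K \<le> r k"
          using r(2)[of k] by simp
        then show ?case
          using K \<open>K \<le> n\<close> unfolding v_def by (intro less_imp_le) blast
      qed
    qed
    then show ?thesis
      by blast
  qed
  obtain K where "\<forall>n\<ge>K. W_energy \<Omega> a s p (u n - w) \<le> ennreal 1 + ennreal 1"
    using close[of 1] by auto
  then have "W_energy \<Omega> a s p (u K - w) < \<infinity>"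
    by (auto intro: le_less_trans)
  moreover have "u K - w \<in> borel_measurable lebesgue"
    using W_D(1)[OF u] w_meas by (rule fun_measurable(2))
  ultimately have "u K - w \<in> W"
    by (simp add: W_space_def)
  from W_diff[OF u[of K] this] have w: "w \<in> W"
    by simp
  have "(\<lambda>n. energy (u n - w)) \<longlonglongrightarrow> 0"
  proof (rule LIMSEQ_I)
    fix \<epsilon> :: real
    assume \<epsilon>: "0 < \<epsilon>"
    then obtain K where K: "\<forall>n\<ge>K. W_energy \<Omega> a s p (u n - w) \<le> ennreal (\<epsilon> / 4) + ennreal (\<epsilon> / 4)"
      using close[of "\<epsilon> / 4"] by auto
    have "norm (energy (u n - w) - 0) < \<epsilon>" if "K \<le> n" for n
    proof -
      have "ennreal (energy (u n - w)) \<le> ennreal (\<epsilon> / 4) + ennreal (\<epsilon> / 4)"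
        using K that W_energy_ennreal[OF W_diff[OF u w]] by metis
      also have "\<dots> = ennreal (\<epsilon> / 4 + \<epsilon> / 4)"
        using \<epsilon> by (intro ennreal_plus[symmetric]) auto
      finally have "energy (u n - w) \<le> \<epsilon> / 4 + \<epsilon> / 4"
        by (rule iffD1[OF ennreal_le_iff, rotated]) (use \<epsilon> in simp)
      then show ?thesis
        using \<epsilon> energy_nonneg[of "u n - w"] by simp
    qed
    then show "\<exists>K. \<forall>n\<ge>K. norm (energy (u n - w) - 0) < \<epsilon>"
      by blast
  qed
  with w show ?thesis
    by blast
qed

sublocale convex_energy W energy p
  by unfold_locales
    (fact subspace_W p_ge_2' energy_nonneg energy_scale energy_convex energy_clarkson energy_complete)+

end

section \<open>Compactness\<close>

text \<open>
  A tent of radius \<open>\<delta>\<close>. It is used as a convolution kernel because, unlike the indicator of a ball, it is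
  Lipschitz, so that means depend on their centre in a uniformly continuous way.
\<close>

definition hat :: "real \<Rightarrow> 'a::real_normed_vector \<Rightarrow> real" where
  "hat \<delta> z = max 0 (1 - norm z / \<delta>)"

lemma hat_nonneg: "0 \<le> hat \<delta> z"
  by (simp add: hat_def)

lemma hat_le_1: "0 < \<delta> \<Longrightarrow> hat \<delta> z \<le> 1"
  by (simp add: hat_def)

lemma hat_eq_0: "0 < \<delta> \<Longrightarrow> \<delta> \<le> norm z \<Longrightarrow> hat \<delta> z = 0"
  by (simp add: hat_def)

lemma hat_ge_half: "0 < \<delta> \<Longrightarrow> norm z \<le> \<delta> / 2 \<Longrightarrow> 1 / 2 \<le> hat \<delta> z"
  by (simp add: hat_def field_simps max_def)

lemma hat_lipschitz:
  assumes "0 < \<delta>"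
  shows "\<bar>hat \<delta> x - hat \<delta> y\<bar> \<le> norm (x - y) / \<delta>"
proof -
  have "\<bar>hat \<delta> x - hat \<delta> y\<bar> \<le> \<bar>norm x / \<delta> - norm y / \<delta>\<bar>"
    by (simp add: hat_def max_def abs_if)
  also have "\<dots> = \<bar>norm x - norm y\<bar> / \<delta>"
    using assms by (simp add: diff_divide_distrib[symmetric])
  also have "\<dots> \<le> norm (x - y) / \<delta>"
    using assms by (intro divide_right_mono norm_triangle_ineq3) auto
  finally show ?thesis .
qed

text \<open>
  Oscillations up to \<open>\<theta>\<close> are tolerated, and larger ones are paid for by their \<open>p\<close>-th power. This trades
  an \<open>L\<^sup>1\<close> bound for an energy bound without Hoelder's inequality.
\<close>

lemma abs_le_power_bound:
  fixes t \<theta> p :: real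
  assumes "0 < \<theta>" "1 \<le> p"
  shows "\<bar>t\<bar> \<le> \<theta> + \<theta> powr (1 - p) * \<bar>t\<bar> powr p"
proof (cases "\<bar>t\<bar> \<le> \<theta>")
  case True
  then show ?thesis
    by (simp add: add_increasing2)
next
  case False
  have "\<bar>t\<bar> powr (1 - p) \<le> \<theta> powr (1 - p)"
    using False assms by (intro powr_mono2') auto
  then have "\<bar>t\<bar> powr (1 - p) * \<bar>t\<bar> powr p \<le> \<theta> powr (1 - p) * \<bar>t\<bar> powr p"
    by (intro mult_right_mono) auto
  moreover have "\<bar>t\<bar> powr (1 - p) * \<bar>t\<bar> powr p = \<bar>t\<bar>"
    using False assms by (simp add: powr_add[symmetric])
  ultimately show ?thesis
    using assms by linarith
qed

context fractional_energy
begin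

definition vol :: real where
  "vol = measure lebesgue \<Omega>"

lemma \<Omega>_finite: "emeasure lebesgue \<Omega> < \<infinity>"
proof -
  have "\<Omega> \<in> lmeasurable"
    by (rule bounded_set_imp_lmeasurable[OF bounded_\<Omega> \<Omega>_sets])
  then show ?thesis
    by (simp add: fmeasurable_def)
qed

sublocale on_\<Omega>: finite_measure "lebesgue_on \<Omega>"
proof
  show "emeasure (lebesgue_on \<Omega>) (space (lebesgue_on \<Omega>)) \<noteq> \<infinity>"
    using \<Omega>_finite by (simp add: emeasure_restrict_space)
qed

lemma measure_\<Omega>: "measure (lebesgue_on \<Omega>) (space (lebesgue_on \<Omega>)) = vol"
  by (simp add: vol_def measure_restrict_space)

lemma vol_nonneg: "0 \<le> vol"
  by (simp add: vol_def)

lemma integrable_if_bounded: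
  fixes f :: "'a \<Rightarrow> real"
  assumes "f \<in> borel_measurable (lebesgue_on \<Omega>)" "AE x in lebesgue_on \<Omega>. \<bar>f x\<bar> \<le> C"
  shows "integrable (lebesgue_on \<Omega>) f"
  using assms by (intro on_\<Omega>.integrable_const_bound[of f C]) auto

lemma abs_integral_le:
  fixes f :: "'a \<Rightarrow> real"
  assumes f: "f \<in> borel_measurable (lebesgue_on \<Omega>)" and bound: "AE x in lebesgue_on \<Omega>. \<bar>f x\<bar> \<le> C"
  shows "\<bar>LINT x|lebesgue_on \<Omega>. f x\<bar> \<le> C * vol"
proof -
  have "\<bar>LINT x|lebesgue_on \<Omega>. f x\<bar> \<le> (LINT x|lebesgue_on \<Omega>. \<bar>f x\<bar>)"
    using integral_norm_bound[of "lebesgue_on \<Omega>" f] by simp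
  also have "\<dots> \<le> (LINT x|lebesgue_on \<Omega>. C)"
    using bound integrable_if_bounded[OF f bound] by (intro integral_mono_AE) auto
  also have "\<dots> = C * vol"
    using measure_\<Omega> by (simp add: mult.commute)
  finally show ?thesis .
qed

end

locale fractional_embedding = fractional_energy +
  fixes c :: real
  assumes s_pos: "0 < s" and c_pos: "0 < c"
    and embedding: "u \<in> W \<Longrightarrow> AE x in lebesgue_on \<Omega>. \<bar>u x\<bar> \<le> c * nrm u"
begin

text \<open>The mean is not normalised, that is, not divided by the mass of the tent inside \<open>\<Omega>\<close>.\<close>

definition mean :: "real \<Rightarrow> ('a \<Rightarrow> real) \<Rightarrow> 'a \<Rightarrow> real" where
  "mean \<delta> w x = (LINT y|lebesgue_on \<Omega>. hat \<delta> (x - y) * w y)"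

lemma hat_measurable [measurable]: "(\<lambda>y. hat \<delta> (x - y)) \<in> borel_measurable (lebesgue_on \<Omega>)"
proof -
  have "(\<lambda>y. hat \<delta> (x - y)) \<in> borel_measurable lborel"
    unfolding hat_def by measurable
  then show ?thesis
    by (intro measurable_restrict_space1 measurable_completion)
qed

lemma hat_integrable: "0 < \<delta> \<Longrightarrow> integrable (lebesgue_on \<Omega>) (\<lambda>y. hat \<delta> (x - y))"
  by (rule integrable_if_bounded[of _ 1]) (simp_all add: hat_nonneg hat_le_1)

lemma mean_integrable:
  assumes [measurable]: "w \<in> borel_measurable (lebesgue_on \<Omega>)"
    and B: "AE y in lebesgue_on \<Omega>. \<bar>w y\<bar> \<le> B" and \<delta>: "0 < \<delta>"
  shows "integrable (lebesgue_on \<Omega>) (\<lambda>y. hat \<delta> (x - y) * w y)"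
proof (rule integrable_if_bounded)
  show "AE y in lebesgue_on \<Omega>. \<bar>hat \<delta> (x - y) * w y\<bar> \<le> B"
    using B
  proof eventually_elim
    case (elim y)
    have "hat \<delta> (x - y) * \<bar>w y\<bar> \<le> 1 * \<bar>w y\<bar>"
      by (intro mult_right_mono hat_le_1[OF \<delta>]) auto
    with elim show ?case
      by (simp add: abs_mult hat_nonneg)
  qed
qed measurable

lemma mean_bound:
  assumes w: "w \<in> borel_measurable (lebesgue_on \<Omega>)"
    and B: "AE y in lebesgue_on \<Omega>. \<bar>w y\<bar> \<le> B" and \<delta>: "0 < \<delta>"
  shows "\<bar>mean \<delta> w x\<bar> \<le> B * vol"
  unfolding mean_def
proof (rule abs_integral_le)
  show "(\<lambda>y. hat \<delta> (x - y) * w y) \<in> borel_measurable (lebesgue_on \<Omega>)"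
    using w by measurable
  show "AE y in lebesgue_on \<Omega>. \<bar>hat \<delta> (x - y) * w y\<bar> \<le> B"
    using B
  proof eventually_elim
    case (elim y)
    have "hat \<delta> (x - y) * \<bar>w y\<bar> \<le> 1 * \<bar>w y\<bar>"
      by (intro mult_right_mono hat_le_1[OF \<delta>]) auto
    with elim show ?case
      by (simp add: abs_mult hat_nonneg)
  qed
qed

lemma mean_lipschitz:
  assumes w: "w \<in> borel_measurable (lebesgue_on \<Omega>)"
    and B: "AE y in lebesgue_on \<Omega>. \<bar>w y\<bar> \<le> B" and \<delta>: "0 < \<delta>"
  shows "\<bar>mean \<delta> w x - mean \<delta> w x'\<bar> \<le> norm (x - x') / \<delta> * B * vol"
proof -
  have "mean \<delta> w x - mean \<delta> w x' = (LINT y|lebesgue_on \<Omega>. (hat \<delta> (x - y) - hat \<delta> (x' - y)) * w y)"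
    unfolding mean_def left_diff_distrib
    by (intro Bochner_Integration.integral_diff[symmetric] mean_integrable[OF w B \<delta>])
  also have "\<bar>\<dots>\<bar> \<le> (norm (x - x') / \<delta> * B) * vol"
  proof (rule abs_integral_le)
    show "(\<lambda>y. (hat \<delta> (x - y) - hat \<delta> (x' - y)) * w y) \<in> borel_measurable (lebesgue_on \<Omega>)"
      using w by measurable
    show "AE y in lebesgue_on \<Omega>. \<bar>(hat \<delta> (x - y) - hat \<delta> (x' - y)) * w y\<bar> \<le> norm (x - x') / \<delta> * B"
      using B
    proof eventually_elim
      case (elim y)
      have "\<bar>hat \<delta> (x - y) - hat \<delta> (x' - y)\<bar> \<le> norm (x - x') / \<delta>"
        using hat_lipschitz[OF \<delta>, of "x - y" "x' - y"] by simp
      then show ?case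
        unfolding abs_mult using elim \<delta> by (intro mult_mono) auto
    qed
  qed
  finally show ?thesis
    by simp
qed

lemma mean_measurable:
  assumes w: "w \<in> borel_measurable (lebesgue_on \<Omega>)"
    and B: "AE y in lebesgue_on \<Omega>. \<bar>w y\<bar> \<le> B" and \<delta>: "0 < \<delta>"
  shows "mean \<delta> w \<in> borel_measurable (lebesgue_on \<Omega>)"
proof -
  have "isCont (mean \<delta> w) x" for x
    unfolding isCont_def
  proof (rule LIM_zero_cancel, rule Lim_null_comparison)
    show "\<forall>\<^sub>F x' in at x. norm (mean \<delta> w x' - mean \<delta> w x) \<le> norm (x' - x) / \<delta> * B * vol"
      using mean_lipschitz[OF w B \<delta>] by simp
    have "((\<lambda>x'. norm (x' - x) / \<delta> * B * vol) \<longlongrightarrow> norm (x - x) / \<delta> * B * vol) (at x)"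
      using \<delta> by (intro tendsto_intros) auto
    then show "((\<lambda>x'. norm (x' - x) / \<delta> * B * vol) \<longlongrightarrow> 0) (at x)"
      by simp
  qed
  then have "mean \<delta> w \<in> borel_measurable borel"
    by (intro borel_measurable_continuous_onI continuous_at_imp_continuous_on) auto
  then have "mean \<delta> w \<in> borel_measurable lborel"
    by simp
  then show ?thesis
    by (intro measurable_restrict_space1 measurable_completion)
qed

lemma mean_diff:
  assumes "v \<in> borel_measurable (lebesgue_on \<Omega>)" "AE y in lebesgue_on \<Omega>. \<bar>v y\<bar> \<le> B"
    and "w \<in> borel_measurable (lebesgue_on \<Omega>)" "AE y in lebesgue_on \<Omega>. \<bar>w y\<bar> \<le> B" and \<delta>: "0 < \<delta>"
  shows "mean \<delta> (v - w) x = mean \<delta> v x - mean \<delta> w x"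
  unfolding mean_def minus_apply right_diff_distrib
  by (intro Bochner_Integration.integral_diff mean_integrable[OF assms(1,2) \<delta>]
      mean_integrable[OF assms(3,4) \<delta>])

text \<open>
  The points of \<open>\<Omega>\<close> where the tent of radius \<open>\<delta>\<close> is not cut off by the boundary.
\<close>

definition core :: "real \<Rightarrow> 'a set" where
  "core \<delta> = {x \<in> \<Omega>. ball x \<delta> \<subseteq> \<Omega>}"

lemma core_sets: "core \<delta> \<in> sets lebesgue"
proof -
  have "core \<delta> = \<Omega> \<inter> (\<Inter>y\<in>- \<Omega>. {x. \<delta> \<le> dist x y})"
    by (auto simp: core_def subset_eq not_less[symmetric])
  moreover have "closed (\<Inter>y\<in>- \<Omega>. {x. \<delta> \<le> dist x y})"
    by (intro closed_INT ballI closed_Collect_le continuous_intros)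
  ultimately show ?thesis
    by (auto intro: sets.Int)
qed

text \<open>
  Half the volume of the ball of radius \<open>1 / 2\<close>: on the ball of radius \<open>\<delta> / 2\<close> the tent is at least
  \<open>1 / 2\<close>.
\<close>

definition ball_const :: real where
  "ball_const = unit_ball_vol (real DIM('a)) / 2 / 2 ^ DIM('a)"

lemma ball_const_pos: "0 < ball_const"
  by (simp add: ball_const_def)

lemma hat_integral_ge:
  assumes x: "x \<in> core \<delta>" and \<delta>: "0 < \<delta>"
  shows "ball_const * \<delta> ^ DIM('a) \<le> (LINT y|lebesgue_on \<Omega>. hat \<delta> (x - y))"
proof -
  have sub: "ball x (\<delta> / 2) \<subseteq> \<Omega>"
    using x \<delta> by (auto simp: core_def)
  have "measure lebesgue (ball x (\<delta> / 2)) = unit_ball_vol (real DIM('a)) * (\<delta> / 2) ^ DIM('a)"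
    using \<delta> by (simp add: content_ball)
  then have "ball_const * \<delta> ^ DIM('a) = (1 / 2) * measure lebesgue (ball x (\<delta> / 2))"
    by (simp add: ball_const_def power_divide)
  also have "\<dots> = (LINT y|lebesgue_on \<Omega>. (1 / 2) * indicator (ball x (\<delta> / 2)) y)"
    using sub by (simp add: measure_restrict_space sets_restrict_space_iff Int_absorb2)
  also have "\<dots> \<le> (LINT y|lebesgue_on \<Omega>. hat \<delta> (x - y))"
  proof (rule integral_mono)
    show "integrable (lebesgue_on \<Omega>) (\<lambda>y. hat \<delta> (x - y))"
      by (rule hat_integrable[OF \<delta>])
    show "integrable (lebesgue_on \<Omega>) (\<lambda>y. (1 / 2) * indicator (ball x (\<delta> / 2)) y :: real)"
      using sub on_\<Omega>.emeasure_finite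
      by (intro integrable_mult_right integrable_real_indicator)
        (auto simp: sets_restrict_space_iff less_top[symmetric])
    show "(1 / 2) * indicator (ball x (\<delta> / 2)) y \<le> hat \<delta> (x - y)" for y
      using hat_nonneg[of \<delta> "x - y"] hat_ge_half[OF \<delta>, of "x - y"]
      by (auto simp: indicator_def dist_norm)
  qed
  finally show ?thesis .
qed

definition nonlocal_density :: "('a \<Rightarrow> real) \<Rightarrow> 'a \<Rightarrow> ennreal" where
  "nonlocal_density w x = (\<integral>\<^sup>+y. ennreal (kernel (x, y) * \<bar>increment w (x, y)\<bar> powr p) \<partial>lebesgue)"

text \<open>
  The value at \<open>x\<close> is compared with the mean around \<open>x\<close>; the oscillation over the small ball is
  absorbed by the nonlocal energy density, with a factor that is small with \<open>\<delta>\<close>.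
\<close>

lemma value_le_mean_plus_density:
  assumes w: "w \<in> borel_measurable lebesgue"
    and B: "AE y in lebesgue_on \<Omega>. \<bar>w y\<bar> \<le> B" and \<delta>: "0 < \<delta>" and \<theta>: "0 < \<theta>" and x: "x \<in> core \<delta>"
  shows "ennreal \<bar>w x\<bar> \<le> ennreal (\<bar>mean \<delta> w x\<bar> / (ball_const * \<delta> ^ DIM('a))) + ennreal \<theta> +
    ennreal (\<theta> powr (1 - p) * 2 * \<delta> powr (s * p) / ball_const) * nonlocal_density w x"
proof -
  let ?M = "lebesgue_on \<Omega>"
  have w' [measurable]: "w \<in> borel_measurable ?M"
    by (rule restrict_measurable[OF w])
  have p: "1 \<le> p"
    using p_ge_2' by simp
  define C where "C = (LINT y|?M. hat \<delta> (x - y))"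
  define c0 where "c0 = ball_const * \<delta> ^ DIM('a)"
  have c0: "0 < c0" "c0 \<le> C"
    using hat_integral_ge[OF x \<delta>] ball_const_pos \<delta> by (auto simp: c0_def C_def)
  have hat_int: "integrable ?M (\<lambda>y. hat \<delta> (x - y))"
    by (rule hat_integrable[OF \<delta>])
  define D where "D = \<theta> powr (1 - p) * (2 * \<delta> powr (real DIM('a) + s * p))"
  have D: "0 \<le> D"
    by (simp add: D_def)
  have pointwise: "hat \<delta> (x - y) * \<bar>w x - w y\<bar>
      \<le> \<theta> * hat \<delta> (x - y) + D * (kernel (x, y) * \<bar>increment w (x, y)\<bar> powr p)" for y
  proof (cases "norm (x - y) < \<delta> \<and> x \<noteq> y")
    case False
    then have "hat \<delta> (x - y) * \<bar>w x - w y\<bar> = 0"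
      using hat_eq_0[OF \<delta>, of "x - y"] by auto
    moreover have "0 \<le> \<theta> * hat \<delta> (x - y) + D * (kernel (x, y) * \<bar>increment w (x, y)\<bar> powr p)"
      using \<theta> D hat_nonneg kernel_nonneg by (intro add_nonneg_nonneg mult_nonneg_nonneg) auto
    ultimately show ?thesis
      by linarith
  next
    case True
    let ?X = "\<bar>w x - w y\<bar> powr p"
    have "x \<in> \<Omega>"
      using x by (simp add: core_def)
    then have k: "kernel (x, y) = 1 / 2 / norm (x - y) powr (real DIM('a) + s * p)"
      by (simp add: kernel_def T_set_def)
    have "norm (x - y) powr (real DIM('a) + s * p) \<le> \<delta> powr (real DIM('a) + s * p)"
      using True s_pos p by (intro powr_mono2) auto
    then have "1 \<le> 2 * \<delta> powr (real DIM('a) + s * p) * kernel (x, y)"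
      using True unfolding k by (simp add: pos_le_divide_eq)
    then have "1 * ?X \<le> 2 * \<delta> powr (real DIM('a) + s * p) * kernel (x, y) * ?X"
      by (intro mult_right_mono) auto
    then have X: "\<theta> powr (1 - p) * ?X \<le> D * (kernel (x, y) * ?X)"
      using mult_left_mono[of "1 * ?X" _ "\<theta> powr (1 - p)"] by (simp add: D_def mult.assoc)
    have "hat \<delta> (x - y) * \<bar>w x - w y\<bar> \<le> hat \<delta> (x - y) * (\<theta> + \<theta> powr (1 - p) * ?X)"
      by (intro mult_left_mono abs_le_power_bound \<theta> p hat_nonneg)
    also have "\<dots> = \<theta> * hat \<delta> (x - y) + hat \<delta> (x - y) * (\<theta> powr (1 - p) * ?X)"
      by (simp add: algebra_simps)
    also have "hat \<delta> (x - y) * (\<theta> powr (1 - p) * ?X) \<le> 1 * (\<theta> powr (1 - p) * ?X)"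
      by (intro mult_right_mono hat_le_1[OF \<delta>]) auto
    finally show ?thesis
      using X by (simp add: increment_def)
  qed
  have osc_bound: "AE y in ?M. \<bar>hat \<delta> (x - y) * (w x - w y)\<bar> \<le> \<bar>w x\<bar> + B"
    using B
  proof eventually_elim
    case (elim y)
    have "hat \<delta> (x - y) * \<bar>w x - w y\<bar> \<le> 1 * \<bar>w x - w y\<bar>"
      by (intro mult_right_mono hat_le_1[OF \<delta>]) auto
    then show ?case
      using elim by (simp add: abs_mult hat_nonneg)
  qed
  have osc_int: "integrable ?M (\<lambda>y. hat \<delta> (x - y) * (w x - w y))"
    by (rule integrable_if_bounded[OF _ osc_bound]) measurable
  have "C * w x = (LINT y|?M. hat \<delta> (x - y) * w x)"
    using hat_int by (simp add: C_def)
  also have "\<dots> = (LINT y|?M. hat \<delta> (x - y) * (w x - w y) + hat \<delta> (x - y) * w y)"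
    by (simp add: algebra_simps)
  also have "\<dots> = (LINT y|?M. hat \<delta> (x - y) * (w x - w y)) + mean \<delta> w x"
    unfolding mean_def by (intro Bochner_Integration.integral_add osc_int mean_integrable[OF w' B \<delta>])
  finally have split: "C * \<bar>w x\<bar> \<le> \<bar>LINT y|?M. hat \<delta> (x - y) * (w x - w y)\<bar> + \<bar>mean \<delta> w x\<bar>"
    using c0 abs_mult[of C "w x"] by simp
  have "ennreal \<bar>LINT y|?M. hat \<delta> (x - y) * (w x - w y)\<bar>
      \<le> (\<integral>\<^sup>+y. ennreal \<bar>hat \<delta> (x - y) * (w x - w y)\<bar> \<partial>?M)"
    using integral_norm_bound_ennreal[OF osc_int] by simp
  also have "\<dots> \<le> (\<integral>\<^sup>+y. ennreal (\<theta> * hat \<delta> (x - y)) +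
      ennreal D * ennreal (kernel (x, y) * \<bar>increment w (x, y)\<bar> powr p) \<partial>?M)"
  proof (rule nn_integral_mono)
    fix y
    have "ennreal \<bar>hat \<delta> (x - y) * (w x - w y)\<bar>
        \<le> ennreal (\<theta> * hat \<delta> (x - y) + D * (kernel (x, y) * \<bar>increment w (x, y)\<bar> powr p))"
      using pointwise[of y] by (intro ennreal_leI) (simp add: abs_mult hat_nonneg)
    also have "\<dots> = ennreal (\<theta> * hat \<delta> (x - y)) +
        ennreal (D * (kernel (x, y) * \<bar>increment w (x, y)\<bar> powr p))"
      using \<theta> D hat_nonneg kernel_nonneg by (intro ennreal_plus mult_nonneg_nonneg) auto
    also have "ennreal (D * (kernel (x, y) * \<bar>increment w (x, y)\<bar> powr p)) =
        ennreal D * ennreal (kernel (x, y) * \<bar>increment w (x, y)\<bar> powr p)"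
      using D kernel_nonneg by (intro ennreal_mult mult_nonneg_nonneg) auto
    finally show "ennreal \<bar>hat \<delta> (x - y) * (w x - w y)\<bar> \<le> ennreal (\<theta> * hat \<delta> (x - y)) +
        ennreal D * ennreal (kernel (x, y) * \<bar>increment w (x, y)\<bar> powr p)" .
  qed
  also have "\<dots> = (\<integral>\<^sup>+y. ennreal (\<theta> * hat \<delta> (x - y)) \<partial>?M) +
      ennreal D * (\<integral>\<^sup>+y. ennreal (kernel (x, y) * \<bar>increment w (x, y)\<bar> powr p) \<partial>?M)"
  proof -
    have "(\<lambda>y. ennreal (kernel (x, y) * \<bar>increment w (x, y)\<bar> powr p)) \<in> borel_measurable lebesgue"
      using measurable_Pair2[OF kernel_measurable, of x] measurable_Pair2[OF increment_measurable[OF w], of x]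
      by measurable
    then have "(\<lambda>y. ennreal (kernel (x, y) * \<bar>increment w (x, y)\<bar> powr p)) \<in> borel_measurable ?M"
      by (rule measurable_restrict_space1)
    then show ?thesis
      by (simp add: nn_integral_add nn_integral_cmult)
  qed
  also have "(\<integral>\<^sup>+y. ennreal (\<theta> * hat \<delta> (x - y)) \<partial>?M) = ennreal (\<theta> * C)"
    unfolding C_def using hat_int \<theta> hat_nonneg
    by (subst nn_integral_eq_integral) (auto intro!: AE_I2 mult_nonneg_nonneg hat_nonneg)
  also have "ennreal (\<theta> * C) + ennreal D * (\<integral>\<^sup>+y. ennreal (kernel (x, y) * \<bar>increment w (x, y)\<bar> powr p) \<partial>?M)
      \<le> ennreal (\<theta> * C) + ennreal D * nonlocal_density w x"
  proof (intro add_left_mono mult_left_mono)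
    show "(\<integral>\<^sup>+y. ennreal (kernel (x, y) * \<bar>increment w (x, y)\<bar> powr p) \<partial>?M) \<le> nonlocal_density w x"
      unfolding nonlocal_density_def
      by (subst nn_integral_restrict_space) (auto intro!: nn_integral_mono simp: indicator_def)
  qed simp
  finally have osc: "ennreal \<bar>LINT y|?M. hat \<delta> (x - y) * (w x - w y)\<bar>
      \<le> ennreal (\<theta> * C) + ennreal D * nonlocal_density w x" .
  have "ennreal C * ennreal \<bar>w x\<bar> = ennreal (C * \<bar>w x\<bar>)"
    using c0 by (intro ennreal_mult[symmetric]) auto
  also have "\<dots> \<le> ennreal (\<bar>LINT y|?M. hat \<delta> (x - y) * (w x - w y)\<bar> + \<bar>mean \<delta> w x\<bar>)"
    by (intro ennreal_leI split)
  also have "\<dots> = ennreal \<bar>LINT y|?M. hat \<delta> (x - y) * (w x - w y)\<bar> + ennreal \<bar>mean \<delta> w x\<bar>"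
    by (intro ennreal_plus) auto
  also have "\<dots> \<le> (ennreal (\<theta> * C) + ennreal D * nonlocal_density w x) + ennreal \<bar>mean \<delta> w x\<bar>"
    by (intro add_right_mono osc)
  finally have main: "ennreal C * ennreal \<bar>w x\<bar>
      \<le> (ennreal (\<theta> * C) + ennreal D * nonlocal_density w x) + ennreal \<bar>mean \<delta> w x\<bar>" .
  have inv: "ennreal (1 / C) * ennreal r \<le> ennreal (r / c0)" if "0 \<le> r" for r
  proof -
    have "1 / C * r \<le> r / c0"
      using that c0 by (simp add: frac_le)
    then show ?thesis
      using that c0 by (subst ennreal_mult[symmetric]) (auto intro: ennreal_leI)
  qed
  have "ennreal \<bar>w x\<bar> = ennreal (1 / C) * (ennreal C * ennreal \<bar>w x\<bar>)"
    using c0 by (simp add: mult.assoc[symmetric] ennreal_mult[symmetric] del: ennreal_mult)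
  also have "\<dots> \<le> ennreal (1 / C) * ((ennreal (\<theta> * C) + ennreal D * nonlocal_density w x) + ennreal \<bar>mean \<delta> w x\<bar>)"
    by (intro mult_left_mono main) auto
  also have "\<dots> = ennreal (1 / C) * ennreal (\<theta> * C) + (ennreal (1 / C) * ennreal D) * nonlocal_density w x +
      ennreal (1 / C) * ennreal \<bar>mean \<delta> w x\<bar>"
    by (simp only: distrib_left mult.assoc)
  also have "ennreal (1 / C) * ennreal (\<theta> * C) = ennreal (1 / C * (\<theta> * C))"
    using c0 \<theta> by (intro ennreal_mult[symmetric]) auto
  also have "1 / C * (\<theta> * C) = \<theta>"
    using c0 by simp
  finally have "ennreal \<bar>w x\<bar> \<le> ennreal \<theta> + (ennreal (1 / C) * ennreal D) * nonlocal_density w x +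
      ennreal (1 / C) * ennreal \<bar>mean \<delta> w x\<bar>" .
  also have "\<dots> \<le> ennreal \<theta> + ennreal (D / c0) * nonlocal_density w x + ennreal (\<bar>mean \<delta> w x\<bar> / c0)"
    by (intro add_mono mult_right_mono inv order_refl D) auto
  also have "D / c0 = \<theta> powr (1 - p) * 2 * \<delta> powr (s * p) / ball_const"
    using \<delta> ball_const_pos by (simp add: D_def c0_def powr_add powr_realpow field_simps)
  finally show ?thesis
    unfolding c0_def by (simp only: ac_simps)
qed

lemma nonlocal_density_measurable:
  "w \<in> borel_measurable lebesgue \<Longrightarrow> nonlocal_density w \<in> borel_measurable lebesgue"
  unfolding nonlocal_density_def
  by (intro lebesgue.borel_measurable_nn_integral_fst) (use increment_measurable in measurable)

lemma integral_nonlocal_density_le: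
  assumes w: "w \<in> W"
  shows "(\<integral>\<^sup>+x. nonlocal_density w x \<partial>lebesgue_on \<Omega>) \<le> ennreal (energy w)"
proof -
  have [measurable]: "increment w \<in> borel_measurable pairs"
    by (rule increment_measurable[OF W_D(1)[OF w]])
  have "(\<integral>\<^sup>+x. nonlocal_density w x \<partial>lebesgue_on \<Omega>) \<le> (\<integral>\<^sup>+x. nonlocal_density w x \<partial>lebesgue)"
    by (subst nn_integral_restrict_space) (auto intro!: nn_integral_mono simp: indicator_def)
  also have "\<dots> = (\<integral>\<^sup>+z. ennreal (kernel z * \<bar>increment w z\<bar> powr p) \<partial>pairs)"
    unfolding nonlocal_density_def
    by (rule lebesgue.nn_integral_fst[of "\<lambda>z. ennreal (kernel z * \<bar>increment w z\<bar> powr p)"]) measurable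
  also have "\<dots> \<le> W_energy \<Omega> a s p w"
    by (rule nonlocal_energy_le[OF W_D(1)[OF w]])
  finally show ?thesis
    unfolding W_energy_ennreal[OF w] .
qed

text \<open>
  On the core the bound by the mean is integrated; on the thin rest of \<open>\<Omega>\<close> the function is merely bounded.
  All terms except the one with the means can be made small, uniformly for bounded energy, by choosing
  first \<open>\<theta>\<close> and then \<open>\<delta>\<close>.
\<close>

lemma integral_abs_le:
  assumes w: "w \<in> W" and B: "AE y in lebesgue_on \<Omega>. \<bar>w y\<bar> \<le> B" "0 \<le> B"
    and \<delta>: "0 < \<delta>" and \<theta>: "0 < \<theta>"
  shows "(LINT x|lebesgue_on \<Omega>. \<bar>w x\<bar>) \<le> B * measure lebesgue (\<Omega> - core \<delta>) +
    (LINT x|lebesgue_on \<Omega>. \<bar>mean \<delta> w x\<bar>) / (ball_const * \<delta> ^ DIM('a)) + \<theta> * vol +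
    \<theta> powr (1 - p) * 2 * \<delta> powr (s * p) / ball_const * energy w"
proof -
  let ?M = "lebesgue_on \<Omega>"
  define c0 where "c0 = ball_const * \<delta> ^ DIM('a)"
  define D where "D = \<theta> powr (1 - p) * 2 * \<delta> powr (s * p) / ball_const"
  have c0: "0 < c0" and D: "0 \<le> D"
    using ball_const_pos \<delta> by (auto simp: c0_def D_def)
  have w_meas [measurable]: "w \<in> borel_measurable ?M"
    by (rule restrict_measurable[OF W_D(1)[OF w]])
  have mean_meas [measurable]: "mean \<delta> w \<in> borel_measurable ?M"
    by (rule mean_measurable[OF w_meas B(1) \<delta>])
  have dens_meas [measurable]: "nonlocal_density w \<in> borel_measurable ?M"
    by (intro measurable_restrict_space1 nonlocal_density_measurable W_D(1)[OF w])
  have rim: "\<Omega> - core \<delta> \<in> sets ?M"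
    using core_sets[of \<delta>] by (auto simp: sets_restrict_space_iff)
  have w_int: "integrable ?M (\<lambda>x. \<bar>w x\<bar>)"
    by (rule integrable_if_bounded[of _ B]) (use B in simp_all)
  have mean_int: "integrable ?M (\<lambda>x. \<bar>mean \<delta> w x\<bar>)"
    by (rule integrable_if_bounded[of _ "B * vol"]) (simp_all add: mean_bound[OF w_meas B(1) \<delta>])
  have "AE x in ?M. ennreal \<bar>w x\<bar> \<le> ennreal B * indicator (\<Omega> - core \<delta>) x +
      (ennreal (\<bar>mean \<delta> w x\<bar> / c0) + (ennreal \<theta> + ennreal D * nonlocal_density w x))"
    using B(1) AE_space
  proof eventually_elim
    case (elim x)
    show ?case
    proof (cases "x \<in> core \<delta>")
      case True
      have "ennreal \<bar>w x\<bar> \<le> ennreal (\<bar>mean \<delta> w x\<bar> / c0) + ennreal \<theta> + ennreal D * nonlocal_density w x"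
        unfolding c0_def D_def by (rule value_le_mean_plus_density[OF W_D(1)[OF w] B(1) \<delta> \<theta> True])
      then show ?thesis
        using True by (simp add: add.assoc)
    next
      case False
      then have "ennreal \<bar>w x\<bar> \<le> ennreal B * indicator (\<Omega> - core \<delta>) x"
        using elim by (simp add: ennreal_leI)
      then show ?thesis
        by (rule order_trans) simp
    qed
  qed
  then have "(\<integral>\<^sup>+x. ennreal \<bar>w x\<bar> \<partial>?M) \<le> (\<integral>\<^sup>+x. ennreal B * indicator (\<Omega> - core \<delta>) x +
      (ennreal (\<bar>mean \<delta> w x\<bar> / c0) + (ennreal \<theta> + ennreal D * nonlocal_density w x)) \<partial>?M)"
    by (rule nn_integral_mono_AE)
  also have "\<dots> = ennreal B * emeasure ?M (\<Omega> - core \<delta>) + ((\<integral>\<^sup>+x. ennreal (\<bar>mean \<delta> w x\<bar> / c0) \<partial>?M) +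
      (ennreal \<theta> * emeasure ?M \<Omega> + ennreal D * (\<integral>\<^sup>+x. nonlocal_density w x \<partial>?M)))"
    using rim by (simp add: nn_integral_add nn_integral_cmult nn_integral_cmult_indicator)
  also have "emeasure ?M (\<Omega> - core \<delta>) = ennreal (measure lebesgue (\<Omega> - core \<delta>))"
    using core_sets[of \<delta>] on_\<Omega>.emeasure_eq_measure[of "\<Omega> - core \<delta>"]
    by (simp add: measure_restrict_space)
  also have "emeasure ?M \<Omega> = ennreal vol"
    using on_\<Omega>.emeasure_eq_measure[of \<Omega>] measure_\<Omega> by simp
  also have "(\<integral>\<^sup>+x. ennreal (\<bar>mean \<delta> w x\<bar> / c0) \<partial>?M) = ennreal ((LINT x|?M. \<bar>mean \<delta> w x\<bar>) / c0)"
    using mean_int c0 by (subst nn_integral_eq_integral) (auto intro!: AE_I2 divide_nonneg_pos)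
  also have "ennreal B * ennreal (measure lebesgue (\<Omega> - core \<delta>)) +
      (ennreal ((LINT x|?M. \<bar>mean \<delta> w x\<bar>) / c0) +
        (ennreal \<theta> * ennreal vol + ennreal D * (\<integral>\<^sup>+x. nonlocal_density w x \<partial>?M)))
    \<le> ennreal B * ennreal (measure lebesgue (\<Omega> - core \<delta>)) +
      (ennreal ((LINT x|?M. \<bar>mean \<delta> w x\<bar>) / c0) + (ennreal \<theta> * ennreal vol + ennreal D * ennreal (energy w)))"
    by (intro add_left_mono mult_left_mono integral_nonlocal_density_le[OF w]) simp
  also have "\<dots> = ennreal (B * measure lebesgue (\<Omega> - core \<delta>) +
      ((LINT x|?M. \<bar>mean \<delta> w x\<bar>) / c0 + (\<theta> * vol + D * energy w)))"
  proof -
    have "0 \<le> (LINT x|?M. \<bar>mean \<delta> w x\<bar>) / c0" "0 \<le> B * measure lebesgue (\<Omega> - core \<delta>)"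
        "0 \<le> \<theta> * vol" "0 \<le> D * energy w"
      using c0 B(2) D \<theta> vol_nonneg energy_nonneg by auto
    moreover have "ennreal B * ennreal (measure lebesgue (\<Omega> - core \<delta>)) = ennreal (B * measure lebesgue (\<Omega> - core \<delta>))"
        "ennreal \<theta> * ennreal vol = ennreal (\<theta> * vol)" "ennreal D * ennreal (energy w) = ennreal (D * energy w)"
      using B(2) D \<theta> vol_nonneg energy_nonneg by (auto intro!: ennreal_mult[symmetric])
    ultimately show ?thesis
      by (simp only: ennreal_plus add_nonneg_nonneg)
  qed
  finally have le: "(\<integral>\<^sup>+x. ennreal \<bar>w x\<bar> \<partial>?M) \<le> ennreal (B * measure lebesgue (\<Omega> - core \<delta>) +
      ((LINT x|?M. \<bar>mean \<delta> w x\<bar>) / c0 + (\<theta> * vol + D * energy w)))" .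
  have "(\<integral>\<^sup>+x. ennreal \<bar>w x\<bar> \<partial>?M) = ennreal (LINT x|?M. \<bar>w x\<bar>)"
    using w_int by (intro nn_integral_eq_integral) auto
  from le[unfolded this] have "(LINT x|?M. \<bar>w x\<bar>) \<le> B * measure lebesgue (\<Omega> - core \<delta>) +
      ((LINT x|?M. \<bar>mean \<delta> w x\<bar>) / c0 + (\<theta> * vol + D * energy w))"
    by (rule iffD1[OF ennreal_le_iff, rotated])
      (use c0 B(2) D \<theta> vol_nonneg energy_nonneg in \<open>auto intro!: add_nonneg_nonneg\<close>)
  then show ?thesis
    unfolding c0_def D_def by (simp only: add.assoc)
qed

lemma rim_vanishes: "(\<lambda>j. measure lebesgue (\<Omega> - core (1 / real (Suc j)))) \<longlonglongrightarrow> 0"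
proof -
  have "(\<lambda>j. measure lebesgue (\<Omega> - core (1 / real (Suc j)))) \<longlonglongrightarrow>
      measure lebesgue (\<Inter>j. \<Omega> - core (1 / real (Suc j)))"
  proof (rule Lim_measure_decseq)
    show "range (\<lambda>j. \<Omega> - core (1 / real (Suc j))) \<subseteq> sets lebesgue"
      using core_sets by auto
    show "decseq (\<lambda>j. \<Omega> - core (1 / real (Suc j)))"
    proof (rule decseq_SucI, intro Diff_mono order_refl)
      fix j
      have "ball x (1 / real (Suc (Suc j))) \<subseteq> ball x (1 / real (Suc j))" for x :: 'a
        by (intro subset_ball divide_left_mono) auto
      then show "core (1 / real (Suc j)) \<subseteq> core (1 / real (Suc (Suc j)))"
        unfolding core_def by blast
    qed
    show "emeasure lebesgue (\<Omega> - core (1 / real (Suc j))) \<noteq> \<infinity>" for j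
      using emeasure_mono[of "\<Omega> - core (1 / real (Suc j))" \<Omega> lebesgue] \<Omega>_finite
      by (auto simp: less_top[symmetric] top_unique)
  qed
  moreover have "(\<Inter>j. \<Omega> - core (1 / real (Suc j))) = {}"
  proof -
    have "\<exists>j. x \<in> core (1 / real (Suc j))" if x: "x \<in> \<Omega>" for x
    proof -
      obtain e where e: "0 < e" "ball x e \<subseteq> \<Omega>"
        using open_\<Omega> x by (auto simp: open_contains_ball)
      obtain j where "1 / real (Suc j) < e"
        using nat_approx_posE[OF e(1)] by blast
      then have "ball x (1 / real (Suc j)) \<subseteq> \<Omega>"
        using subset_ball[of "1 / real (Suc j)" e x] e by auto
      then show ?thesis
        using x by (auto simp: core_def)
    qed
    then show ?thesis
      by auto
  qed
  ultimately show ?thesis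
    by (simp only: measure_empty)
qed

text \<open>
  The means at countably many points and scales converge along a diagonal subsequence; by their
  Lipschitz continuity all means converge. As the means control the functions up to small errors, the
  subsequence is Cauchy in \<open>L\<^sup>1\<close>, and a further subsequence converges almost everywhere.
\<close>

lemma AE_convergent_subsequence:
  assumes u: "\<And>n. u n \<in> W" and R: "\<And>n. energy (u n) \<le> R"
  obtains r :: "nat \<Rightarrow> nat" where "strict_mono r" "AE x in lebesgue_on \<Omega>. convergent (\<lambda>n. u (r n) x)"
proof -
  let ?M = "lebesgue_on \<Omega>"
  define R' where "R' = \<bar>R\<bar> powr (1 / p)"
  have nrm_le: "nrm (u n) \<le> R'" for n
    unfolding nrm_def R'_def using R[of n] energy_nonneg[of "u n"] p_pos by (intro powr_mono2) auto
  define B where "B = c * R'"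
  have B0: "0 \<le> B"
    using c_pos by (simp add: B_def R'_def)
  have bound: "AE x in ?M. \<bar>u n x\<bar> \<le> B" for n
    using embedding[OF u[of n]]
  proof eventually_elim
    case (elim x)
    moreover have "c * nrm (u n) \<le> B"
      unfolding B_def using nrm_le c_pos by (intro mult_left_mono) auto
    ultimately show ?case
      by linarith
  qed
  have meas: "u n \<in> borel_measurable ?M" for n
    by (rule restrict_measurable[OF W_D(1)[OF u]])
  define \<delta> where "\<delta> j = 1 / real (Suc j)" for j
  have \<delta>: "0 < \<delta> j" for j
    by (simp add: \<delta>_def)
  obtain Q :: "'a set" where Q: "countable Q" "\<And>X. open X \<Longrightarrow> X \<noteq> {} \<Longrightarrow> \<exists>q\<in>Q. q \<in> X"
    by (rule countable_dense_setE) (rule that)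
  define f where "f n = (\<lambda>(q, j). mean (\<delta> j) (u n) q)" for n
  have "countable (Q \<times> (UNIV :: nat set))"
    using Q(1) by (intro countable_SIGMA) auto
  moreover have "norm (f n z) \<le> B * vol" if "z \<in> Q \<times> UNIV" for n z
    using mean_bound[OF meas bound \<delta>] by (cases z) (simp add: f_def)
  ultimately have "\<exists>r::nat \<Rightarrow> nat. strict_mono r \<and> (\<forall>z\<in>Q \<times> UNIV. \<exists>l. (\<lambda>n. f (r n) z) \<longlonglongrightarrow> l)"
    by (rule function_convergent_subsequence[of "Q \<times> UNIV" f "B * vol"]) (assumption, rule exI, rule conjI, assumption, rule ballI)
  then obtain r :: "nat \<Rightarrow> nat" where r: "strict_mono r"
    and f_lim: "\<forall>z\<in>Q \<times> UNIV. \<exists>l. (\<lambda>n. f (r n) z) \<longlonglongrightarrow> l"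
    by (elim exE conjE)
  define v where "v n = u (r n)" for n
  have v: "v n \<in> W" "v n \<in> borel_measurable ?M" "AE x in ?M. \<bar>v n x\<bar> \<le> B" for n
    using u meas bound by (auto simp: v_def)
  have means_converge: "convergent (\<lambda>n. mean (\<delta> j) (v n) x)" for j x
  proof -
    have "Cauchy (\<lambda>n. mean (\<delta> j) (v n) x)"
    proof (rule metric_CauchyI)
      fix e :: real
      assume e: "0 < e"
      \<comment> \<open>\<open>Y\<close> exceeds the common Lipschitz constant of the means, so a centre in \<open>Q\<close> within \<open>\<rho>\<close> costs at most \<open>e / 4\<close>.\<close>
      define Y where "Y = 1 / \<delta> j * B * vol + 1"
      define \<rho> where "\<rho> = e / 4 / Y"
      have den: "0 < Y"
        unfolding Y_def using \<delta>[of j] B0 vol_nonneg by (intro add_nonneg_pos mult_nonneg_nonneg) auto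
      then have \<rho>: "0 < \<rho>"
        using e by (simp add: \<rho>_def)
      obtain q where q: "q \<in> Q" "q \<in> ball x \<rho>"
        using Q(2)[of "ball x \<rho>"] \<rho> by auto
      obtain l where "(\<lambda>n. f (r n) (q, j)) \<longlonglongrightarrow> l"
        using bspec[OF f_lim, of "(q, j)"] q(1) by auto
      then have q_cauchy: "Cauchy (\<lambda>n. mean (\<delta> j) (v n) q)"
        by (intro LIMSEQ_imp_Cauchy) (simp add: f_def v_def)
      have "0 < e / 4"
        using e by simp
      from metric_CauchyD[OF q_cauchy this]
      obtain K where K: "\<forall>m\<ge>K. \<forall>n\<ge>K. dist (mean (\<delta> j) (v m) q) (mean (\<delta> j) (v n) q) < e / 4"
        ..
      have near: "\<bar>mean (\<delta> j) (v n) x - mean (\<delta> j) (v n) q\<bar> \<le> e / 4" for n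
      proof -
        have "\<bar>mean (\<delta> j) (v n) x - mean (\<delta> j) (v n) q\<bar> \<le> norm (x - q) / \<delta> j * B * vol"
          by (rule mean_lipschitz[OF v(2,3) \<delta>])
        also have "\<dots> = norm (x - q) * (1 / \<delta> j * B * vol)"
          by simp
        also have "\<dots> \<le> \<rho> * Y"
          unfolding Y_def using q(2) \<rho> \<delta>[of j] B0 vol_nonneg
          by (intro mult_mono mult_nonneg_nonneg) (auto simp: dist_norm)
        also have "\<dots> = e / 4"
          using den by (simp add: \<rho>_def)
        finally show ?thesis .
      qed
      have "dist (mean (\<delta> j) (v m) x) (mean (\<delta> j) (v n) x) < e" if "K \<le> m" "K \<le> n" for m n
        using K[rule_format, OF that] near[of m] near[of n] e unfolding dist_real_def by linarith
      then show "\<exists>K. \<forall>m\<ge>K. \<forall>n\<ge>K. dist (mean (\<delta> j) (v m) x) (mean (\<delta> j) (v n) x) < e"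
        by blast
    qed
    then show ?thesis
      by (simp add: Cauchy_convergent_iff)
  qed
  define g where "g j x = lim (\<lambda>n. mean (\<delta> j) (v n) x)" for j x
  have g_lim: "(\<lambda>n. mean (\<delta> j) (v n) x) \<longlonglongrightarrow> g j x" for j x
    unfolding g_def using means_converge by (simp add: convergent_LIMSEQ_iff)
  have mean_meas: "mean (\<delta> j) (v n) \<in> borel_measurable ?M" for j n
    by (rule mean_measurable[OF v(2,3) \<delta>])
  have g_meas: "g j \<in> borel_measurable ?M" for j
    using mean_meas g_lim by (rule borel_measurable_LIMSEQ_real[rotated])
  have g_bound: "\<bar>g j x\<bar> \<le> B * vol" for j x
    by (rule LIMSEQ_le_const2[OF tendsto_rabs[OF g_lim]]) (use mean_bound[OF v(2,3) \<delta>] in auto)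
  have diff_bound: "\<bar>mean (\<delta> j) (v n) x - g j x\<bar> \<le> 2 * (B * vol)" for j n x
    using mean_bound[OF v(2,3) \<delta>, of j n x] g_bound[of j x] by linarith
  have L1_lim: "(\<lambda>n. LINT x|?M. \<bar>mean (\<delta> j) (v n) x - g j x\<bar>) \<longlonglongrightarrow> 0" for j
  proof -
    have "(\<lambda>n. LINT x|?M. \<bar>mean (\<delta> j) (v n) x - g j x\<bar>) \<longlonglongrightarrow> (LINT x|?M. 0)"
    proof (rule integral_dominated_convergence[where w = "\<lambda>x. 2 * (B * vol)"])
      show "(\<lambda>x. \<bar>mean (\<delta> j) (v n) x - g j x\<bar>) \<in> borel_measurable ?M" for n
        using mean_meas[of j n] g_meas[of j] by measurable
      show "AE x in ?M. (\<lambda>n. \<bar>mean (\<delta> j) (v n) x - g j x\<bar>) \<longlonglongrightarrow> 0"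
        using g_lim by (intro AE_I2 tendsto_rabs_zero LIM_zero)
      show "AE x in ?M. norm \<bar>mean (\<delta> j) (v n) x - g j x\<bar> \<le> 2 * (B * vol)" for n
        using diff_bound by simp
    qed simp_all
    then show ?thesis
      by simp
  qed
  define K where "K = (2 * R') powr p"
  have dW: "v m - v n \<in> W" for m n
    using v(1)[of m] v(1)[of n] by (rule W_diff)
  have d_energy: "energy (v m - v n) \<le> K" for m n
  proof -
    have "nrm (v m - v n) \<le> nrm (v m) + nrm (v n)"
      using nrm_triangle_diff[OF v(1) W_0 v(1), of m n] nrm_minus_commute[OF W_0 v(1), of n] by simp
    also have "\<dots> \<le> 2 * R'"
      using nrm_le[of "r m"] nrm_le[of "r n"] by (simp add: v_def)
    finally show ?thesis
      unfolding K_def by (subst nrm_le_iff[symmetric]) (auto simp: R'_def)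
  qed
  have d_bound: "AE x in ?M. \<bar>(v m - v n) x\<bar> \<le> 2 * B" for m n
    using v(3)[of m] v(3)[of n]
  proof eventually_elim
    case (elim x)
    then show ?case
      unfolding minus_apply by linarith
  qed
  have cauchy: "\<exists>N. \<forall>m\<ge>N. \<forall>n\<ge>N. (LINT x|?M. norm (v m x - v n x)) < e" if e: "0 < e" for e
  proof -
    define Z where "Z = vol + 1"
    have Z: "0 < Z" "vol \<le> Z"
      using vol_nonneg by (auto simp: Z_def)
    define \<theta> where "\<theta> = e / 8 / Z"
    have \<theta>: "0 < \<theta>" "\<theta> * vol \<le> e / 8"
    proof -
      show "0 < \<theta>"
        using e Z by (simp add: \<theta>_def)
      then have "\<theta> * vol \<le> \<theta> * Z"
        using Z by (intro mult_left_mono) auto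
      also have "\<dots> = e / 8"
        using Z by (simp add: \<theta>_def)
      finally show "\<theta> * vol \<le> e / 8" .
    qed
    have \<delta>_lim: "\<delta> \<longlonglongrightarrow> 0"
      unfolding \<delta>_def by (rule LIMSEQ_Suc[OF lim_1_over_n])
    have "0 < s * p"
      using s_pos p_pos by simp
    then have powr_lim: "(\<lambda>j. \<delta> j powr (s * p)) \<longlonglongrightarrow> 0 powr (s * p)"
      by (intro tendsto_powr'[OF \<delta>_lim tendsto_const]) (simp add: \<delta> less_imp_le)
    define X where "X j = 2 * B * measure lebesgue (\<Omega> - core (\<delta> j)) +
        \<theta> powr (1 - p) * 2 * \<delta> j powr (s * p) / ball_const * K" for j
    have "X \<longlonglongrightarrow> 2 * B * 0 + \<theta> powr (1 - p) * 2 * 0 powr (s * p) / ball_const * K"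
      unfolding X_def using ball_const_pos
      by (intro tendsto_add tendsto_mult tendsto_divide tendsto_const powr_lim rim_vanishes[folded \<delta>_def]) auto
    then have "X \<longlonglongrightarrow> 0"
      by simp
    moreover have "0 < e / 4"
      using e by simp
    ultimately have "\<forall>\<^sub>F j in sequentially. X j < e / 4"
      by (rule order_tendstoD(2))
    then obtain j where "\<forall>i\<ge>j. X i < e / 4"
      unfolding eventually_sequentially ..
    then have j: "X j < e / 4"
      by simp
    define c0 where "c0 = ball_const * \<delta> j ^ DIM('a)"
    have c0: "0 < c0"
      using ball_const_pos \<delta>[of j] by (simp add: c0_def)
    have "0 < e / 8 * c0"
      using e c0 by simp
    with L1_lim have "\<forall>\<^sub>F n in sequentially. (LINT x|?M. \<bar>mean (\<delta> j) (v n) x - g j x\<bar>) < e / 8 * c0"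
      by (rule order_tendstoD(2))
    then obtain N where N: "\<forall>n\<ge>N. (LINT x|?M. \<bar>mean (\<delta> j) (v n) x - g j x\<bar>) < e / 8 * c0"
      unfolding eventually_sequentially ..
    have "(LINT x|?M. norm (v m x - v n x)) < e" if "N \<le> m" "N \<le> n" for m n
    proof -
      have int: "integrable ?M (\<lambda>x. \<bar>mean (\<delta> j) (v n) x - g j x\<bar>)" for n
        by (rule integrable_if_bounded[of _ "2 * (B * vol)"])
          (use mean_meas[of j n] g_meas[of j] diff_bound in \<open>auto intro!: AE_I2\<close>)
      have "(LINT x|?M. \<bar>mean (\<delta> j) (v m - v n) x\<bar>)
          \<le> (LINT x|?M. \<bar>mean (\<delta> j) (v m) x - g j x\<bar> + \<bar>mean (\<delta> j) (v n) x - g j x\<bar>)"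
      proof (rule integral_mono)
        show "integrable ?M (\<lambda>x. \<bar>mean (\<delta> j) (v m - v n) x\<bar>)"
        proof (rule integrable_if_bounded)
          show "(\<lambda>x. \<bar>mean (\<delta> j) (v m - v n) x\<bar>) \<in> borel_measurable ?M"
            by (rule borel_measurable_abs, rule mean_measurable[OF fun_measurable(2)[OF v(2) v(2)] d_bound \<delta>])
          show "AE x in ?M. \<bar>\<bar>mean (\<delta> j) (v m - v n) x\<bar>\<bar> \<le> 2 * B * vol"
            unfolding abs_idempotent
            by (rule AE_I2, rule mean_bound[OF fun_measurable(2)[OF v(2) v(2)] d_bound \<delta>])
        qed
        show "integrable ?M (\<lambda>x. \<bar>mean (\<delta> j) (v m) x - g j x\<bar> + \<bar>mean (\<delta> j) (v n) x - g j x\<bar>)"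
          by (intro Bochner_Integration.integrable_add int)
        show "\<bar>mean (\<delta> j) (v m - v n) x\<bar> \<le> \<bar>mean (\<delta> j) (v m) x - g j x\<bar> + \<bar>mean (\<delta> j) (v n) x - g j x\<bar>" for x
          unfolding mean_diff[OF v(2,3) v(2,3) \<delta>] by linarith
      qed
      also have "\<dots> = (LINT x|?M. \<bar>mean (\<delta> j) (v m) x - g j x\<bar>) + (LINT x|?M. \<bar>mean (\<delta> j) (v n) x - g j x\<bar>)"
        by (intro Bochner_Integration.integral_add int)
      finally have means: "(LINT x|?M. \<bar>mean (\<delta> j) (v m - v n) x\<bar>) / c0 < e / 4"
        using N[rule_format, OF that(1)] N[rule_format, OF that(2)] c0 by (simp add: pos_divide_less_eq)
      have "\<theta> powr (1 - p) * 2 * \<delta> j powr (s * p) / ball_const * energy (v m - v n)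
          \<le> \<theta> powr (1 - p) * 2 * \<delta> j powr (s * p) / ball_const * K"
        using d_energy ball_const_pos by (intro mult_left_mono) auto
      moreover have "(LINT x|?M. \<bar>(v m - v n) x\<bar>) \<le> 2 * B * measure lebesgue (\<Omega> - core (\<delta> j)) +
          (LINT x|?M. \<bar>mean (\<delta> j) (v m - v n) x\<bar>) / c0 + \<theta> * vol +
          \<theta> powr (1 - p) * 2 * \<delta> j powr (s * p) / ball_const * energy (v m - v n)"
        unfolding c0_def using B0 by (intro integral_abs_le[OF dW d_bound _ \<delta> \<theta>(1)]) simp
      moreover note j[unfolded X_def] means \<theta>(2)
      ultimately have "(LINT x|?M. \<bar>(v m - v n) x\<bar>) < e"
        using e by linarith
      then show ?thesis
        by simp
    qed
    then show ?thesis
      by blast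
  qed
  have int_v: "integrable ?M (v n)" for n
    by (rule integrable_if_bounded[OF v(2,3)])
  have "\<exists>r'::nat \<Rightarrow> nat. strict_mono r' \<and> (AE x in ?M. Cauchy (\<lambda>i. v (r' i) x))"
  proof (rule cauchy_L1_AE_cauchy_subseq[of ?M v])
    show "integrable ?M (v n)" for n
      by (rule int_v)
    show "\<exists>N. \<forall>i\<ge>N. \<forall>j\<ge>N. (LINT x|?M. norm (v i x - v j x)) < e" if "0 < e" for e
      by (rule cauchy[OF that])
    show "\<exists>r'::nat \<Rightarrow> nat. strict_mono r' \<and> (AE x in ?M. Cauchy (\<lambda>i. v (r' i) x))"
      if "strict_mono r" "AE x in ?M. Cauchy (\<lambda>i. v (r i) x)" for r :: "nat \<Rightarrow> nat"
      using that by (intro exI[of _ r] conjI)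
  qed
  then obtain r' :: "nat \<Rightarrow> nat"
    where r': "strict_mono r'" "AE x in ?M. Cauchy (\<lambda>i. v (r' i) x)"
    by (elim exE conjE)
  show ?thesis
  proof (rule that[of "r \<circ> r'"])
    show "strict_mono (r \<circ> r')"
      using r r'(1) by (rule strict_mono_o)
    show "AE x in ?M. convergent (\<lambda>n. u ((r \<circ> r') n) x)"
      using r'(2) by eventually_elim (simp add: v_def Cauchy_convergent_iff)
  qed
qed

end

section \<open>Superposition with a Caratheodory function\<close>

text \<open>
  Lebesgue measure is complete, so values on a null set do not affect measurability. This deals with the
  points where a Caratheodory function fails to be continuous.
\<close>

lemma borel_measurable_lebesgue_on_AE:
  fixes f g :: "'a::euclidean_space \<Rightarrow> real"
  assumes S: "S \<in> sets lebesgue" and f: "f \<in> borel_measurable (lebesgue_on S)"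
    and eq: "AE x in lebesgue_on S. f x = g x"
  shows "g \<in> borel_measurable (lebesgue_on S)"
proof -
  have "(\<lambda>x. if x \<in> S then f x else 0) \<in> borel_measurable lebesgue"
    by (rule borel_measurable_if_I[OF f S])
  moreover have "AE x in lebesgue. (if x \<in> S then f x else 0) = (if x \<in> S then g x else 0)"
    using eq S by (subst (asm) AE_restrict_space_iff) (auto elim: eventually_mono)
  ultimately have "(\<lambda>x. if x \<in> S then g x else 0) \<in> borel_measurable lebesgue"
    by (rule borel_measurable_AE)
  then show ?thesis
    by (rule borel_measurable_if_D)
qed

text \<open>
  A function measurable in its first and continuous in its second argument is a limit of functions
  that are piecewise constant in the second one.
\<close>

lemma caratheodory_composition_measurable:
  fixes k :: "'b \<Rightarrow> real \<Rightarrow> real"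
  assumes meas: "\<And>\<xi>. (\<lambda>x. k x \<xi>) \<in> borel_measurable M" and cont: "\<And>x. continuous_on UNIV (k x)"
    and X: "X \<in> M' \<rightarrow>\<^sub>M M" and U: "U \<in> borel_measurable M'"
  shows "(\<lambda>z. k (X z) (U z)) \<in> borel_measurable M'"
proof (rule borel_measurable_LIMSEQ_real)
  define q where "q n z = \<lfloor>real (Suc n) * U z\<rfloor>" for n z
  show "(\<lambda>z. k (X z) (real_of_int (q n z) / real (Suc n))) \<in> borel_measurable M'" for n
  proof (rule measurable_compose_countable[where g = "q n" and f = "\<lambda>i z. k (X z) (real_of_int i / real (Suc n))"])
    show "(\<lambda>z. k (X z) (real_of_int i / real (Suc n))) \<in> borel_measurable M'" for i
      by (rule measurable_compose[OF X meas])
    show "q n \<in> M' \<rightarrow>\<^sub>M count_space UNIV"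
      unfolding q_def using U by measurable
  qed
  show "(\<lambda>n. k (X z) (real_of_int (q n z) / real (Suc n))) \<longlonglongrightarrow> k (X z) (U z)" for z
  proof -
    have "(\<lambda>n. real_of_int (q n z) / real (Suc n) - U z) \<longlonglongrightarrow> 0"
    proof (rule Lim_null_comparison[OF _ LIMSEQ_Suc[OF lim_1_over_n]], rule always_eventually, rule allI)
      fix n
      have "\<bar>real_of_int (q n z) - real (Suc n) * U z\<bar> \<le> 1"
        unfolding q_def by linarith
      then have "\<bar>real_of_int (q n z) - real (Suc n) * U z\<bar> / real (Suc n) \<le> 1 / real (Suc n)"
        by (intro divide_right_mono) auto
      moreover have "real_of_int (q n z) / real (Suc n) - U z = (real_of_int (q n z) - real (Suc n) * U z) / real (Suc n)"
        by (simp add: diff_divide_distrib)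
      ultimately show "norm (real_of_int (q n z) / real (Suc n) - U z) \<le> 1 / real (Suc n)"
        by simp
    qed
    then have "(\<lambda>n. real_of_int (q n z) / real (Suc n)) \<longlonglongrightarrow> U z"
      by (simp only: LIM_zero_iff)
    moreover have "isCont (k (X z)) (U z)"
      using cont[of "X z"] by (simp add: continuous_on_eq_continuous_at)
    ultimately show ?thesis
      by (rule isCont_tendsto_compose[rotated])
  qed
qed

lemma primitive_has_derivative:
  fixes f :: "real \<Rightarrow> real"
  assumes f: "continuous_on UNIV f"
  shows "((\<lambda>\<xi>. LBINT \<tau>=0..\<xi>. f \<tau>) has_real_derivative f \<xi>) (at \<xi>)"
proof -
  define R where "R = \<bar>\<xi>\<bar> + 1"
  have "((\<lambda>u. LBINT \<tau>=ereal 0..ereal u. f \<tau>) has_vector_derivative f \<xi>) (at \<xi> within {-R..R})"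
    by (rule interval_integral_FTC2) (auto simp: R_def intro: continuous_on_subset[OF f])
  moreover have "at \<xi> within {-R..R} = at \<xi>"
    by (rule at_within_interior) (auto simp: R_def)
  ultimately show ?thesis
    by (simp add: has_real_derivative_iff_has_vector_derivative zero_ereal_def)
qed

locale superposition = fractional_embedding +
  fixes h :: "'a \<Rightarrow> real \<Rightarrow> real" and lam :: real
  assumes h_caratheodory: "caratheodory \<Omega> h"
    and envelope_integrable: "0 < R \<Longrightarrow> integrable (lebesgue_on \<Omega>) (\<lambda>x. SUP \<xi> \<in> {-R..R}. \<bar>h x \<xi>\<bar>)"
    and lam_pos: "0 < lam"
begin

definition envelope :: "real \<Rightarrow> 'a \<Rightarrow> real" where
  "envelope R x = (SUP \<xi> \<in> {-R..R}. \<bar>h x \<xi>\<bar>)"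

lemma AE_h_continuous: "AE x in lebesgue_on \<Omega>. continuous_on UNIV (h x)"
  using h_caratheodory by (simp add: caratheodory_def)

lemma abs_h_le_envelope:
  assumes "continuous_on UNIV (h x)" "\<bar>\<xi>\<bar> \<le> R"
  shows "\<bar>h x \<xi>\<bar> \<le> envelope R x"
proof -
  have "compact ((\<lambda>\<xi>. \<bar>h x \<xi>\<bar>) ` {-R..R})"
    by (intro compact_continuous_image continuous_intros continuous_on_subset[OF assms(1)]) auto
  then have "bdd_above ((\<lambda>\<xi>. \<bar>h x \<xi>\<bar>) ` {-R..R})"
    by (intro bounded_imp_bdd_above compact_imp_bounded)
  then show ?thesis
    unfolding envelope_def using assms(2) by (intro cSUP_upper) auto
qed

lemma H_derivative:
  "continuous_on UNIV (h x) \<Longrightarrow> (primitive h x has_real_derivative h x \<xi>) (at \<xi>)"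
  using primitive_has_derivative[of "h x" \<xi>] by (simp add: primitive_def[abs_def])

lemma H_0: "primitive h x 0 = 0"
  by (simp add: primitive_def zero_ereal_def[symmetric])

lemma H_mean_value:
  assumes "continuous_on UNIV (h x)"
  shows "\<exists>\<theta>. \<bar>\<theta> - \<xi>\<bar> \<le> \<bar>\<zeta> - \<xi>\<bar> \<and> primitive h x \<zeta> - primitive h x \<xi> = (\<zeta> - \<xi>) * h x \<theta>"
proof -
  consider "\<xi> < \<zeta>" | "\<zeta> < \<xi>" | "\<zeta> = \<xi>"
    by linarith
  then show ?thesis
  proof cases
    case 1
    from MVT2[OF this H_derivative[OF assms]] obtain z
      where "\<xi> < z" "z < \<zeta>" "primitive h x \<zeta> - primitive h x \<xi> = (\<zeta> - \<xi>) * h x z"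
      by blast
    then show ?thesis
      by (intro exI[of _ z]) auto
  next
    case 2
    from MVT2[OF this H_derivative[OF assms]] obtain z
      where "\<zeta> < z" "z < \<xi>" "primitive h x \<xi> - primitive h x \<zeta> = (\<xi> - \<zeta>) * h x z"
      by blast
    then show ?thesis
      by (intro exI[of _ z]) (auto simp: algebra_simps)
  qed auto
qed

lemma abs_H_le:
  assumes x: "continuous_on UNIV (h x)" and \<xi>: "\<bar>\<xi>\<bar> \<le> R"
  shows "\<bar>primitive h x \<xi>\<bar> \<le> R * envelope R x"
proof -
  obtain \<theta> where \<theta>: "\<bar>\<theta> - 0\<bar> \<le> \<bar>\<xi> - 0\<bar>" "primitive h x \<xi> - primitive h x 0 = (\<xi> - 0) * h x \<theta>"
    using H_mean_value[OF x] by metis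
  then have "\<bar>primitive h x \<xi>\<bar> = \<bar>\<xi>\<bar> * \<bar>h x \<theta>\<bar>"
    by (simp add: H_0 abs_mult)
  also have "\<dots> \<le> R * envelope R x"
    using \<xi> \<theta>(1) by (intro mult_mono abs_h_le_envelope[OF x]) auto
  finally show ?thesis .
qed

text \<open>
  The nonlinearity, made continuous at every point of \<open>\<Omega>\<close> by a change on a null set.
\<close>

definition h_cont :: "'a \<Rightarrow> real \<Rightarrow> real" where
  "h_cont x \<xi> = (if continuous_on UNIV (h x) then h x \<xi> else 0)"

lemma h_cont_continuous: "continuous_on UNIV (h_cont x)"
  by (cases "continuous_on UNIV (h x)") (auto simp: h_cont_def[abs_def] cong: continuous_on_cong)

lemma h_cont_measurable: "(\<lambda>x. h_cont x \<xi>) \<in> borel_measurable (lebesgue_on \<Omega>)"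
proof (rule borel_measurable_lebesgue_on_AE[OF \<Omega>_sets])
  show "(\<lambda>x. h x \<xi>) \<in> borel_measurable (lebesgue_on \<Omega>)"
    using h_caratheodory by (simp add: caratheodory_def)
  show "AE x in lebesgue_on \<Omega>. h x \<xi> = h_cont x \<xi>"
    using AE_h_continuous by eventually_elim (simp add: h_cont_def)
qed

lemma h_comp_measurable:
  assumes u: "u \<in> borel_measurable (lebesgue_on \<Omega>)"
  shows "(\<lambda>x. h x (u x)) \<in> borel_measurable (lebesgue_on \<Omega>)"
proof (rule borel_measurable_lebesgue_on_AE[OF \<Omega>_sets])
  show "(\<lambda>x. h_cont x (u x)) \<in> borel_measurable (lebesgue_on \<Omega>)"
    by (rule caratheodory_composition_measurable[OF h_cont_measurable h_cont_continuous measurable_ident u,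
        unfolded id_apply])
  show "AE x in lebesgue_on \<Omega>. h_cont x (u x) = h x (u x)"
    using AE_h_continuous by eventually_elim (simp add: h_cont_def)
qed

text \<open>Substitution turns the oriented integral from \<open>0\<close> to \<open>u x\<close> into an integral over the unit interval.\<close>

lemma H_comp_measurable:
  assumes u: "u \<in> borel_measurable (lebesgue_on \<Omega>)"
  shows "(\<lambda>x. primitive h x (u x)) \<in> borel_measurable (lebesgue_on \<Omega>)"
proof (rule borel_measurable_lebesgue_on_AE[OF \<Omega>_sets])
  let ?G = "\<lambda>x. LINT \<sigma>|lborel. (u x * h_cont x (\<sigma> * u x)) * indicator {0..1} \<sigma>"
  have u_fst: "(\<lambda>z. u (fst z)) \<in> borel_measurable (lebesgue_on \<Omega> \<Otimes>\<^sub>M (lborel :: real measure))"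
    by (rule measurable_compose[OF measurable_fst u])
  have snd_meas: "(\<lambda>z. snd z) \<in> borel_measurable (lebesgue_on \<Omega> \<Otimes>\<^sub>M (lborel :: real measure))"
    using measurable_snd[of "lebesgue_on \<Omega>" "lborel :: real measure"] by simp
  have "(\<lambda>z. h_cont (fst z) (snd z * u (fst z))) \<in> borel_measurable (lebesgue_on \<Omega> \<Otimes>\<^sub>M (lborel :: real measure))"
    by (intro caratheodory_composition_measurable[OF h_cont_measurable h_cont_continuous measurable_fst]
        borel_measurable_times snd_meas u_fst)
  with u_fst snd_meas have "(\<lambda>z. (u (fst z) * h_cont (fst z) (snd z * u (fst z))) * indicator {0..1} (snd z))
      \<in> borel_measurable (lebesgue_on \<Omega> \<Otimes>\<^sub>M (lborel :: real measure))"
    by measurable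
  then show "?G \<in> borel_measurable (lebesgue_on \<Omega>)"
    by (intro lborel.borel_measurable_lebesgue_integral) (simp add: case_prod_beta)
  show "AE x in lebesgue_on \<Omega>. ?G x = primitive h x (u x)"
    using AE_h_continuous
  proof eventually_elim
    case (elim x)
    have "?G x = (LINT \<sigma>|lborel. (u x * h x (\<sigma> * u x)) * indicator {0..1} \<sigma>)"
      using elim by (simp add: h_cont_def)
    also have "\<dots> = primitive h x (1 * u x) - primitive h x (0 * u x)"
    proof (rule integral_FTC_Icc_real[where F = "\<lambda>\<sigma>. primitive h x (\<sigma> * u x)"])
      fix \<sigma> :: real
      have "((\<lambda>\<sigma>. \<sigma> * u x) has_real_derivative u x) (at \<sigma>)"
        by (auto intro!: derivative_eq_intros)
      from DERIV_chain2[OF H_derivative[OF elim] this]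
      show "((\<lambda>\<sigma>. primitive h x (\<sigma> * u x)) has_real_derivative u x * h x (\<sigma> * u x)) (at \<sigma>)"
        by (simp only: mult.commute[of "u x"])
      have 1: "isCont (\<lambda>\<sigma>. \<sigma> * u x) \<sigma>"
        by simp
      have 2: "isCont (h x) (\<sigma> * u x)"
        using elim by (simp add: continuous_on_eq_continuous_at)
      show "isCont (\<lambda>\<sigma>. u x * h x (\<sigma> * u x)) \<sigma>"
        by (rule isCont_mult[OF continuous_const isCont_o2[OF 1 2]])
    qed simp
    finally show ?case
      by (simp add: H_0)
  qed
qed

lemma h_comp_bound:
  assumes "AE x in lebesgue_on \<Omega>. \<bar>u x\<bar> \<le> B"
  shows "AE x in lebesgue_on \<Omega>. \<bar>h x (u x)\<bar> \<le> envelope B x"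
  using assms AE_h_continuous by eventually_elim (rule abs_h_le_envelope)

lemma envelope_int: "0 < R \<Longrightarrow> integrable (lebesgue_on \<Omega>) (envelope R)"
  using envelope_integrable unfolding envelope_def[abs_def] .

lemma h_comp_integrable:
  assumes u: "u \<in> borel_measurable (lebesgue_on \<Omega>)" "AE x in lebesgue_on \<Omega>. \<bar>u x\<bar> \<le> B" and B: "0 < B"
  shows "integrable (lebesgue_on \<Omega>) (\<lambda>x. h x (u x))"
  by (rule Bochner_Integration.integrable_bound[OF envelope_int[OF B] h_comp_measurable[OF u(1)]])
    (use h_comp_bound[OF u(2)] in \<open>auto elim!: eventually_mono\<close>)

lemma H_comp_integrable:
  assumes u: "u \<in> borel_measurable (lebesgue_on \<Omega>)" "AE x in lebesgue_on \<Omega>. \<bar>u x\<bar> \<le> B" and B: "0 < B"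
  shows "integrable (lebesgue_on \<Omega>) (\<lambda>x. primitive h x (u x))"
proof (rule Bochner_Integration.integrable_bound)
  show "integrable (lebesgue_on \<Omega>) (\<lambda>x. B * envelope B x)"
    by (intro integrable_mult_right envelope_int B)
  show "AE x in lebesgue_on \<Omega>. norm (primitive h x (u x)) \<le> norm (B * envelope B x)"
    using u(2) AE_h_continuous
  proof eventually_elim
    case (elim x)
    then have "\<bar>primitive h x (u x)\<bar> \<le> B * envelope B x"
      by (intro abs_H_le)
    then show ?case
      by simp
  qed
qed (rule H_comp_measurable[OF u(1)])

text \<open>
  Both superposition operators are continuous along bounded sequences that converge almost everywhere,
  by dominated convergence.
\<close>

lemma h_comp_tendsto:
  assumes v: "\<And>n. v n \<in> borel_measurable (lebesgue_on \<Omega>)" "\<And>n. AE x in lebesgue_on \<Omega>. \<bar>v n x\<bar> \<le> B"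
    and w: "w \<in> borel_measurable (lebesgue_on \<Omega>)" and B: "0 < B"
    and lim: "AE x in lebesgue_on \<Omega>. (\<lambda>n. v n x) \<longlonglongrightarrow> w x"
  shows "(\<lambda>n. LINT x|lebesgue_on \<Omega>. \<bar>h x (v n x) - h x (w x)\<bar>) \<longlonglongrightarrow> 0"
proof -
  have all: "AE x in lebesgue_on \<Omega>. \<forall>n. \<bar>v n x\<bar> \<le> B"
    using v(2) by (simp add: AE_all_countable)
  have w_bound: "AE x in lebesgue_on \<Omega>. \<bar>w x\<bar> \<le> B"
    using lim all
  proof eventually_elim
    case (elim x)
    show ?case
      by (rule LIMSEQ_le_const2[OF tendsto_rabs[OF elim(1)]]) (use elim(2) in auto)
  qed
  have "(\<lambda>n. LINT x|lebesgue_on \<Omega>. \<bar>h x (v n x) - h x (w x)\<bar>) \<longlonglongrightarrow> (LINT x|lebesgue_on \<Omega>. 0)"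
  proof (rule integral_dominated_convergence[where w = "\<lambda>x. 2 * envelope B x"])
    show "(\<lambda>x. \<bar>h x (v n x) - h x (w x)\<bar>) \<in> borel_measurable (lebesgue_on \<Omega>)" for n
      by (intro borel_measurable_abs borel_measurable_diff h_comp_measurable v w)
    show "integrable (lebesgue_on \<Omega>) (\<lambda>x. 2 * envelope B x)"
      by (intro integrable_mult_right envelope_int B)
    show "AE x in lebesgue_on \<Omega>. (\<lambda>n. \<bar>h x (v n x) - h x (w x)\<bar>) \<longlonglongrightarrow> 0"
      using lim AE_h_continuous
    proof eventually_elim
      case (elim x)
      have "(\<lambda>n. h x (v n x)) \<longlonglongrightarrow> h x (w x)"
        using elim by (intro isCont_tendsto_compose[of "w x" "h x"]) (simp_all add: continuous_on_eq_continuous_at)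
      then show ?case
        by (intro tendsto_rabs_zero LIM_zero)
    qed
    show "AE x in lebesgue_on \<Omega>. norm \<bar>h x (v n x) - h x (w x)\<bar> \<le> 2 * envelope B x" for n
      using h_comp_bound[OF v(2)[of n]] h_comp_bound[OF w_bound]
    proof eventually_elim
      case (elim x)
      then show ?case
        unfolding real_norm_def abs_idempotent by linarith
    qed
  qed simp
  then show ?thesis
    by simp
qed

lemma H_comp_tendsto:
  assumes v: "\<And>n. v n \<in> borel_measurable (lebesgue_on \<Omega>)" "\<And>n. AE x in lebesgue_on \<Omega>. \<bar>v n x\<bar> \<le> B"
    and w: "w \<in> borel_measurable (lebesgue_on \<Omega>)" and B: "0 < B"
    and lim: "AE x in lebesgue_on \<Omega>. (\<lambda>n. v n x) \<longlonglongrightarrow> w x"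
  shows "(\<lambda>n. LINT x|lebesgue_on \<Omega>. primitive h x (v n x)) \<longlonglongrightarrow> (LINT x|lebesgue_on \<Omega>. primitive h x (w x))"
proof (rule integral_dominated_convergence[where w = "\<lambda>x. B * envelope B x"])
  show "(\<lambda>x. primitive h x (w x)) \<in> borel_measurable (lebesgue_on \<Omega>)"
    by (rule H_comp_measurable[OF w])
  show "(\<lambda>x. primitive h x (v n x)) \<in> borel_measurable (lebesgue_on \<Omega>)" for n
    by (rule H_comp_measurable[OF v(1)])
  show "integrable (lebesgue_on \<Omega>) (\<lambda>x. B * envelope B x)"
    by (intro integrable_mult_right envelope_int B)
  show "AE x in lebesgue_on \<Omega>. (\<lambda>n. primitive h x (v n x)) \<longlonglongrightarrow> primitive h x (w x)"
    using lim AE_h_continuous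
  proof eventually_elim
    case (elim x)
    show ?case
      using elim(1) by (rule isCont_tendsto_compose[OF DERIV_isCont[OF H_derivative[OF elim(2)]]])
  qed
  show "AE x in lebesgue_on \<Omega>. norm (primitive h x (v n x)) \<le> B * envelope B x" for n
    using v(2)[of n] AE_h_continuous
  proof eventually_elim
    case (elim x)
    then show ?case
      unfolding real_norm_def by (intro abs_H_le)
  qed
qed

text \<open>
  The difference quotients of \<open>H\<close> approximate \<open>h\<close> uniformly for bounded data, because \<open>h x\<close> is uniformly
  continuous on bounded intervals.
\<close>

lemma H_quotient_tendsto:
  assumes v: "\<And>n. v n \<in> borel_measurable (lebesgue_on \<Omega>)" "\<And>n. AE x in lebesgue_on \<Omega>. \<bar>v n x\<bar> \<le> B"
    and d: "\<And>n. d n \<in> borel_measurable (lebesgue_on \<Omega>)" "\<And>n. AE x in lebesgue_on \<Omega>. \<bar>d n x\<bar> \<le> B"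
    and B: "0 < B" and \<tau>: "\<And>n. 0 < \<tau> n" "\<And>n. \<tau> n \<le> T" "\<tau> \<longlonglongrightarrow> 0"
  shows "(\<lambda>n. LINT x|lebesgue_on \<Omega>. (primitive h x (v n x + \<tau> n * d n x) - primitive h x (v n x)) / \<tau> n -
    h x (v n x) * d n x) \<longlonglongrightarrow> 0"
proof -
  let ?\<rho> = "\<lambda>n x. (primitive h x (v n x + \<tau> n * d n x) - primitive h x (v n x)) / \<tau> n - h x (v n x) * d n x"
  define C where "C = B + T * B"
  have T: "0 < T"
    using \<tau>(1)[of 0] \<tau>(2)[of 0] by linarith
  have C: "0 < C"
    unfolding C_def by (intro add_pos_pos mult_pos_pos B T)
  have BC: "B \<le> C"
    unfolding C_def using mult_pos_pos[OF T B] by linarith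
  have all: "AE x in lebesgue_on \<Omega>. (\<forall>n. \<bar>v n x\<bar> \<le> B) \<and> (\<forall>n. \<bar>d n x\<bar> \<le> B)"
    using v(2) d(2) by (simp add: AE_all_countable)
  have rep: "\<exists>\<theta>. \<bar>\<theta> - v n x\<bar> \<le> \<tau> n * B \<and> \<bar>\<theta>\<bar> \<le> C \<and> ?\<rho> n x = (h x \<theta> - h x (v n x)) * d n x"
    if x: "continuous_on UNIV (h x)" and vd: "\<bar>v n x\<bar> \<le> B" "\<bar>d n x\<bar> \<le> B" for n x
  proof -
    obtain \<theta> where \<theta>: "\<bar>\<theta> - v n x\<bar> \<le> \<bar>(v n x + \<tau> n * d n x) - v n x\<bar>"
      "primitive h x (v n x + \<tau> n * d n x) - primitive h x (v n x) = ((v n x + \<tau> n * d n x) - v n x) * h x \<theta>"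
      using H_mean_value[OF x] by metis
    have step: "\<bar>\<theta> - v n x\<bar> \<le> \<tau> n * B"
    proof -
      have "\<bar>(v n x + \<tau> n * d n x) - v n x\<bar> = \<tau> n * \<bar>d n x\<bar>"
        using \<tau>(1)[of n] by (simp add: abs_mult)
      also have "\<dots> \<le> \<tau> n * B"
        using \<tau>(1)[of n] vd by (intro mult_left_mono) auto
      finally show ?thesis
        using \<theta>(1) by linarith
    qed
    have "\<tau> n * B \<le> T * B"
      using \<tau>(2)[of n] B by (intro mult_right_mono) auto
    then have "\<bar>\<theta>\<bar> \<le> C"
      using step vd(1) unfolding C_def by linarith
    moreover have "?\<rho> n x = (h x \<theta> - h x (v n x)) * d n x"
      unfolding \<theta>(2) using \<tau>(1)[of n] by (simp add: algebra_simps)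
    ultimately show ?thesis
      using step by blast
  qed
  have "(\<lambda>n. LINT x|lebesgue_on \<Omega>. ?\<rho> n x) \<longlonglongrightarrow> (LINT x|lebesgue_on \<Omega>. 0)"
  proof (rule integral_dominated_convergence[where w = "\<lambda>x. 2 * B * envelope C x"])
    show "?\<rho> n \<in> borel_measurable (lebesgue_on \<Omega>)" for n
      by (intro borel_measurable_diff borel_measurable_divide borel_measurable_times H_comp_measurable
          h_comp_measurable borel_measurable_add borel_measurable_const v d)
    show "integrable (lebesgue_on \<Omega>) (\<lambda>x. 2 * B * envelope C x)"
      by (intro integrable_mult_right envelope_int C)
    show "AE x in lebesgue_on \<Omega>. norm (?\<rho> n x) \<le> 2 * B * envelope C x" for n
      using all AE_h_continuous
    proof eventually_elim
      case (elim x)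
      then obtain \<theta> where \<theta>: "\<bar>\<theta>\<bar> \<le> C" "?\<rho> n x = (h x \<theta> - h x (v n x)) * d n x"
        using rep[of x n] by blast
      have "\<bar>h x \<theta>\<bar> \<le> envelope C x" "\<bar>h x (v n x)\<bar> \<le> envelope C x"
        using elim \<theta>(1) BC by (auto intro!: abs_h_le_envelope intro: order_trans)
      then have "\<bar>h x \<theta> - h x (v n x)\<bar> \<le> 2 * envelope C x"
        by linarith
      then have "\<bar>(h x \<theta> - h x (v n x)) * d n x\<bar> \<le> (2 * envelope C x) * B"
        unfolding abs_mult using elim by (intro mult_mono) auto
      then show ?case
        unfolding \<theta>(2) real_norm_def by (simp add: mult.commute mult.left_commute)
    qed
    show "AE x in lebesgue_on \<Omega>. (\<lambda>n. ?\<rho> n x) \<longlonglongrightarrow> 0"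
      using all AE_h_continuous
    proof eventually_elim
      case (elim x)
      have "uniformly_continuous_on {-C..C} (h x)"
        by (intro compact_uniformly_continuous continuous_on_subset[OF elim(2)]) auto
      show ?case
      proof (rule LIMSEQ_I)
        fix e :: real
        assume e: "0 < e"
        then have "0 < e / (2 * B)"
          using B by simp
        then obtain \<eta> where \<eta>: "0 < \<eta>" "\<And>y z. y \<in> {-C..C} \<Longrightarrow> z \<in> {-C..C} \<Longrightarrow> dist y z < \<eta> \<Longrightarrow>
            dist (h x y) (h x z) < e / (2 * B)"
          using \<open>uniformly_continuous_on {-C..C} (h x)\<close> unfolding uniformly_continuous_on_def
          by (metis dist_commute)
        have "(\<lambda>n. \<tau> n * B) \<longlonglongrightarrow> 0 * B"
          by (intro tendsto_mult \<tau>(3) tendsto_const)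
        then have "\<forall>\<^sub>F n in sequentially. \<tau> n * B < \<eta>"
          by (rule order_tendstoD) (use \<eta>(1) in simp)
        then obtain N where N: "\<And>n. N \<le> n \<Longrightarrow> \<tau> n * B < \<eta>"
          by (auto simp: eventually_sequentially)
        have "norm (?\<rho> n x - 0) < e" if n: "N \<le> n" for n
        proof -
          obtain \<theta> where \<theta>: "\<bar>\<theta> - v n x\<bar> \<le> \<tau> n * B" "\<bar>\<theta>\<bar> \<le> C" "?\<rho> n x = (h x \<theta> - h x (v n x)) * d n x"
            using rep[of x n] elim by blast
          have "\<bar>v n x\<bar> \<le> C"
            using elim BC by (auto intro: order_trans)
          moreover have "\<bar>\<theta> - v n x\<bar> < \<eta>"
            using N[OF n] \<theta>(1) by linarith
          ultimately have "\<bar>h x \<theta> - h x (v n x)\<bar> < e / (2 * B)"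
            using \<eta>(2)[of \<theta> "v n x"] \<theta>(2) by (simp add: dist_real_def abs_le_iff)
          then have "\<bar>(h x \<theta> - h x (v n x)) * d n x\<bar> \<le> e / (2 * B) * B"
            unfolding abs_mult using elim by (intro mult_mono) auto
          also have "\<dots> < e"
            using e B by simp
          finally show ?thesis
            unfolding \<theta>(3) by simp
        qed
        then show "\<exists>N. \<forall>n\<ge>N. norm (?\<rho> n x - 0) < e"
          by blast
      qed
    qed
  qed simp
  then show ?thesis
    by simp
qed

end

section \<open>The potential of the problem\<close>

context superposition
begin

definition potential :: "('a \<Rightarrow> real) \<Rightarrow> real" where
  "potential u = lam * (LINT x|lebesgue_on \<Omega>. primitive h x (u x))"

definition load :: "('a \<Rightarrow> real) \<Rightarrow> ('a \<Rightarrow> real) \<Rightarrow> real" where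
  "load u v = lam * (LINT x|lebesgue_on \<Omega>. h x (u x) * v x)"

text \<open>The summand \<open>1\<close> keeps the bound positive.\<close>

definition sup_bound :: "real \<Rightarrow> real" where
  "sup_bound R = c * \<bar>R\<bar> powr (1 / p) + 1"

lemma sup_bound_pos: "0 < sup_bound R"
  using c_pos by (simp add: sup_bound_def add_nonneg_pos)

lemma W_measurable: "u \<in> W \<Longrightarrow> u \<in> borel_measurable (lebesgue_on \<Omega>)"
  by (rule restrict_measurable[OF W_D(1)])

lemma W_bounded:
  assumes u: "u \<in> W" and R: "energy u \<le> R"
  shows "AE x in lebesgue_on \<Omega>. \<bar>u x\<bar> \<le> sup_bound R"
  using embedding[OF u]
proof eventually_elim
  case (elim x)
  have "nrm u \<le> \<bar>R\<bar> powr (1 / p)"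
    unfolding nrm_def using R energy_nonneg[of u] p_pos by (intro powr_mono2) auto
  then have "c * nrm u \<le> c * \<bar>R\<bar> powr (1 / p)"
    using c_pos by (intro mult_left_mono) auto
  then show ?case
    using elim unfolding sup_bound_def by linarith
qed

lemma integrable_times_W:
  assumes f: "integrable (lebesgue_on \<Omega>) f" and v: "v \<in> W"
  shows "integrable (lebesgue_on \<Omega>) (\<lambda>x. f x * v x)"
proof (rule Bochner_Integration.integrable_bound)
  show "integrable (lebesgue_on \<Omega>) (\<lambda>x. (c * nrm v) * f x)"
    by (intro integrable_mult_right f)
  show "(\<lambda>x. f x * v x) \<in> borel_measurable (lebesgue_on \<Omega>)"
    by (intro borel_measurable_times borel_measurable_integrable[OF f] W_measurable[OF v])
  show "AE x in lebesgue_on \<Omega>. norm (f x * v x) \<le> norm ((c * nrm v) * f x)"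
    using embedding[OF v]
  proof eventually_elim
    case (elim x)
    have "\<bar>f x\<bar> * \<bar>v x\<bar> \<le> \<bar>f x\<bar> * (c * nrm v)"
      using elim by (intro mult_left_mono) auto
    then show ?case
      using c_pos by (simp add: abs_mult mult.commute)
  qed
qed

lemma abs_integral_times_W_le:
  assumes f: "integrable (lebesgue_on \<Omega>) f" and v: "v \<in> W"
  shows "\<bar>LINT x|lebesgue_on \<Omega>. f x * v x\<bar> \<le> (LINT x|lebesgue_on \<Omega>. \<bar>f x\<bar>) * (c * nrm v)"
proof -
  have "\<bar>LINT x|lebesgue_on \<Omega>. f x * v x\<bar> \<le> (LINT x|lebesgue_on \<Omega>. norm (f x * v x))"
    using integral_norm_bound[of "lebesgue_on \<Omega>" "\<lambda>x. f x * v x"] by simp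
  also have "\<dots> \<le> (LINT x|lebesgue_on \<Omega>. \<bar>f x\<bar> * (c * nrm v))"
  proof (rule integral_mono_AE)
    show "integrable (lebesgue_on \<Omega>) (\<lambda>x. norm (f x * v x))"
      by (intro integrable_norm integrable_times_W f v)
    show "integrable (lebesgue_on \<Omega>) (\<lambda>x. \<bar>f x\<bar> * (c * nrm v))"
      by (intro integrable_mult_left integrable_abs f)
    show "AE x in lebesgue_on \<Omega>. norm (f x * v x) \<le> \<bar>f x\<bar> * (c * nrm v)"
      using embedding[OF v]
    proof eventually_elim
      case (elim x)
      have "\<bar>f x\<bar> * \<bar>v x\<bar> \<le> \<bar>f x\<bar> * (c * nrm v)"
        using elim by (intro mult_left_mono) auto
      then show ?case
        by (simp add: abs_mult)
    qed
  qed
  also have "\<dots> = (LINT x|lebesgue_on \<Omega>. \<bar>f x\<bar>) * (c * nrm v)"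
    by (rule Bochner_Integration.integral_mult_left_zero)
  finally show ?thesis .
qed

lemma h_integrable: "u \<in> W \<Longrightarrow> integrable (lebesgue_on \<Omega>) (\<lambda>x. h x (u x))"
  by (rule h_comp_integrable[OF W_measurable W_bounded[OF _ order_refl] sup_bound_pos])

lemma load_add:
  assumes "u \<in> W" "v \<in> W" "w \<in> W"
  shows "load u (v + w) = load u v + load u w"
proof -
  have "(LINT x|lebesgue_on \<Omega>. h x (u x) * v x + h x (u x) * w x) =
      (LINT x|lebesgue_on \<Omega>. h x (u x) * v x) + (LINT x|lebesgue_on \<Omega>. h x (u x) * w x)"
    by (intro Bochner_Integration.integral_add integrable_times_W h_integrable assms)
  then show ?thesis
    by (simp add: load_def distrib_left)
qed

lemma load_scale: "load u (k *\<^sub>R v) = k * load u v"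
  by (simp add: load_def mult.left_commute)

lemma load_diff_le:
  assumes u: "u \<in> W" and w: "w \<in> borel_measurable (lebesgue_on \<Omega>)"
    "AE x in lebesgue_on \<Omega>. \<bar>w x\<bar> \<le> B" "0 < B" and v: "v \<in> W"
  shows "\<bar>load u v - load w v\<bar> \<le> lam * (LINT x|lebesgue_on \<Omega>. \<bar>h x (u x) - h x (w x)\<bar>) * c * nrm v"
proof -
  have int: "integrable (lebesgue_on \<Omega>) (\<lambda>x. h x (u x) - h x (w x))"
    by (intro Bochner_Integration.integrable_diff h_integrable u h_comp_integrable[OF w])
  have "(LINT x|lebesgue_on \<Omega>. h x (u x) * v x) - (LINT x|lebesgue_on \<Omega>. h x (w x) * v x) =
      (LINT x|lebesgue_on \<Omega>. (h x (u x) - h x (w x)) * v x)"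
    unfolding left_diff_distrib
    by (intro Bochner_Integration.integral_diff[symmetric] integrable_times_W h_integrable u v
        h_comp_integrable[OF w])
  then have "load u v - load w v = lam * (LINT x|lebesgue_on \<Omega>. (h x (u x) - h x (w x)) * v x)"
    by (simp add: load_def flip: right_diff_distrib)
  then have "\<bar>load u v - load w v\<bar> = lam * \<bar>LINT x|lebesgue_on \<Omega>. (h x (u x) - h x (w x)) * v x\<bar>"
    using lam_pos by (simp add: abs_mult)
  also have "\<dots> \<le> lam * ((LINT x|lebesgue_on \<Omega>. \<bar>h x (u x) - h x (w x)\<bar>) * (c * nrm v))"
    using lam_pos by (intro mult_left_mono abs_integral_times_W_le int v) auto
  finally show ?thesis
    by (simp add: mult.assoc)
qed

lemma load_bounded: "\<exists>C\<ge>0. \<forall>u\<in>W. energy u \<le> R \<longrightarrow> (\<forall>v\<in>W. \<bar>load u v\<bar> \<le> C * nrm v)"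
proof -
  let ?I = "LINT x|lebesgue_on \<Omega>. envelope (sup_bound R) x"
  have h_le: "(LINT x|lebesgue_on \<Omega>. \<bar>h x (u x)\<bar>) \<le> \<bar>?I\<bar>" if u: "u \<in> W" "energy u \<le> R" for u
  proof -
    have "(LINT x|lebesgue_on \<Omega>. \<bar>h x (u x)\<bar>) \<le> ?I"
      by (intro integral_mono_AE integrable_abs h_integrable u(1) envelope_int sup_bound_pos
          h_comp_bound W_bounded[OF u])
    then show ?thesis
      by linarith
  qed
  have "\<bar>load u v\<bar> \<le> (lam * \<bar>?I\<bar> * c) * nrm v" if u: "u \<in> W" "energy u \<le> R" and v: "v \<in> W" for u v
  proof -
    have "\<bar>load u v\<bar> = lam * \<bar>LINT x|lebesgue_on \<Omega>. h x (u x) * v x\<bar>"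
      using lam_pos by (simp add: load_def abs_mult)
    also have "\<dots> \<le> lam * ((LINT x|lebesgue_on \<Omega>. \<bar>h x (u x)\<bar>) * (c * nrm v))"
      using lam_pos by (intro mult_left_mono abs_integral_times_W_le h_integrable u(1) v) auto
    also have "\<dots> \<le> lam * (\<bar>?I\<bar> * (c * nrm v))"
      using lam_pos c_pos by (intro mult_left_mono mult_right_mono h_le[OF u]) auto
    finally show ?thesis
      by (simp add: mult.assoc)
  qed
  moreover have "0 \<le> lam * \<bar>?I\<bar> * c"
    using lam_pos c_pos by simp
  ultimately show ?thesis
    by blast
qed

text \<open>
  A test function is bounded on \<open>\<Omega>\<close> by \<open>c\<close> times its norm. Hence the distance of two linear forms is at
  most a multiple of the \<open>L\<^sup>1\<close> distance of their coefficients, which tends to \<open>0\<close> by dominated convergence.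
\<close>

lemma load_converges:
  assumes v: "\<And>n. v n \<in> W" "\<And>n. energy (v n) \<le> R"
    and w: "w \<in> borel_measurable (lebesgue_on \<Omega>)" "AE x in lebesgue_on \<Omega>. (\<lambda>n. v n x) \<longlonglongrightarrow> w x"
    and e: "0 < e"
  shows "\<forall>\<^sub>F n in sequentially. \<forall>z\<in>W. \<bar>load (v n) z - load w z\<bar> \<le> e * nrm z"
proof -
  have meas: "v n \<in> borel_measurable (lebesgue_on \<Omega>)" for n
    by (rule W_measurable[OF v(1)])
  have bound: "AE x in lebesgue_on \<Omega>. \<bar>v n x\<bar> \<le> sup_bound R" for n
    by (rule W_bounded[OF v])
  have all: "AE x in lebesgue_on \<Omega>. \<forall>n. \<bar>v n x\<bar> \<le> sup_bound R"
    using bound by (simp add: AE_all_countable)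
  have w_bound: "AE x in lebesgue_on \<Omega>. \<bar>w x\<bar> \<le> sup_bound R"
    using w(2) all
  proof eventually_elim
    case (elim x)
    show ?case
      by (rule LIMSEQ_le_const2[OF tendsto_rabs[OF elim(1)]]) (use elim(2) in auto)
  qed
  have lc: "0 < lam * c"
    using lam_pos c_pos by simp
  have "(\<lambda>n. LINT x|lebesgue_on \<Omega>. \<bar>h x (v n x) - h x (w x)\<bar>) \<longlonglongrightarrow> 0"
    by (rule h_comp_tendsto[OF meas bound w(1) sup_bound_pos w(2)])
  then have "\<forall>\<^sub>F n in sequentially. (LINT x|lebesgue_on \<Omega>. \<bar>h x (v n x) - h x (w x)\<bar>) < e / (lam * c)"
    by (rule order_tendstoD) (use e lc in simp)
  then show ?thesis
  proof eventually_elim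
    case (elim n)
    then have small: "lam * (LINT x|lebesgue_on \<Omega>. \<bar>h x (v n x) - h x (w x)\<bar>) * c \<le> e"
      using lc by (simp add: pos_less_divide_eq mult.commute mult.left_commute less_imp_le)
    show ?case
    proof
      fix z
      assume z: "z \<in> W"
      have "\<bar>load (v n) z - load w z\<bar> \<le> lam * (LINT x|lebesgue_on \<Omega>. \<bar>h x (v n x) - h x (w x)\<bar>) * c * nrm z"
        by (rule load_diff_le[OF v(1) w(1) w_bound sup_bound_pos z])
      also have "\<dots> \<le> e * nrm z"
        by (intro mult_right_mono small nrm_nonneg)
      finally show "\<bar>load (v n) z - load w z\<bar> \<le> e * nrm z" .
    qed
  qed
qed

text \<open>
  The limit of the subsequence need not belong to the space; it only serves to compare two members of
  the sequence.
\<close>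

lemma load_compact:
  assumes v: "\<And>n. v n \<in> W" "\<And>n. energy (v n) \<le> R"
  shows "\<exists>r::nat \<Rightarrow> nat. strict_mono r \<and> (\<forall>e>0. \<exists>M. \<forall>m\<ge>M. \<forall>n\<ge>M. \<forall>z\<in>W.
    \<bar>load (v (r m)) z - load (v (r n)) z\<bar> \<le> e * nrm z)"
proof -
  obtain r :: "nat \<Rightarrow> nat" where r: "strict_mono r"
    and conv: "AE x in lebesgue_on \<Omega>. convergent (\<lambda>n. v (r n) x)"
    by (rule AE_convergent_subsequence[OF v])
  define w where "w x = lim (\<lambda>n. v (r n) x)" for x
  have w: "w \<in> borel_measurable (lebesgue_on \<Omega>)"
    unfolding w_def by (intro borel_measurable_lim_metric W_measurable v)
  have lim: "AE x in lebesgue_on \<Omega>. (\<lambda>n. v (r n) x) \<longlonglongrightarrow> w x"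
    using conv by eventually_elim (simp add: w_def convergent_LIMSEQ_iff)
  have "\<exists>M. \<forall>m\<ge>M. \<forall>n\<ge>M. \<forall>z\<in>W. \<bar>load (v (r m)) z - load (v (r n)) z\<bar> \<le> e * nrm z"
    if e: "0 < e" for e
  proof -
    have "0 < e / 2"
      using e by simp
    from load_converges[OF v(1) v(2) w lim this]
    obtain M where M: "\<forall>n\<ge>M. \<forall>z\<in>W. \<bar>load (v (r n)) z - load w z\<bar> \<le> e / 2 * nrm z"
      unfolding eventually_sequentially by blast
    have "\<bar>load (v (r m)) z - load (v (r n)) z\<bar> \<le> e * nrm z" if "M \<le> m" "M \<le> n" "z \<in> W" for m n z
    proof -
      have "\<bar>load (v (r m)) z - load w z\<bar> \<le> e / 2 * nrm z" "\<bar>load (v (r n)) z - load w z\<bar> \<le> e / 2 * nrm z"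
        using M that by blast+
      then show ?thesis
        by linarith
    qed
    then show ?thesis
      by blast
  qed
  with r show ?thesis
    by blast
qed

lemma converges_in_W:
  assumes v: "\<And>n. v n \<in> W" and w: "w \<in> W" and lim: "(\<lambda>n. energy (v n - w)) \<longlonglongrightarrow> 0"
  shows "AE x in lebesgue_on \<Omega>. (\<lambda>n. v n x) \<longlonglongrightarrow> w x" and "\<exists>R. \<forall>n. energy (v n) \<le> R"
proof -
  have "AE x in lebesgue_on \<Omega>. \<forall>n. \<bar>(v n - w) x\<bar> \<le> c * nrm (v n - w)"
    unfolding AE_all_countable using embedding[OF W_diff[OF v w]] by blast
  then show "AE x in lebesgue_on \<Omega>. (\<lambda>n. v n x) \<longlonglongrightarrow> w x"
  proof eventually_elim
    case (elim x)
    have "(\<lambda>n. c * nrm (v n - w)) \<longlonglongrightarrow> 0"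
      using lim unfolding E_tendsto_0_iff by (rule tendsto_mult_right_zero)
    then have "(\<lambda>n. v n x - w x) \<longlonglongrightarrow> 0"
      by (rule Lim_null_comparison[rotated]) (use elim in \<open>simp add: always_eventually\<close>)
    then show ?case
      by (simp only: LIM_zero_iff)
  qed
  have "Bseq (\<lambda>n. energy (v n))"
    by (rule convergent_imp_Bseq[OF convergentI[OF E_tendsto[OF v w lim]]])
  then show "\<exists>R. \<forall>n. energy (v n) \<le> R"
    unfolding Bseq_def by (auto simp: abs_le_iff)
qed

lemma load_continuous:
  assumes v: "\<And>n. v n \<in> W" and w: "w \<in> W" and lim: "(\<lambda>n. energy (v n - w)) \<longlonglongrightarrow> 0" and e: "0 < e"
  shows "\<forall>\<^sub>F n in sequentially. \<forall>z\<in>W. \<bar>load (v n) z - load w z\<bar> \<le> e * nrm z"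
proof -
  obtain R where R: "\<And>n. energy (v n) \<le> R"
    using converges_in_W(2)[OF assms(1-3)] by blast
  show ?thesis
    by (rule load_converges[OF v R W_measurable[OF w] converges_in_W(1)[OF assms(1-3)] e])
qed

lemma potential_continuous:
  assumes v: "\<And>n. v n \<in> W" and w: "w \<in> W" and lim: "(\<lambda>n. energy (v n - w)) \<longlonglongrightarrow> 0"
  shows "(\<lambda>n. potential (v n)) \<longlonglongrightarrow> potential w"
proof -
  obtain R where R: "\<And>n. energy (v n) \<le> R"
    using converges_in_W(2)[OF assms] by blast
  show ?thesis
    unfolding potential_def
    by (intro tendsto_mult_left H_comp_tendsto[OF W_measurable[OF v] W_bounded[OF v R] W_measurable[OF w]
        sup_bound_pos converges_in_W(1)[OF assms]])
qed

lemma potential_derivative: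
  assumes v: "\<And>n. v n \<in> W" "\<And>n. energy (v n) \<le> R" and d: "\<And>n. d n \<in> W" "\<And>n. energy (d n) \<le> R"
    and \<tau>: "\<And>n. 0 < \<tau> n" "\<tau> \<longlonglongrightarrow> 0"
  shows "(\<lambda>n. (potential (v n + \<tau> n *\<^sub>R d n) - potential (v n)) / \<tau> n - load (v n) (d n)) \<longlonglongrightarrow> 0"
proof -
  let ?M = "lebesgue_on \<Omega>"
  have "Bseq \<tau>"
    by (rule convergent_imp_Bseq[OF convergentI[OF \<tau>(2)]])
  then obtain T where T: "\<And>n. \<tau> n \<le> T"
    unfolding Bseq_def by (auto simp: abs_le_iff)
  have eq: "(potential (v n + \<tau> n *\<^sub>R d n) - potential (v n)) / \<tau> n - load (v n) (d n) =
      lam * (LINT x|?M. (primitive h x (v n x + \<tau> n * d n x) - primitive h x (v n x)) / \<tau> n - h x (v n x) * d n x)"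
    for n
  proof -
    have sum: "v n + \<tau> n *\<^sub>R d n \<in> W"
      using v(1) d(1) by (intro W_add W_scale)
    have int1: "integrable ?M (\<lambda>x. primitive h x ((v n + \<tau> n *\<^sub>R d n) x))"
      by (rule H_comp_integrable[OF W_measurable[OF sum] W_bounded[OF sum order_refl] sup_bound_pos])
    have int2: "integrable ?M (\<lambda>x. primitive h x (v n x))"
      by (rule H_comp_integrable[OF W_measurable[OF v(1)] W_bounded[OF v(1) order_refl] sup_bound_pos])
    have int3: "integrable ?M (\<lambda>x. h x (v n x) * d n x)"
      by (intro integrable_times_W h_integrable v d)
    have "(LINT x|?M. (primitive h x ((v n + \<tau> n *\<^sub>R d n) x) - primitive h x (v n x)) / \<tau> n - h x (v n x) * d n x) =
        (LINT x|?M. (primitive h x ((v n + \<tau> n *\<^sub>R d n) x) - primitive h x (v n x)) / \<tau> n) - (LINT x|?M. h x (v n x) * d n x)"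
      by (intro Bochner_Integration.integral_diff integrable_divide int1 int2 int3
          Bochner_Integration.integrable_diff)
    also have "(LINT x|?M. (primitive h x ((v n + \<tau> n *\<^sub>R d n) x) - primitive h x (v n x)) / \<tau> n) =
        (LINT x|?M. primitive h x ((v n + \<tau> n *\<^sub>R d n) x) - primitive h x (v n x)) / \<tau> n"
      by (rule Bochner_Integration.integral_divide_zero)
    also have "(LINT x|?M. primitive h x ((v n + \<tau> n *\<^sub>R d n) x) - primitive h x (v n x)) =
        (LINT x|?M. primitive h x ((v n + \<tau> n *\<^sub>R d n) x)) - (LINT x|?M. primitive h x (v n x))"
      by (rule Bochner_Integration.integral_diff[OF int1 int2])
    finally show ?thesis
      by (simp add: potential_def load_def right_diff_distrib)
  qed
  have "(\<lambda>n. lam * (LINT x|?M. (primitive h x (v n x + \<tau> n * d n x) - primitive h x (v n x)) / \<tau> n -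
      h x (v n x) * d n x)) \<longlonglongrightarrow> lam * 0"
    by (intro tendsto_mult_left H_quotient_tendsto[OF W_measurable[OF v(1)] W_bounded[OF v]
        W_measurable[OF d(1)] W_bounded[OF d] sup_bound_pos \<tau>(1) T \<tau>(2)])
  then show ?thesis
    unfolding eq by simp
qed

sublocale compact_potential W energy p potential load
proof unfold_locales
  show "load u (v + w) = load u v + load u w" if "u \<in> W" "v \<in> W" "w \<in> W" for u v w
    using that by (rule load_add)
  show "load u (k *\<^sub>R v) = k * load u v" for u v k
    by (rule load_scale)
  show "\<exists>C\<ge>0. \<forall>u\<in>W. energy u \<le> R \<longrightarrow> (\<forall>v\<in>W. \<bar>load u v\<bar> \<le> C * nrm v)" for R
    by (rule load_bounded)
  show "(\<lambda>n. (potential (v n + \<tau> n *\<^sub>R d n) - potential (v n)) / \<tau> n - load (v n) (d n)) \<longlonglongrightarrow> 0"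
    if "\<And>n. v n \<in> W" "\<And>n. d n \<in> W" "\<And>n. energy (v n) \<le> R" "\<And>n. energy (d n) \<le> R"
      "\<And>n. 0 < \<tau> n" "\<tau> \<longlonglongrightarrow> 0" for v d R \<tau>
    using that(1,3,2,4,5,6) by (rule potential_derivative)
qed (fact load_compact load_continuous potential_continuous)+

end

section \<open>Equilibria are weak solutions\<close>

lemma abs_powr_has_derivative:
  fixes t p :: real
  assumes p: "1 < p"
  shows "((\<lambda>t. \<bar>t\<bar> powr p) has_real_derivative p * p_pow p t) (at t)"
proof -
  consider "0 < t" | "t < 0" | "t = 0"
    by linarith
  then show ?thesis
  proof cases
    case 1
    have "((\<lambda>t. t powr p) has_real_derivative p * t powr (p - 1)) (at t)"
      by (rule has_real_derivative_powr[OF 1])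
    moreover have "t powr (p - 1) = t powr (p - 2) * t"
      using 1 powr_add[of t "p - 2" 1] by simp
    ultimately have "((\<lambda>t. t powr p) has_real_derivative p * p_pow p t) (at t)"
      using 1 by (simp add: p_pow_def)
    then show ?thesis
      by (rule has_field_derivative_transform_within_open[of _ _ _ "{0<..}"]) (use 1 in auto)
  next
    case 2
    have "((\<lambda>t. (- t) powr p) has_real_derivative p * (- t) powr (p - 1) * (- 1)) (at t)"
      by (rule DERIV_chain2[OF has_real_derivative_powr]) (use 2 in \<open>auto intro!: derivative_eq_intros\<close>)
    moreover have "(- t) powr (p - 1) = (- t) powr (p - 2) * (- t)"
      using 2 powr_add[of "- t" "p - 2" 1] by simp
    ultimately have "((\<lambda>t. (- t) powr p) has_real_derivative p * p_pow p t) (at t)"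
      using 2 by (simp add: p_pow_def)
    then show ?thesis
      by (rule has_field_derivative_transform_within_open[of _ _ _ "{..<0}"]) (use 2 in auto)
  next
    case 3
    have "((\<lambda>h. \<bar>h\<bar> powr p / h) \<longlongrightarrow> 0) (at 0)"
    proof (rule Lim_null_comparison)
      have "((\<lambda>h::real. \<bar>h\<bar> powr (p - 1)) \<longlongrightarrow> \<bar>0\<bar> powr (p - 1)) (at 0)"
        using p by (intro tendsto_powr' tendsto_rabs tendsto_ident_at tendsto_const) auto
      then show "((\<lambda>h::real. \<bar>h\<bar> powr (p - 1)) \<longlongrightarrow> 0) (at 0)"
        by simp
      have "norm (\<bar>h\<bar> powr p / h) \<le> \<bar>h\<bar> powr (p - 1)" if "h \<noteq> 0" for h :: real
        using that by (simp add: powr_diff)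
      then show "\<forall>\<^sub>F h in at 0. norm (\<bar>h\<bar> powr p / h) \<le> \<bar>h\<bar> powr (p - 1)"
        by (auto simp: eventually_at_filter)
    qed
    then show ?thesis
      using 3 by (simp add: DERIV_def p_pow_def)
  qed
qed

lemma abs_p_pow: "1 < p \<Longrightarrow> \<bar>p_pow p t\<bar> = \<bar>t\<bar> powr (p - 1)"
proof -
  assume "1 < p"
  then show ?thesis
    using powr_add[of "\<bar>t\<bar>" "p - 2" 1] by (cases "t = 0") (auto simp: p_pow_def abs_mult)
qed

text \<open>
  By the mean value theorem the quotient equals \<open>p_pow p z * y\<close> with \<open>\<bar>z\<bar> \<le> 2 * max \<bar>x\<bar> \<bar>y\<bar>\<close>.
\<close>

lemma abs_powr_quotient_bound:
  fixes x y e p :: real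
  assumes p: "1 < p" and e: "0 < e" "e \<le> 1"
  shows "\<bar>(\<bar>x + e * y\<bar> powr p - \<bar>x\<bar> powr p) / (p * e)\<bar> \<le> 2 powr p * (\<bar>x\<bar> powr p + \<bar>y\<bar> powr p)"
proof -
  have mean: "\<exists>z. \<bar>z\<bar> \<le> \<bar>u\<bar> + \<bar>w - u\<bar> \<and> \<bar>w\<bar> powr p - \<bar>u\<bar> powr p = (w - u) * (p * p_pow p z)" for u w :: real
  proof -
    consider "u < w" | "w < u" | "w = u"
      by linarith
    then show ?thesis
    proof cases
      case 1
      from MVT2[OF this abs_powr_has_derivative[OF p]] obtain z
        where "u < z" "z < w" "\<bar>w\<bar> powr p - \<bar>u\<bar> powr p = (w - u) * (p * p_pow p z)"
        by blast
      then show ?thesis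
        by (intro exI[of _ z]) auto
    next
      case 2
      from MVT2[OF this abs_powr_has_derivative[OF p]] obtain z
        where z: "w < z" "z < u" "\<bar>u\<bar> powr p - \<bar>w\<bar> powr p = (u - w) * (p * p_pow p z)"
        by blast
      then have "\<bar>w\<bar> powr p - \<bar>u\<bar> powr p = (w - u) * (p * p_pow p z)"
        by (simp add: left_diff_distrib)
      with z show ?thesis
        by (intro exI[of _ z]) auto
    qed (intro exI[of _ u], auto)
  qed
  obtain z where z: "\<bar>z\<bar> \<le> \<bar>x\<bar> + \<bar>(x + e * y) - x\<bar>"
    "\<bar>x + e * y\<bar> powr p - \<bar>x\<bar> powr p = ((x + e * y) - x) * (p * p_pow p z)"
    using mean by blast
  define m where "m = max \<bar>x\<bar> \<bar>y\<bar>"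
  have "\<bar>e * y\<bar> \<le> \<bar>y\<bar>"
    using e by (simp add: abs_mult mult_left_le_one_le)
  then have zm: "\<bar>z\<bar> \<le> 2 * m"
    using z(1) by (simp add: m_def)
  have "(\<bar>x + e * y\<bar> powr p - \<bar>x\<bar> powr p) / (p * e) = y * p_pow p z"
    unfolding z(2) using p e by simp
  then have "\<bar>(\<bar>x + e * y\<bar> powr p - \<bar>x\<bar> powr p) / (p * e)\<bar> = \<bar>y\<bar> * \<bar>z\<bar> powr (p - 1)"
    using abs_p_pow[OF p] by (simp add: abs_mult)
  also have "\<dots> \<le> (2 * m) * (2 * m) powr (p - 1)"
    using zm p by (intro mult_mono powr_mono2) (auto simp: m_def)
  also have "\<dots> = (2 * m) powr p"
    using p by (cases "m = 0") (auto simp: powr_diff m_def)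
  also have "\<dots> = 2 powr p * m powr p"
    by (rule powr_mult)
  also have "m powr p \<le> \<bar>x\<bar> powr p + \<bar>y\<bar> powr p"
    by (auto simp: m_def max_def)
  finally show ?thesis
    by (simp add: mult_left_mono)
qed

text \<open>
  The directional derivative of a weighted \<open>p\<close>-th power integral; the quotients are dominated by
  the energies of the two functions.
\<close>

lemma weighted_power_integral_derivative:
  fixes f g w :: "'b \<Rightarrow> real"
  assumes p: "1 < p" and [measurable]: "w \<in> borel_measurable M" "f \<in> borel_measurable M" "g \<in> borel_measurable M"
    and f: "integrable M (\<lambda>z. w z * \<bar>f z\<bar> powr p)" and g: "integrable M (\<lambda>z. w z * \<bar>g z\<bar> powr p)"
    and e: "\<And>n::nat. 0 < e n" "\<And>n. e n \<le> 1" "e \<longlonglongrightarrow> 0" and w: "AE z in M. 0 \<le> w z"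
  shows "(\<lambda>n. LINT z|M. w z * ((\<bar>f z + e n * g z\<bar> powr p - \<bar>f z\<bar> powr p) / (p * e n))) \<longlonglongrightarrow>
      (LINT z|M. w z * (p_pow p (f z) * g z))"
proof (rule integral_dominated_convergence[where w = "\<lambda>z. 2 powr p * (w z * \<bar>f z\<bar> powr p + w z * \<bar>g z\<bar> powr p)"])
  show "(\<lambda>z. w z * (p_pow p (f z) * g z)) \<in> borel_measurable M"
    unfolding p_pow_def by measurable
  show "(\<lambda>z. w z * ((\<bar>f z + e n * g z\<bar> powr p - \<bar>f z\<bar> powr p) / (p * e n))) \<in> borel_measurable M" for n
    by measurable
  show "integrable M (\<lambda>z. 2 powr p * (w z * \<bar>f z\<bar> powr p + w z * \<bar>g z\<bar> powr p))"
    by (intro integrable_mult_right Bochner_Integration.integrable_add f g)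
  show "AE z in M. (\<lambda>n. w z * ((\<bar>f z + e n * g z\<bar> powr p - \<bar>f z\<bar> powr p) / (p * e n))) \<longlonglongrightarrow>
      w z * (p_pow p (f z) * g z)"
  proof (rule AE_I2)
    fix z
    have "((\<lambda>t. \<bar>f z + t * g z\<bar> powr p) has_real_derivative (p * p_pow p (f z + 0 * g z)) * g z) (at 0)"
      by (rule DERIV_chain2[OF abs_powr_has_derivative[OF p]]) (auto intro!: derivative_eq_intros)
    then have "((\<lambda>t. (\<bar>f z + t * g z\<bar> powr p - \<bar>f z\<bar> powr p) / t) \<longlongrightarrow> p * p_pow p (f z) * g z) (at 0)"
      by (simp add: DERIV_def)
    moreover have "filterlim e (at 0) sequentially"
      unfolding filterlim_at using e by (auto intro!: always_eventually simp: less_imp_neq[THEN not_sym])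
    ultimately have "(\<lambda>n. (\<bar>f z + e n * g z\<bar> powr p - \<bar>f z\<bar> powr p) / e n) \<longlonglongrightarrow> p * p_pow p (f z) * g z"
      by (rule filterlim_compose)
    then have lim: "(\<lambda>n. w z * (((\<bar>f z + e n * g z\<bar> powr p - \<bar>f z\<bar> powr p) / e n) / p)) \<longlonglongrightarrow>
        w z * ((p * p_pow p (f z) * g z) / p)"
      using p by (intro tendsto_intros) auto
    have limit: "(p * p_pow p (f z) * g z) / p = p_pow p (f z) * g z"
      using p by simp
    have quotient: "((\<bar>f z + e n * g z\<bar> powr p - \<bar>f z\<bar> powr p) / e n) / p =
        (\<bar>f z + e n * g z\<bar> powr p - \<bar>f z\<bar> powr p) / (p * e n)" for n
      by (simp add: mult.commute)
    show "(\<lambda>n. w z * ((\<bar>f z + e n * g z\<bar> powr p - \<bar>f z\<bar> powr p) / (p * e n))) \<longlonglongrightarrow>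
        w z * (p_pow p (f z) * g z)"
      using lim unfolding limit quotient .
  qed
  show "AE z in M. norm (w z * ((\<bar>f z + e n * g z\<bar> powr p - \<bar>f z\<bar> powr p) / (p * e n)))
      \<le> 2 powr p * (w z * \<bar>f z\<bar> powr p + w z * \<bar>g z\<bar> powr p)" for n
    using w
  proof eventually_elim
    case (elim z)
    have "\<bar>w z * ((\<bar>f z + e n * g z\<bar> powr p - \<bar>f z\<bar> powr p) / (p * e n))\<bar> =
        w z * \<bar>(\<bar>f z + e n * g z\<bar> powr p - \<bar>f z\<bar> powr p) / (p * e n)\<bar>"
      using elim by (simp only: abs_mult abs_of_nonneg)
    also have "\<dots> \<le> w z * (2 powr p * (\<bar>f z\<bar> powr p + \<bar>g z\<bar> powr p))"
      by (intro mult_left_mono abs_powr_quotient_bound p e elim)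
    finally show ?case
      by (simp add: distrib_left mult.left_commute)
  qed
qed

context fractional_energy
begin

text \<open>
  The directional derivative of \<open>energy u / p\<close> in the direction \<open>v\<close>, that is, the left-hand side of the
  weak formulation.
\<close>

definition gradient :: "('a \<Rightarrow> real) \<Rightarrow> ('a \<Rightarrow> real) \<Rightarrow> real" where
  "gradient u v = (LINT x|lebesgue_on \<Omega>. a x * (p_pow p (u x) * v x)) +
    (LINT z|pairs. kernel z * (p_pow p (increment u z) * increment v z))"

lemma local_integrable:
  assumes u: "u \<in> W"
  shows "integrable (lebesgue_on \<Omega>) (\<lambda>x. a x * \<bar>u x\<bar> powr p)"
proof (rule integrableI_nonneg)
  show "(\<lambda>x. a x * \<bar>u x\<bar> powr p) \<in> borel_measurable (lebesgue_on \<Omega>)"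
    using restrict_measurable[OF W_D(1)[OF u]] by measurable
  show "AE x in lebesgue_on \<Omega>. 0 \<le> a x * \<bar>u x\<bar> powr p"
    using AE_a_pos by eventually_elim simp
  show "(\<integral>\<^sup>+x. ennreal (a x * \<bar>u x\<bar> powr p) \<partial>lebesgue_on \<Omega>) < \<infinity>"
    using local_energy_le[OF W_D(1)[OF u]] W_D(2)[OF u] by (rule le_less_trans)
qed

lemma nonlocal_integrable:
  assumes u: "u \<in> W"
  shows "integrable pairs (\<lambda>z. kernel z * \<bar>increment u z\<bar> powr p)"
proof (rule integrableI_nonneg)
  show "(\<lambda>z. kernel z * \<bar>increment u z\<bar> powr p) \<in> borel_measurable pairs"
    using increment_measurable[OF W_D(1)[OF u]] by measurable
  show "AE z in pairs. 0 \<le> kernel z * \<bar>increment u z\<bar> powr p"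
    by (intro AE_I2 mult_nonneg_nonneg kernel_nonneg) simp
  show "(\<integral>\<^sup>+z. ennreal (kernel z * \<bar>increment u z\<bar> powr p) \<partial>pairs) < \<infinity>"
    using nonlocal_energy_le[OF W_D(1)[OF u]] W_D(2)[OF u] by (rule le_less_trans)
qed

lemma energy_eq_integrals:
  assumes u: "u \<in> W"
  shows "energy u = (LINT x|lebesgue_on \<Omega>. a x * \<bar>u x\<bar> powr p) +
    (LINT z|pairs. kernel z * \<bar>increment u z\<bar> powr p)"
proof -
  have "AE x in lebesgue_on \<Omega>. 0 \<le> a x * \<bar>u x\<bar> powr p"
    using AE_a_pos by eventually_elim simp
  then have 1: "(\<integral>\<^sup>+x. ennreal (a x * \<bar>u x\<bar> powr p) \<partial>lebesgue_on \<Omega>) =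
      ennreal (LINT x|lebesgue_on \<Omega>. a x * \<bar>u x\<bar> powr p)" "0 \<le> (LINT x|lebesgue_on \<Omega>. a x * \<bar>u x\<bar> powr p)"
    by (auto intro: nn_integral_eq_integral local_integrable[OF u] integral_nonneg_AE)
  have "AE z in pairs. 0 \<le> kernel z * \<bar>increment u z\<bar> powr p"
    by (intro AE_I2 mult_nonneg_nonneg kernel_nonneg) simp
  then have 2: "(\<integral>\<^sup>+z. ennreal (kernel z * \<bar>increment u z\<bar> powr p) \<partial>pairs) =
      ennreal (LINT z|pairs. kernel z * \<bar>increment u z\<bar> powr p)" "0 \<le> (LINT z|pairs. kernel z * \<bar>increment u z\<bar> powr p)"
    by (auto intro: nn_integral_eq_integral nonlocal_integrable[OF u] integral_nonneg_AE)
  have "W_energy \<Omega> a s p u = ennreal ((LINT x|lebesgue_on \<Omega>. a x * \<bar>u x\<bar> powr p) +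
    (LINT z|pairs. kernel z * \<bar>increment u z\<bar> powr p))"
    unfolding W_energy_eq[OF W_D(1)[OF u]] 1(1) 2(1) using 1(2) 2(2) by (rule ennreal_plus[symmetric])
  then show ?thesis
    unfolding energy_def by (simp only: enn2real_ennreal[OF add_nonneg_nonneg[OF 1(2) 2(2)]])
qed

lemma energy_quotient_tendsto:
  assumes u: "u \<in> W" and v: "v \<in> W" and e: "\<And>n::nat. 0 < e n" "\<And>n. e n \<le> 1" "e \<longlonglongrightarrow> 0"
  shows "(\<lambda>n. (energy (u + e n *\<^sub>R v) - energy u) / (p * e n)) \<longlonglongrightarrow> gradient u v"
proof -
  have p: "1 < p"
    using p_ge_2' by simp
  have sum: "u + e n *\<^sub>R v \<in> W" for n
    using u v by (intro W_add W_scale)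
  let ?l = "\<lambda>n x. a x * ((\<bar>u x + e n * v x\<bar> powr p - \<bar>u x\<bar> powr p) / (p * e n))"
  let ?n = "\<lambda>n z. kernel z * ((\<bar>increment u z + e n * increment v z\<bar> powr p - \<bar>increment u z\<bar> powr p) / (p * e n))"
  have l: "(LINT x|lebesgue_on \<Omega>. ?l n x) = ((LINT x|lebesgue_on \<Omega>. a x * \<bar>(u + e n *\<^sub>R v) x\<bar> powr p) -
      (LINT x|lebesgue_on \<Omega>. a x * \<bar>u x\<bar> powr p)) / (p * e n)" for n
    unfolding Bochner_Integration.integral_diff[OF local_integrable[OF sum] local_integrable[OF u], symmetric]
      Bochner_Integration.integral_divide_zero[symmetric]
    by (simp add: right_diff_distrib)
  have n: "(LINT z|pairs. ?n n z) = ((LINT z|pairs. kernel z * \<bar>increment (u + e n *\<^sub>R v) z\<bar> powr p) -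
      (LINT z|pairs. kernel z * \<bar>increment u z\<bar> powr p)) / (p * e n)" for n
    unfolding Bochner_Integration.integral_diff[OF nonlocal_integrable[OF sum] nonlocal_integrable[OF u], symmetric]
      Bochner_Integration.integral_divide_zero[symmetric]
    by (simp add: right_diff_distrib)
  have eq: "(energy (u + e n *\<^sub>R v) - energy u) / (p * e n) =
      (LINT x|lebesgue_on \<Omega>. ?l n x) + (LINT z|pairs. ?n n z)" for n
    unfolding l n energy_eq_integrals[OF sum] energy_eq_integrals[OF u] add_divide_distrib[symmetric]
    by (simp only: add_diff_add)
  have "AE x in lebesgue_on \<Omega>. 0 \<le> a x"
    using AE_a_pos by eventually_elim simp
  then have "(\<lambda>n. LINT x|lebesgue_on \<Omega>. ?l n x) \<longlonglongrightarrow> (LINT x|lebesgue_on \<Omega>. a x * (p_pow p (u x) * v x))"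
    by (intro weighted_power_integral_derivative p a_measurable restrict_measurable W_D(1) u v e
        local_integrable)
  moreover have "(\<lambda>n. LINT z|pairs. ?n n z) \<longlonglongrightarrow>
      (LINT z|pairs. kernel z * (p_pow p (increment u z) * increment v z))"
    by (intro weighted_power_integral_derivative p kernel_measurable increment_measurable W_D(1) u v e
        nonlocal_integrable AE_I2 kernel_nonneg)
  ultimately show ?thesis
    unfolding eq gradient_def by (rule tendsto_add)
qed

lemma gradient_minus: "gradient u (-1 *\<^sub>R v) = - gradient u v"
proof -
  have 1: "increment (-1 *\<^sub>R v) z = - increment v z" for z
    unfolding increment_simps by simp
  have 2: "(-1 *\<^sub>R v) x = - v x" for x
    by simp
  show ?thesis
    unfolding gradient_def 1 2 by simp
qed

end

context superposition
begin

text \<open>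
  Minimality of \<open>u\<close> bounds the load from above by the difference quotients of the energy, hence by the
  gradient, in every direction; the directions \<open>v\<close> and \<open>-v\<close> together give equality.
\<close>

lemma equilibrium_imp_gradient_eq_load:
  assumes u: "equilibrium u" and v: "v \<in> W"
  shows "gradient u v = load u v"
proof -
  have uW: "u \<in> W"
    using u by (simp add: equilibrium_def)
  have ge: "load u z \<le> gradient u z" if z: "z \<in> W" for z
  proof -
    define e where "e n = 1 / real (Suc n)" for n
    have e: "\<And>n. 0 < e n" "\<And>n. e n \<le> 1" "e \<longlonglongrightarrow> 0"
      unfolding e_def using LIMSEQ_Suc[OF lim_1_over_n] by auto
    have "load u z \<le> (energy (u + e n *\<^sub>R z) - energy u) / (p * e n)" for n
    proof -
      have "u + e n *\<^sub>R z \<in> W"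
        using uW z by (intro W_add W_scale)
      then have "energy u / p - load u u \<le> energy (u + e n *\<^sub>R z) / p - load u (u + e n *\<^sub>R z)"
        using u by (simp add: equilibrium_def)
      also have "load u (u + e n *\<^sub>R z) = load u u + e n * load u z"
        using uW z by (simp add: load_add load_scale W_scale)
      finally have "e n * load u z \<le> (energy (u + e n *\<^sub>R z) - energy u) / p"
        unfolding diff_divide_distrib by linarith
      then have "load u z \<le> (energy (u + e n *\<^sub>R z) - energy u) / p / e n"
        unfolding pos_le_divide_eq[OF e(1)] by (simp only: mult.commute)
      then show ?thesis
        by (simp only: divide_divide_eq_left)
    qed
    then show ?thesis
      by (intro LIMSEQ_le_const[OF energy_quotient_tendsto[OF uW z e]]) blast
  qed
  have "load u (-1 *\<^sub>R v) \<le> gradient u (-1 *\<^sub>R v)"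
    by (intro ge W_scale v)
  then have "gradient u v \<le> load u v"
    unfolding gradient_minus load_scale by simp
  with ge[OF v] show ?thesis
    by simp
qed

lemma equilibrium_imp_weak_solution:
  assumes u: "equilibrium u"
  shows "weak_solution \<Omega> a s p lam h u"
  unfolding weak_solution_def
proof (intro conjI ballI)
  show "u \<in> W"
    using u by (simp add: equilibrium_def)
  fix v
  assume v: "v \<in> W"
  have "1 / 2 * (LINT (x, y) : T_set \<Omega> | pairs.
        p_pow p (u x - u y) * (v x - v y) / norm (x - y) powr (real DIM('a) + p * s)) =
      (LINT z|pairs. kernel z * (p_pow p (increment u z) * increment v z))"
    unfolding set_lebesgue_integral_def integral_mult_right_zero[symmetric]
    by (intro Bochner_Integration.integral_cong refl)
      (simp add: kernel_def increment_def case_prod_beta indicator_def mult.commute[of p s])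
  moreover have "(LINT x|lebesgue_on \<Omega>. a x * p_pow p (u x) * v x) =
      (LINT x|lebesgue_on \<Omega>. a x * (p_pow p (u x) * v x))"
    by (simp only: mult.assoc)
  ultimately show "1 / 2 * (LINT (x, y) : T_set \<Omega> | pairs.
        p_pow p (u x - u y) * (v x - v y) / norm (x - y) powr (real DIM('a) + p * s)) +
      (LINT x|lebesgue_on \<Omega>. a x * p_pow p (u x) * v x) = lam * (LINT x|lebesgue_on \<Omega>. h x (u x) * v x)"
    using equilibrium_imp_gradient_eq_load[OF u v] by (simp add: gradient_def load_def add.commute)
qed

text \<open>
  The difference is the almost everywhere limit of the zero sequence, so its energy vanishes by lower
  semicontinuity, and both quantities are continuous in energy. This separates the three solutions
  as classes modulo equality almost everywhere.
\<close>

lemma AE_equal_imp_same_values: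
  assumes u: "u \<in> W" and v: "v \<in> W" and eq: "AE x in lebesgue. u x = v x"
  shows "energy u = energy v" and "I u = I v"
proof -
  have lim: "AE x in lebesgue. (\<lambda>k::nat. (0 :: 'a \<Rightarrow> real) x) \<longlonglongrightarrow> (u - v) x"
    using eq by eventually_elim simp
  have "W_energy \<Omega> a s p (u - v) \<le> ennreal 0 + ennreal 0"
    by (rule W_energy_le_if_AE_tendsto[OF W_0 W_D(1)[OF W_diff[OF u v]] lim])
      (rule always_eventually, simp only: E_0 order_refl simp_thms)
  then have zero: "energy (u - v) = 0"
    by (simp add: energy_def)
  have "(\<lambda>n::nat. energy u) \<longlonglongrightarrow> energy v"
    by (rule E_tendsto[OF u v]) (simp add: zero)
  then show "energy u = energy v"
    by (simp add: LIMSEQ_const_iff)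
  have "(\<lambda>n::nat. I u) \<longlonglongrightarrow> I v"
    by (rule I_tendsto[OF u v]) (simp add: zero)
  then show "I u = I v"
    by (simp add: LIMSEQ_const_iff)
qed

end

section \<open>The embedding constant and the growth of the functional\<close>

context fractional_energy
begin

lemma W_norm_eq_nrm: "W_norm \<Omega> a s p u = nrm u"
  by (simp add: W_norm_def nrm_def energy_def)

lemma a_integrable: "integrable (lebesgue_on \<Omega>) a"
proof -
  obtain K where K: "Linfty_norm \<Omega> a \<le> ereal K"
    using a_Linfty by (cases "Linfty_norm \<Omega> a") (auto simp: in_Linfty_def)
  have "AE x in lebesgue_on \<Omega>. ereal \<bar>a x\<bar> \<le> Linfty_norm \<Omega> a"
    unfolding Linfty_norm_def by (rule esssup_AE)
  then have "AE x in lebesgue_on \<Omega>. \<bar>a x\<bar> \<le> K"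
  proof eventually_elim
    case (elim x)
    then have "ereal \<bar>a x\<bar> \<le> ereal K"
      using K by (rule order_trans)
    then show ?case
      by simp
  qed
  then show ?thesis
    by (rule integrable_if_bounded[OF a_measurable])
qed

lemma L1_norm_a: "L1_norm \<Omega> a = (LINT x|lebesgue_on \<Omega>. a x)" "0 \<le> L1_norm \<Omega> a"
proof -
  have "AE x in lebesgue_on \<Omega>. \<bar>a x\<bar> = a x"
    using AE_a_pos by eventually_elim simp
  then show "L1_norm \<Omega> a = (LINT x|lebesgue_on \<Omega>. a x)"
    unfolding L1_norm_def by (intro integral_cong_AE borel_measurable_abs a_measurable)
  show "0 \<le> L1_norm \<Omega> a"
    by (simp add: L1_norm_def)
qed

lemma W_energy_const: "W_energy \<Omega> a s p (\<lambda>x. k) = ennreal (\<bar>k\<bar> powr p * L1_norm \<Omega> a)"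
proof -
  have "AE x in lebesgue_on \<Omega>. 0 \<le> a x * \<bar>k\<bar> powr p"
    using AE_a_pos by eventually_elim simp
  then have "(\<integral>\<^sup>+x. ennreal (a x * \<bar>k\<bar> powr p) \<partial>lebesgue_on \<Omega>) = ennreal (LINT x|lebesgue_on \<Omega>. a x * \<bar>k\<bar> powr p)"
    by (intro nn_integral_eq_integral integrable_mult_left a_integrable)
  moreover have "(\<integral>\<^sup>+z. ennreal (kernel z * \<bar>increment (\<lambda>x. k) z\<bar> powr p) \<partial>pairs) = 0"
    by (simp add: increment_def)
  ultimately show ?thesis
    by (subst W_energy_eq) (simp_all add: L1_norm_a(1) mult.commute)
qed

lemma const_in_W: "(\<lambda>x. k) \<in> W" and energy_const: "energy (\<lambda>x. k) = \<bar>k\<bar> powr p * L1_norm \<Omega> a"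
  using L1_norm_a(2) by (simp_all add: W_space_def W_energy_const energy_def)

text \<open>
  An infinite supremum is converted to the constant \<open>0\<close>. A nonzero constant therefore equals the
  supremum, and it bounds every member of the space. A function of norm \<open>0\<close> that is not negligible on
  \<open>\<Omega>\<close> would make the quotient infinite.
\<close>

lemma embedding_if_const_nonzero:
  assumes c: "c = embedding_const \<Omega> a s p" "c \<noteq> 0"
  shows "0 < c" and "u \<in> W \<Longrightarrow> AE x in lebesgue_on \<Omega>. \<bar>u x\<bar> \<le> c * nrm u"
proof -
  define S where "S = (SUP u \<in> {u \<in> W. \<not> (AE x in lebesgue. u x = 0)}.
        Linfty_norm \<Omega> u / ereal (W_norm \<Omega> a s p u))"
  have S: "S = ereal c"
    using c unfolding embedding_const_def S_def[symmetric] by (cases S) auto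
  have nonzero: "AE x in lebesgue_on \<Omega>. \<bar>u x\<bar> \<le> c * nrm u"
    if u: "u \<in> W" "\<not> (AE x in lebesgue. u x = 0)" for u
  proof -
    let ?X = "Linfty_norm \<Omega> u"
    have "?X / ereal (W_norm \<Omega> a s p u) \<le> S"
      unfolding S_def using u by (intro SUP_upper) auto
    then have le: "?X / ereal (nrm u) \<le> ereal c"
      unfolding S W_norm_eq_nrm .
    have X: "?X \<le> ereal (c * nrm u)"
    proof (cases "nrm u = 0")
      case True
      have "?X \<le> 0"
      proof (rule ccontr)
        assume "\<not> ?X \<le> 0"
        then have "?X / ereal (nrm u) = \<infinity>"
          using True by (cases ?X) (auto simp: divide_ereal_def zero_ereal_def[symmetric])
        with le show False
          by simp
      qed
      then show ?thesis
        using True by (simp add: zero_ereal_def)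
    next
      case False
      then have "0 < ereal (nrm u)"
        using nrm_nonneg[of u] by (simp add: less_le)
      then have "?X \<le> ereal (nrm u) * ereal c"
        using le by (subst (asm) ereal_divide_le_pos) auto
      then show ?thesis
        by (simp add: mult.commute)
    qed
    have "AE x in lebesgue_on \<Omega>. ereal \<bar>u x\<bar> \<le> ?X"
      unfolding Linfty_norm_def by (rule esssup_AE)
    then show ?thesis
    proof eventually_elim
      case (elim x)
      then have "ereal \<bar>u x\<bar> \<le> ereal (c * nrm u)"
        using X by (rule order_trans)
      then show ?case
        by simp
    qed
  qed
  show c_pos: "0 < c"
  proof (rule ccontr)
    assume "\<not> 0 < c"
    then have neg: "c * nrm (\<lambda>x. 1) \<le> 0"
      by (intro mult_nonpos_nonneg) auto
    have "\<not> (AE x in (lebesgue :: 'a measure). (1 :: real) = 0)"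
    proof
      assume "AE x in (lebesgue :: 'a measure). (1 :: real) = 0"
      then have "AE x in lebesgue. x \<notin> \<Omega>"
        by eventually_elim simp
      with \<Omega>_not_negligible show False
        by blast
    qed
    from nonzero[OF const_in_W this] have "AE x in lebesgue. x \<in> \<Omega> \<longrightarrow> \<bar>1\<bar> \<le> c * nrm (\<lambda>x. 1)"
      unfolding AE_on_\<Omega> .
    then have "AE x in lebesgue. x \<notin> \<Omega>"
      by eventually_elim (use neg in auto)
    with \<Omega>_not_negligible show False
      by blast
  qed
  show "AE x in lebesgue_on \<Omega>. \<bar>u x\<bar> \<le> c * nrm u" if u: "u \<in> W"
  proof (cases "AE x in lebesgue. u x = 0")
    case True
    then have "AE x in lebesgue_on \<Omega>. u x = 0"
      unfolding AE_on_\<Omega> by eventually_elim simp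
    then show ?thesis
      by eventually_elim (use c_pos in simp)
  qed (rule nonzero[OF u])
qed

end

text \<open>
  Beyond the threshold \<open>(2 * p * B) powr (1 / (p - t))\<close> the left-hand side is at most
  \<open>n powr p / (2 * p)\<close>; up to it, \<open>n\<close> may be replaced by the threshold.
\<close>

lemma lower_power_absorbed:
  fixes n t p B :: real
  assumes t: "0 < t" "t < p" and B: "0 \<le> B" and n: "0 \<le> n"
  shows "B * n powr t \<le> n powr p / (2 * p) + B * ((2 * p * B) powr (1 / (p - t))) powr t"
proof -
  define N where "N = (2 * p * B) powr (1 / (p - t))"
  have p: "0 < p"
    using t by simp
  have "B * n powr t \<le> n powr p / (2 * p) + B * N powr t"
  proof (cases "n \<le> N")
    case True
    then have "B * n powr t \<le> B * N powr t"
      using n t B by (intro mult_left_mono powr_mono2) auto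
    moreover have "0 \<le> n powr p / (2 * p)"
      using p by simp
    ultimately show ?thesis
      by linarith
  next
    case False
    have "2 * p * B = N powr (p - t)"
      using t p B by (simp add: N_def powr_powr)
    also have "\<dots> \<le> n powr (p - t)"
      using False t by (intro powr_mono2) (auto simp: N_def)
    finally have "(2 * p * B) * n powr t \<le> n powr (p - t) * n powr t"
      by (intro mult_right_mono) auto
    also have "\<dots> = n powr p"
      by (simp add: powr_add[symmetric])
    finally have "B * n powr t \<le> n powr p / (2 * p)"
      using p by (simp add: pos_le_divide_eq mult.commute mult.left_commute)
    moreover have "0 \<le> B * N powr t"
      using B by simp
    ultimately show ?thesis
      by linarith
  qed
  then show ?thesis
    unfolding N_def .
qed

context superposition
begin

text \<open>The potential grows like the power \<open>t < p\<close> of the norm, so half of the energy dominates it.\<close>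

lemma functional_coercive:
  assumes t: "0 < t" "t < p" and \<mu>: "integrable (lebesgue_on \<Omega>) \<mu>"
    and growth: "AE x in lebesgue_on \<Omega>. \<forall>\<xi>. primitive h x \<xi> \<le> \<mu> x * (1 + \<bar>\<xi>\<bar> powr t)"
  obtains m where "\<And>u. u \<in> W \<Longrightarrow> energy u / (2 * p) - m \<le> I u"
proof -
  define A where "A = lam * (LINT x|lebesgue_on \<Omega>. \<bar>\<mu> x\<bar>)"
  define B where "B = A * c powr t"
  have A: "0 \<le> A"
    using lam_pos by (simp add: A_def)
  then have B: "0 \<le> B"
    by (simp add: B_def)
  define m where "m = A + B * ((2 * p * B) powr (1 / (p - t))) powr t"
  have "energy u / (2 * p) - m \<le> I u" if u: "u \<in> W" for u
  proof -
    let ?n = "nrm u"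
    have "(LINT x|lebesgue_on \<Omega>. primitive h x (u x)) \<le> (LINT x|lebesgue_on \<Omega>. \<bar>\<mu> x\<bar> * (1 + (c * ?n) powr t))"
    proof (rule integral_mono_AE)
      show "integrable (lebesgue_on \<Omega>) (\<lambda>x. primitive h x (u x))"
        by (rule H_comp_integrable[OF W_measurable[OF u] W_bounded[OF u order_refl] sup_bound_pos])
      show "integrable (lebesgue_on \<Omega>) (\<lambda>x. \<bar>\<mu> x\<bar> * (1 + (c * ?n) powr t))"
        by (intro integrable_mult_left integrable_abs \<mu>)
      show "AE x in lebesgue_on \<Omega>. primitive h x (u x) \<le> \<bar>\<mu> x\<bar> * (1 + (c * ?n) powr t)"
        using growth embedding[OF u]
      proof eventually_elim
        case (elim x)
        have "primitive h x (u x) \<le> \<mu> x * (1 + \<bar>u x\<bar> powr t)"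
          using elim by blast
        also have "\<dots> \<le> \<bar>\<mu> x\<bar> * (1 + (c * ?n) powr t)"
          using elim t by (intro mult_mono add_left_mono powr_mono2) auto
        finally show ?case .
      qed
    qed
    also have "\<dots> = (LINT x|lebesgue_on \<Omega>. \<bar>\<mu> x\<bar>) * (1 + (c * ?n) powr t)"
      by (rule Bochner_Integration.integral_mult_left_zero)
    finally have "potential u \<le> lam * ((LINT x|lebesgue_on \<Omega>. \<bar>\<mu> x\<bar>) * (1 + (c * ?n) powr t))"
      unfolding potential_def using lam_pos by (intro mult_left_mono) auto
    also have "\<dots> = A + B * ?n powr t"
      using c_pos by (simp add: A_def B_def powr_mult distrib_left mult.assoc)
    also have "\<dots> \<le> m + ?n powr p / (2 * p)"
      using lower_power_absorbed[OF t B nrm_nonneg[of u]] by (simp add: m_def)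
    finally have "potential u \<le> m + energy u / (2 * p)"
      by (simp only: nrm_powr)
    then have "energy u / p - (m + energy u / (2 * p)) \<le> I u"
      by (simp add: I_def)
    moreover have "energy u / p - energy u / (2 * p) = energy u / (2 * p)"
      using p_pos by (simp add: field_simps)
    ultimately show ?thesis
      by linarith
  qed
  then show ?thesis
    by (rule that)
qed

lemma H_le_Sup:
  assumes x: "continuous_on UNIV (h x)" and \<xi>: "\<bar>\<xi>\<bar> \<le> \<gamma>"
  shows "primitive h x \<xi> \<le> (SUP \<xi> \<in> {-\<gamma>..\<gamma>}. primitive h x \<xi>)"
proof (rule cSUP_upper)
  show "\<xi> \<in> {-\<gamma>..\<gamma>}"
    using \<xi> by (simp add: abs_le_iff)
  show "bdd_above (primitive h x ` {-\<gamma>..\<gamma>})"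
  proof (rule bdd_aboveI2)
    fix \<zeta>
    assume "\<zeta> \<in> {-\<gamma>..\<gamma>}"
    then have "\<bar>primitive h x \<zeta>\<bar> \<le> \<gamma> * envelope \<gamma> x"
      by (intro abs_H_le[OF x]) (simp add: abs_le_iff)
    then show "primitive h x \<zeta> \<le> \<gamma> * envelope \<gamma> x"
      by simp
  qed
qed

lemma integral_Sup_nonneg:
  assumes "0 < \<gamma>"
  shows "0 \<le> (LINT x|lebesgue_on \<Omega>. (SUP \<xi> \<in> {-\<gamma>..\<gamma>}. primitive h x \<xi>))"
proof (rule integral_nonneg_AE)
  show "AE x in lebesgue_on \<Omega>. 0 \<le> (SUP \<xi> \<in> {-\<gamma>..\<gamma>}. primitive h x \<xi>)"
    using AE_h_continuous
  proof eventually_elim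
    case (elim x)
    show ?case
      using H_le_Sup[OF elim, of 0 \<gamma>] assms by (simp add: H_0)
  qed
qed

text \<open>
  A function that is not integrable has the integral \<open>0\<close>. Hence \<open>\<Gamma> \<noteq> 0\<close> makes the supremum integrable,
  and the bound follows by monotonicity.
\<close>

lemma potential_le_Sup:
  assumes \<Gamma>: "\<Gamma> = (LINT x|lebesgue_on \<Omega>. (SUP \<xi> \<in> {-\<gamma>..\<gamma>}. primitive h x \<xi>))" "\<Gamma> \<noteq> 0"
    and u: "u \<in> W" "AE x in lebesgue_on \<Omega>. \<bar>u x\<bar> \<le> \<gamma>"
  shows "potential u \<le> lam * \<Gamma>"
proof -
  have "(LINT x|lebesgue_on \<Omega>. primitive h x (u x)) \<le> \<Gamma>"
    unfolding \<Gamma>(1)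
  proof (rule integral_mono_AE)
    show "integrable (lebesgue_on \<Omega>) (\<lambda>x. primitive h x (u x))"
      by (rule H_comp_integrable[OF W_measurable[OF u(1)] W_bounded[OF u(1) order_refl] sup_bound_pos])
    show "integrable (lebesgue_on \<Omega>) (\<lambda>x. SUP \<xi> \<in> {-\<gamma>..\<gamma>}. primitive h x \<xi>)"
      using \<Gamma> not_integrable_integral_eq by blast
    show "AE x in lebesgue_on \<Omega>. primitive h x (u x) \<le> (SUP \<xi> \<in> {-\<gamma>..\<gamma>}. primitive h x \<xi>)"
      using AE_h_continuous u(2) by eventually_elim (rule H_le_Sup)
  qed
  then show ?thesis
    unfolding potential_def using lam_pos by (intro mult_left_mono) auto
qed

lemma potential_0: "potential 0 = 0"
  by (simp add: potential_def H_0)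

end

section \<open>Three weak solutions\<close>

theorem theorem1p2:
  fixes \<Omega> :: "'a::euclidean_space set"
    and a \<mu> :: "'a \<Rightarrow> real"
    and h H :: "'a \<Rightarrow> real \<Rightarrow> real"
    and s p t \<gamma> \<eta> c \<Gamma> lam :: real
  assumes "\<Omega> \<noteq> {}" "open \<Omega>" "bounded \<Omega>" "C1_boundary \<Omega>"
    and "0 < s" "s < 1" "2 \<le> p" "real DIM('a) < s * p"
    and "in_Linfty \<Omega> a" "0 < ess_inf \<Omega> a"
    and c_def: "c = embedding_const \<Omega> a s p"
    and "caratheodory \<Omega> h"
    and "\<And>R. 0 < R \<Longrightarrow> integrable (lebesgue_on \<Omega>) (\<lambda>x. SUP \<xi> \<in> {-R..R}. \<bar>h x \<xi>\<bar>)"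
    and H_def: "H = primitive h"
    and "0 < t" "t < p" "integrable (lebesgue_on \<Omega>) \<mu>"
    and "AE x in lebesgue_on \<Omega>. \<forall>\<xi>. H x \<xi> \<le> \<mu> x * (1 + \<bar>\<xi>\<bar> powr t)"
    and "0 < \<gamma>" "\<gamma> < \<eta>"
    and \<Gamma>_def: "\<Gamma> = (LINT x|lebesgue_on \<Omega>. (SUP \<xi> \<in> {-\<gamma>..\<gamma>}. H x \<xi>))"
    and "\<Gamma> \<noteq> 0"
    and "(LINT x|lebesgue_on \<Omega>. H x \<eta>) / \<eta> powr p
           > (1 + c powr p * L1_norm \<Omega> a) * (\<Gamma> / \<gamma> powr p)"
    and "0 < lam"
    and "lam \<in> {\<eta> powr p * L1_norm \<Omega> a / (p * (LINT x|lebesgue_on \<Omega>. H x \<eta>) - p * \<Gamma>)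
                 <..< \<gamma> powr p / (p * c powr p * \<Gamma>)}"
  shows "\<exists>u1 u2 u3. weak_solution \<Omega> a s p lam h u1 \<and> weak_solution \<Omega> a s p lam h u2 \<and>
           weak_solution \<Omega> a s p lam h u3 \<and>
           \<not> (AE x in lebesgue. u1 x = u2 x) \<and> \<not> (AE x in lebesgue. u1 x = u3 x) \<and>
           \<not> (AE x in lebesgue. u2 x = u3 x)"
proof -
  note growth = assms(18)[unfolded H_def] and lam_range = assms(25)
  interpret fractional_energy \<Omega> a s p
    by unfold_locales (fact assms)+
  \<comment> \<open>For \<open>c = 0\<close> the upper bound on \<open>lam\<close> would be a quotient by \<open>0\<close>, that is, \<open>0\<close>.\<close>
  have "c \<noteq> 0"
  proof
    assume "c = 0"
    then have "\<gamma> powr p / (p * c powr p * \<Gamma>) = 0"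
      by simp
    with lam_range \<open>0 < lam\<close> show False
      by simp
  qed
  note emb = embedding_if_const_nonzero[OF c_def this]
  interpret superposition \<Omega> a s p c h lam
    by unfold_locales (fact assms emb)+
  define X where "X = (LINT x|lebesgue_on \<Omega>. H x \<eta>)"
  \<comment> \<open>The level of the energy up to which the embedding guarantees \<open>\<bar>u\<bar> \<le> \<gamma>\<close> on \<open>\<Omega>\<close>.\<close>
  define r where "r = \<gamma> powr p / (p * c powr p)"
  have cp: "0 < c powr p" and gp: "0 < \<gamma> powr p" and ep: "0 < \<eta> powr p"
    using c_pos \<open>0 < \<gamma>\<close> \<open>\<gamma> < \<eta>\<close> by auto
  have \<Gamma>: "0 < \<Gamma>"
    using integral_Sup_nonneg[OF \<open>0 < \<gamma>\<close>] \<open>\<Gamma> \<noteq> 0\<close> unfolding \<Gamma>_def H_def by linarith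
  have \<Gamma>_less: "\<Gamma> < X"
  proof -
    have "0 \<le> c powr p * L1_norm \<Omega> a * (\<Gamma> / \<gamma> powr p)"
      using \<Gamma> L1_norm_a(2) by simp
    then have "\<Gamma> / \<gamma> powr p \<le> (1 + c powr p * L1_norm \<Omega> a) * (\<Gamma> / \<gamma> powr p)"
      unfolding distrib_right mult_1_left by linarith
    also have "\<dots> < X / \<eta> powr p"
      using assms(23) unfolding X_def .
    finally have "\<Gamma> / \<gamma> powr p * \<eta> powr p < X"
      using ep by (simp only: pos_less_divide_eq)
    moreover have "\<Gamma> / \<gamma> powr p * \<gamma> powr p \<le> \<Gamma> / \<gamma> powr p * \<eta> powr p"
      using \<Gamma> gp \<open>0 < \<gamma>\<close> \<open>\<gamma> < \<eta>\<close> p_pos by (intro mult_left_mono powr_mono2) auto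
    ultimately show ?thesis
      using gp by simp
  qed
  have small: "AE x in lebesgue_on \<Omega>. \<bar>u x\<bar> \<le> \<gamma>" if u: "u \<in> W" "energy u / p \<le> r" for u
  proof -
    have "energy u \<le> r * p"
      using u(2) p_pos by (simp add: pos_divide_le_eq)
    also have "\<dots> = (\<gamma> / c) powr p"
      using p_pos c_pos \<open>0 < \<gamma>\<close> by (simp add: r_def powr_divide)
    finally have "nrm u \<le> \<gamma> / c"
      using c_pos \<open>0 < \<gamma>\<close> by (subst nrm_le_iff) auto
    then have "c * nrm u \<le> \<gamma>"
      using c_pos by (simp add: pos_le_divide_eq mult.commute)
    then show ?thesis
      using embedding[OF u(1)] by (auto elim: eventually_mono)
  qed
  have P_small: "potential u \<le> lam * \<Gamma>" if u: "u \<in> W" "energy u / p \<le> r" for u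
    by (rule potential_le_Sup[OF \<Gamma>_def[unfolded H_def] \<open>\<Gamma> \<noteq> 0\<close> u(1) small[OF u]])
  obtain m where m: "\<And>u. u \<in> W \<Longrightarrow> energy u / (2 * p) - m \<le> I u"
    using functional_coercive[OF \<open>0 < t\<close> \<open>t < p\<close> assms(17) growth] by blast
  obtain u1 u2 u3 where eq: "equilibrium u1" "equilibrium u2" "equilibrium u3"
    and ordered: "energy u1 < energy u2" "I u1 < I u3" "I u2 < I u3"
  proof (rule three_equilibria[of "- m" r "r - lam * \<Gamma>" "- (lam * \<Gamma>)" "\<lambda>x. \<eta>"])
    show "\<exists>R. \<forall>u\<in>W. I u \<le> b \<longrightarrow> energy u \<le> R" for b
    proof (intro exI ballI impI)
      fix u
      assume "u \<in> W" "I u \<le> b"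
      then have "energy u / (2 * p) \<le> b + m"
        using m[of u] by linarith
      then show "energy u \<le> (b + m) * (2 * p)"
        using p_pos by (simp only: pos_divide_le_eq mult_pos_pos zero_less_numeral)
    qed
    show "- m \<le> I u" if "u \<in> W" for u
    proof -
      have "0 \<le> energy u / (2 * p)"
        using energy_nonneg[of u] p_pos by simp
      then show ?thesis
        using m[OF that] by linarith
    qed
    show "r - lam * \<Gamma> \<le> I u" if "u \<in> W" "energy u / p = r" for u
      using P_small[of u] that by (simp add: I_def)
    show "0 \<le> r"
      using cp gp p_pos by (simp add: r_def)
    have "lam * \<Gamma> < r"
    proof -
      have "lam < r / \<Gamma>"
        using lam_range by (simp add: r_def)
      then show ?thesis
        using \<Gamma> by (simp only: pos_less_divide_eq)
    qed
    then show "I 0 < r - lam * \<Gamma>"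
      by (simp only: I_def E_0 potential_0)
    show "- (lam * \<Gamma>) \<le> I u" if "u \<in> W" "energy u / p \<le> r" for u
    proof -
      have "0 \<le> energy u / p"
        using energy_nonneg[of u] p_pos by simp
      then show ?thesis
        using P_small[OF that] unfolding I_def by linarith
    qed
    show "(\<lambda>x. \<eta>) \<in> W"
      by (rule const_in_W)
    show "I (\<lambda>x. \<eta>) < - (lam * \<Gamma>)"
    proof -
      have "0 < p * X - p * \<Gamma>"
        using \<Gamma>_less p_pos by simp
      moreover have "\<eta> powr p * L1_norm \<Omega> a / (p * X - p * \<Gamma>) < lam"
        using lam_range by (simp add: X_def)
      ultimately have "\<eta> powr p * L1_norm \<Omega> a < lam * (p * X - p * \<Gamma>)"
        by (simp only: pos_divide_less_eq)
      also have "\<dots> = (lam * X - lam * \<Gamma>) * p"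
        by (simp add: algebra_simps)
      finally have "\<eta> powr p * L1_norm \<Omega> a / p < lam * X - lam * \<Gamma>"
        using p_pos by (simp only: pos_divide_less_eq)
      moreover have "energy (\<lambda>x. \<eta>) = \<eta> powr p * L1_norm \<Omega> a"
        using \<open>0 < \<gamma>\<close> \<open>\<gamma> < \<eta>\<close> by (simp add: energy_const)
      moreover have "potential (\<lambda>x. \<eta>) = lam * X"
        by (simp add: potential_def X_def H_def)
      ultimately show ?thesis
        unfolding I_def by simp
    qed
  qed
  have in_W: "u1 \<in> W" "u2 \<in> W" "u3 \<in> W"
    using eq by (simp_all add: equilibrium_def)
  have "\<not> (AE x in lebesgue. u1 x = u2 x)" "\<not> (AE x in lebesgue. u1 x = u3 x)"
    "\<not> (AE x in lebesgue. u2 x = u3 x)"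
    using AE_equal_imp_same_values(1)[OF in_W(1,2)] AE_equal_imp_same_values(2)[OF in_W(1,3)]
      AE_equal_imp_same_values(2)[OF in_W(2,3)] ordered
    by fastforce+
  then show ?thesis
    using eq[THEN equilibrium_imp_weak_solution] by blast
qed

end
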